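(* Let $(W,S)$ be a Coxeter system and $m\in\mathbb N$. Consider the $m$-Shi arrangement $\operatorname{Shi}_m(W,S)=\{H_\beta\mid \beta\in\Sigma_m\}$ in the Tits cone of $(W,S)$. (1) Each region of $\operatorname{Shi}_m(W,S)$ contains a unique element of minimal length, i.e. among the elements $w\in W$ whose chamber $C_w$ is contained in a given region there is a unique one of minimal length $\ell(w)$. (2) The set of these minimal length elements (over all regions of $\operatorname{Shi}_m(W,S)$) is equal to the set $L_m$ of $m$-low elements.
   Context: Let $(W,S)$ be a Coxeter system with length function $\ell$. Fix a geometric representation: $W$ acts faithfully on a real vector space $V$ preserving a symmetric bilinear form $B$, each $s\in S$ acting as the $B$-reflection $v\mapsto v-2\frac{B(\alpha_s,v)}{B(\alpha_s,\alpha_s)}\alpha_s$ in a simple root $\alpha_s$, with $B(\alpha_s,\alpha_s)=1$; $\Delta=\{\alpha_s\mid s\in S\}$, root system $\Phi=W(\Delta)$, positive roots $\Phi^+=\Phi\cap\operatorname{cone}(\Delta)$ (nonnegative linear combinations), $\Phi^-=-\Phi^+$, $\Phi=\Phi^+\sqcup\Phi^-$. For $\beta\in\Phi$, $s_\beta$ denotes the corresponding reflection. The inversion set of $w\in W$ is $\Phi(w)=\Phi^+\cap w(\Phi^-)=\{\beta\in\Phi^+\mid \ell(s_\beta w)<\ell(w)\}$, and the short inversions are $\Phi^1(w)=\{\beta\in\Phi^+\mid \ell(s_\beta w)=\ell(w)-1\}$. Dominance order on $\Phi^+$: $\alpha\preceq_{\operatorname{dom}}\beta$ iff for every $w\in W$,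 $\beta\in\Phi(w)$ implies $\alpha\in\Phi(w)$. The dominance-depth of $\beta\in\Phi^+$ is $\operatorname{dp}_\infty(\beta)=|\{\alpha\in\Phi^+\setminus\{\beta\}\mid \alpha\preceq_{\operatorname{dom}}\beta\}|$. The set of $m$-small roots is $\Sigma_m=\{\beta\in\Phi^+\mid \operatorname{dp}_\infty(\beta)\le m\}$, and the set of $m$-low elements is $L_m=\{w\in W\mid \Phi^1(w)\subseteq\Sigma_m\}$. Geometric setting: $W$ acts on its Tits cone $\mathcal U$ (in the dual of $V$); the fundamental chamber is $C_e$, the chambers are $C_w=wC_e$ and $w\mapsto C_w$ is a bijection from $W$ to the set of chambers. For $\beta\in\Phi^+$, $H_\beta$ is the hyperplane (in $\mathcal U$) fixed by $s_\beta$; $H_\beta$ separates $C_w$ from $C_e$ if and only if $\beta\in\Phi(w)$. The regions of $\operatorname{Shi}_m(W,S)$ are unions of chambers, and two chambers $C_u,C_v$ lie in the same region iff no hyperplane $H_\beta$ with $\beta\in\Sigma_m$ separates them. *)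

theory Defs
  imports
    "HOL-Analysis.Analysis"
    "HOL-Algebra.Generated_Groups"
    "HOL-Algebra.Multiplicative_Group"
    "HOL-Library.Extended_Nat"
begin

section \<open>Coxeter systems\<close>

definition word_prod :: "('w, 'z) monoid_scheme \<Rightarrow> 'w list \<Rightarrow> 'w" where
  "word_prod W ws = foldr (\<lambda>x y. x \<otimes>\<^bsub>W\<^esub> y) ws \<one>\<^bsub>W\<^esub>"

text \<open>
  One insertion of a defining relator \<open>(s t)\<^sup>m\<close>, where \<open>m\<close> is the order of \<open>s t\<close> in \<open>W\<close>.
  The order \<open>group.ord\<close> is \<open>0\<close> for elements of infinite order, which contribute no relator.
  Taking \<open>t = s\<close> gives the relator \<open>s s\<close>.
\<close>
inductive relator_step :: "('w, 'z) monoid_scheme \<Rightarrow> 'w set \<Rightarrow> 'w list \<Rightarrow> 'w list \<Rightarrow> bool"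
  for W :: "('w, 'z) monoid_scheme" and S :: "'w set" where
  "s \<in> S \<Longrightarrow> t \<in> S \<Longrightarrow> group.ord W (s \<otimes>\<^bsub>W\<^esub> t) \<noteq> 0 \<Longrightarrow>
   relator_step W S (us @ vs)
     (us @ concat (replicate (group.ord W (s \<otimes>\<^bsub>W\<^esub> t)) [s, t]) @ vs)"

text \<open>
  The axiom \<open>presentation\<close> says that \<open>W\<close> is presented by the generators \<open>S\<close> and the relations
  \<open>(s t)\<^bsup>m(s,t)\<^esup> = 1\<close> for \<open>m(s,t) < \<infinity>\<close>.  Words without inverse letters suffice because each
  generator is an involution.  The set \<open>S\<close> may be infinite.
\<close>
locale coxeter_system = group W for W (structure) +
  fixes S :: "'a set"
  assumes generators_carrier: "S \<subseteq> carrier W"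
    and generators_ord: "s \<in> S \<Longrightarrow> ord s = 2"
    and generate: "generate W S = carrier W"
    and presentation: "us \<in> lists S \<Longrightarrow> vs \<in> lists S \<Longrightarrow> word_prod W us = word_prod W vs \<Longrightarrow>
          equivclp (relator_step W S) us vs"
begin

definition len :: "'a \<Rightarrow> nat" where
  "len w = (LEAST n. \<exists>ws \<in> lists S. length ws = n \<and> word_prod W ws = w)"

end


section \<open>Geometric representations and root systems\<close>

text \<open>
  \<open>\<alpha> s\<close> is the simple root of \<open>s \<in> S\<close>.  The axioms \<open>form_finite\<close> and \<open>form_infinite\<close> are the usual
  conditions on the values of the form at simple roots; \<open>B\<close> need not be the canonical form with
  value \<open>-1\<close> at pairs with \<open>m(s,t) = \<infinity>\<close>, and the simple roots need not be linearly independent.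
  The axiom \<open>chamber_nonempty\<close> says that the fundamental chamber in the dual space is nonempty.
  It is automatic when \<open>S\<close> is finite or the simple roots are linearly independent.
\<close>
locale geometric_representation = coxeter_system W S
  for W (structure) and S :: "'a set" +
  fixes act :: "'a \<Rightarrow> 'v::real_vector \<Rightarrow> 'v"
    and B :: "'v \<Rightarrow> 'v \<Rightarrow> real"
    and \<alpha> :: "'a \<Rightarrow> 'v"
  assumes act_linear: "w \<in> carrier W \<Longrightarrow> linear (act w)"
    and act_one: "act \<one> v = v"
    and act_mult: "u \<in> carrier W \<Longrightarrow> w \<in> carrier W \<Longrightarrow> act (u \<otimes> w) v = act u (act w v)"
    and act_faithful: "inj_on act (carrier W)"
    and form_bilinear: "bilinear B"
    and form_sym: "B x y = B y x"
    and form_invariant: "w \<in> carrier W \<Longrightarrow> B (act w x) (act w y) = B x y"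
    and form_unit: "s \<in> S \<Longrightarrow> B (\<alpha> s) (\<alpha> s) = 1"
    and act_simple: "s \<in> S \<Longrightarrow> act s v = v - (2 * (B (\<alpha> s) v / B (\<alpha> s) (\<alpha> s))) *\<^sub>R \<alpha> s"
    and form_finite: "s \<in> S \<Longrightarrow> t \<in> S \<Longrightarrow> s \<noteq> t \<Longrightarrow> ord (s \<otimes> t) \<noteq> 0 \<Longrightarrow>
          B (\<alpha> s) (\<alpha> t) = - cos (pi / real (ord (s \<otimes> t)))"
    and form_infinite: "s \<in> S \<Longrightarrow> t \<in> S \<Longrightarrow> ord (s \<otimes> t) = 0 \<Longrightarrow> B (\<alpha> s) (\<alpha> t) \<le> - 1"
    and roots_cover: "w \<in> carrier W \<Longrightarrow> s \<in> S \<Longrightarrow>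
          act w (\<alpha> s) \<in> (convex_cone hull (\<alpha> ` S)) \<union> uminus ` (convex_cone hull (\<alpha> ` S))"
    and roots_disjoint: "w \<in> carrier W \<Longrightarrow> s \<in> S \<Longrightarrow>
          act w (\<alpha> s) \<notin> (convex_cone hull (\<alpha> ` S)) \<inter> uminus ` (convex_cone hull (\<alpha> ` S))"
    and chamber_nonempty: "\<exists>f :: 'v \<Rightarrow> real. linear f \<and> (\<forall>s \<in> S. f (\<alpha> s) > 0)"
begin

definition simple_roots :: "'v set" where
  "simple_roots = \<alpha> ` S"

definition roots :: "'v set" where
  "roots = (\<Union>w \<in> carrier W. act w ` simple_roots)"

definition pos_roots :: "'v set" where
  "pos_roots = roots \<inter> (convex_cone hull simple_roots)"

definition neg_roots :: "'v set" where
  "neg_roots = uminus ` pos_roots"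

text \<open>
  For a root \<open>\<beta> = w (\<alpha> s)\<close> this is \<open>w s w\<^sup>-\<^sup>1\<close>; the element is unique because the action is faithful.
  Every root satisfies \<open>B \<beta> \<beta> = 1\<close>.
\<close>
definition reflection :: "'v \<Rightarrow> 'a" where
  "reflection \<beta> = (THE t. t \<in> carrier W \<and> (\<forall>v. act t v = v - (2 * (B \<beta> v / B \<beta> \<beta>)) *\<^sub>R \<beta>))"

definition inversions :: "'a \<Rightarrow> 'v set" where
  "inversions w = pos_roots \<inter> act w ` neg_roots"

definition short_inversions :: "'a \<Rightarrow> 'v set" where
  "short_inversions w = {\<beta> \<in> pos_roots. int (len (reflection \<beta> \<otimes> w)) = int (len w) - 1}"

definition dominated_by :: "'v \<Rightarrow> 'v \<Rightarrow> bool" where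
  "dominated_by \<gamma> \<beta> \<longleftrightarrow> (\<forall>w \<in> carrier W. \<beta> \<in> inversions w \<longrightarrow> \<gamma> \<in> inversions w)"

definition dominance_depth :: "'v \<Rightarrow> enat" where
  "dominance_depth \<beta> =
     (let D = {\<gamma> \<in> pos_roots - {\<beta>}. dominated_by \<gamma> \<beta>}
      in if finite D then enat (card D) else \<infinity>)"

definition small_roots :: "nat \<Rightarrow> 'v set" where
  "small_roots m = {\<beta> \<in> pos_roots. dominance_depth \<beta> \<le> enat m}"

definition low_elements :: "nat \<Rightarrow> 'a set" where
  "low_elements m = {w \<in> carrier W. short_inversions w \<subseteq> small_roots m}"


section \<open>Tits cone and Shi arrangements\<close>

text \<open>
  The dual of \<open>V\<close> is the set of linear functionals \<open>V \<Rightarrow> real\<close>, with the contragredient action.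
\<close>
definition dual_act :: "'a \<Rightarrow> ('v \<Rightarrow> real) \<Rightarrow> 'v \<Rightarrow> real" where
  "dual_act w f = (\<lambda>v. f (act (inv w) v))"

definition fund_chamber :: "('v \<Rightarrow> real) set" where
  "fund_chamber = {f. linear f \<and> (\<forall>\<delta> \<in> simple_roots. f \<delta> > 0)}"

definition closed_fund_chamber :: "('v \<Rightarrow> real) set" where
  "closed_fund_chamber = {f. linear f \<and> (\<forall>\<delta> \<in> simple_roots. f \<delta> \<ge> 0)}"

definition chamber :: "'a \<Rightarrow> ('v \<Rightarrow> real) set" where
  "chamber w = dual_act w ` fund_chamber"

definition tits_cone :: "('v \<Rightarrow> real) set" where
  "tits_cone = (\<Union>w \<in> carrier W. dual_act w ` closed_fund_chamber)"

definition hyperplane :: "'v \<Rightarrow> ('v \<Rightarrow> real) set" where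
  "hyperplane \<beta> = {f \<in> tits_cone. dual_act (reflection \<beta>) f = f}"

definition shi_arrangement :: "nat \<Rightarrow> ('v \<Rightarrow> real) set set" where
  "shi_arrangement m = hyperplane ` small_roots m"

text \<open>
  Regions are the connected components of the complement of the arrangement in the Tits cone.  The
  topology on functionals is that of pointwise convergence, which is the usual topology of the dual
  space when \<open>V\<close> has finite dimension.  Since the Tits cone is convex, two points of the complement
  lie in the same component iff no hyperplane of the arrangement separates them.  A region contains
  the open chambers it is made of, together with those of their faces that lie on no hyperplane of
  the arrangement.
\<close>
definition shi_regions :: "nat \<Rightarrow> ('v \<Rightarrow> real) set set" where
  "shi_regions m = components (tits_cone - \<Union> (shi_arrangement m))"

definition min_length_in :: "('v \<Rightarrow> real) set \<Rightarrow> 'a \<Rightarrow> bool" where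
  "min_length_in R w \<longleftrightarrow> is_arg_min len (\<lambda>u. u \<in> carrier W \<and> chamber u \<subseteq> R) w"

end

end

theory Submission
  imports Defs
begin

text \<open>
  Let \<open>u\<close> invert every short inversion of \<open>w\<close>.  If the quotient of the functionals \<open>f0 \<circ> u\<^sup>-\<^sup>1\<close> and
  \<open>f0\<close> were positive somewhere on the inversions of \<open>w\<close>, its first maximiser along a reduced word
  could not be short, so it would be a positive combination of two inversions, the first of which
  is an earlier maximiser.  Hence the inversions of \<open>w\<close> are inversions of \<open>u\<close>, and a low element
  has the smallest inversion set among all elements with the same small inversions.

  Conversely, the walls between an element of minimal length in its region and its shorter
  neighbours are small.  Every short inversion that is not such a wall is followed along every
  reduced word by another short inversion of at least the same dominance depth, so all short
  inversions are small.  The comparison of depths takes place in a finite dihedral root system,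
  where it says that a simple root has at most the depth of every positive root other than the
  second simple root.

  A linear functional is in the Tits cone iff it is negative on finitely many positive roots only.
  The cone is therefore convex, and its regions correspond to the possible sets of small inversions.
\<close>

subsection \<open>Numerical estimates\<close>

text \<open>The obstacle is one comparison of depths in a plane: a simple root \<open>a\<close>
  against \<open>reflect a b\<close>. A reflection that raises a root takes dominated roots along,
  which settles all other comparisons by descent. But \<open>reflect a b\<close> lies in the
  dihedral orbit of \<open>b\<close>, which differs from that of \<open>a\<close> when the dihedral
  order is \<open>2 k\<close> with \<open>k\<close> even, so no reflection need join the two. The
  roots dominated by \<open>a\<close> and not by \<open>reflect a b\<close> have to be counted by
  hand. No integrality is available for this: at infinite bonds the form is only bounded by -1. Its
  substitute is an infimum. Among roots spanned by the plane and a vector \<open>e\<close>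
  orthogonal to it, the positive coefficients of \<open>e\<close> have a positive infimum, and a
  root within one percent of it forces certain polynomials in form values to be zero or at least
  \<open>100/101\<close>. One percent is merely small enough for the numerical margins, the tightest
  being 0.236 against 0.245. Simple roots may be linearly dependent, so coefficients are not
  compared; signs are read from a fixed functional \<open>f0\<close> in the fundamental
  chamber.\<close>

lemma positive_recurrence_false:
  fixes x :: "nat \<Rightarrow> real"
  assumes pos: "\<And>n. x n > 0" and rec: "\<And>n. x (Suc (Suc n)) = 2 * k * x (Suc n) - x n" and k: "k < 1"
  shows False
proof -
  define d where "d n = x (Suc n) - x n" for n
  \<comment> \<open>The differences strictly decrease because \<open>k < 1\<close>. A negative
    difference makes the sequence fall at least linearly; if no difference is ever nonpositive,
    \<open>x\<close> stays above \<open>x 0\<close> and the differences drop by a fixed amount each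
    time.\<close>
  have d: "d (Suc n) = d n - 2 * (1 - k) * x (Suc n)" for n
    by (simp add: d_def rec algebra_simps)
  have less: "d (Suc n) < d n" for n
    using d[of n] mult_pos_pos[of "1 - k" "x (Suc n)"] pos k by simp
  have anti: "d (n + j) \<le> d n" for n j
    using less by (induction j) (auto intro: order_trans less_imp_le)
  show False
  proof (cases "\<exists>n. d n \<le> 0")
    case True
    then obtain n where n: "d (Suc n) < 0" using less by (meson order_less_le_trans)
    have "x (Suc n + j) \<le> x (Suc n) + real j * d (Suc n)" for j
    proof (induction j)
      case (Suc j)
      have "x (Suc n + Suc j) = x (Suc n + j) + d (Suc n + j)" by (simp add: d_def)
      also have "\<dots> \<le> x (Suc n) + real j * d (Suc n) + d (Suc n)"
        using Suc anti[of "Suc n" j] by linarith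
      finally show ?case by (simp add: algebra_simps)
    qed simp
    moreover obtain j where "real j * (- d (Suc n)) > x (Suc n)"
      using reals_Archimedean3[of "- d (Suc n)"] n by auto
    ultimately show False using pos[of "Suc n + j"] by (smt (verit) mult_minus_right)
  next
    case False
    then have dp: "d n > 0" for n by (meson not_le)
    have inc: "x n \<ge> x 0" for n
    proof (induction n)
      case (Suc n)
      then show ?case using dp[of n] by (simp add: d_def)
    qed simp
    have "d n \<le> d 0 - real n * (2 * (1 - k) * x 0)" for n
    proof (induction n)
      case (Suc n)
      have "(2 * (1 - k)) * x 0 \<le> (2 * (1 - k)) * x (Suc n)" using inc[of "Suc n"] k by (intro mult_left_mono) auto
      then show ?case using Suc d[of n] by (simp add: algebra_simps)
    qed simp
    moreover obtain n where "real n * (2 * (1 - k) * x 0) > d 0"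
      using reals_Archimedean3[of "2 * (1 - k) * x 0"] k pos[of 0] by auto
    ultimately show False using dp[of n] by (smt (verit))
  qed
qed

text \<open>
  In the application a root dominated by \<open>a\<close> has form value \<open>X\<close> with \<open>a\<close>, its projection to the
  plane has coordinate \<open>t\<close> orthogonally to \<open>a\<close>, and \<open>- s\<close> is the square of the remaining component.
\<close>
lemma shadow_bound:
  fixes c X t s :: real
  assumes c: "0 < c" "c < 2" and X: "X \<ge> 1" and t: "\<bar>t\<bar> < 1 - c * X / 2"
    and s: "1 + s = X\<^sup>2 + t\<^sup>2 / (1 - c\<^sup>2 / 4)"
  shows "s < 4 / c\<^sup>2 - 1"
proof -
  define a where "a = c / 2"
  have a: "0 < a" "a < 1" using c by (auto simp: a_def)
  have aX: "a * X < 1" using t by (simp add: a_def)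
  have aX': "a * X \<ge> a" using a X by simp
  have q: "1 - c\<^sup>2 / 4 = 1 - a\<^sup>2" by (simp add: a_def power2_eq_square)
  have a2: "a\<^sup>2 < 1" using a by (simp add: abs_square_less_1)
  have "\<bar>t\<bar>\<^sup>2 < (1 - a * X)\<^sup>2" using t by (intro power_strict_mono) (auto simp: a_def)
  then have "t\<^sup>2 / (1 - a\<^sup>2) < (1 - a * X)\<^sup>2 / (1 - a\<^sup>2)" using a2 by (intro divide_strict_right_mono) auto
  moreover have "X\<^sup>2 + (1 - a * X)\<^sup>2 / (1 - a\<^sup>2) \<le> 1 / a\<^sup>2"
  proof -
    \<comment> \<open>Cleared of denominators, the bound says that
      \<open>(1 - a X) (1 + a X - 2 a^2)\<close> is nonnegative.\<close>
    have "1 + a * X - 2 * a\<^sup>2 \<ge> 0"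
    proof -
      have "a\<^sup>2 \<le> a" using a by (simp add: power2_eq_square)
      then show ?thesis using aX' a by linarith
    qed
    then have "0 \<le> (1 - a * X) * (1 + a * X - 2 * a\<^sup>2)" using aX by simp
    then have "a\<^sup>2 * X\<^sup>2 * (1 - a\<^sup>2) + a\<^sup>2 * (1 - a * X)\<^sup>2 \<le> 1 - a\<^sup>2"
      by (simp add: algebra_simps power2_eq_square)
    then have "(X\<^sup>2 * (1 - a\<^sup>2) + (1 - a * X)\<^sup>2) * a\<^sup>2 \<le> 1 - a\<^sup>2"
      by (simp add: algebra_simps)
    then have "X\<^sup>2 * (1 - a\<^sup>2) + (1 - a * X)\<^sup>2 \<le> (1 - a\<^sup>2) / a\<^sup>2"
      using a by (simp add: pos_le_divide_eq)
    then have "(X\<^sup>2 * (1 - a\<^sup>2) + (1 - a * X)\<^sup>2) / (1 - a\<^sup>2) \<le> ((1 - a\<^sup>2) / a\<^sup>2) / (1 - a\<^sup>2)"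
      using a2 by (intro divide_right_mono) auto
    then show ?thesis using a2 by (simp add: add_divide_distrib)
  qed
  moreover have "1 / a\<^sup>2 = 4 / c\<^sup>2" by (simp add: a_def power2_eq_square)
  moreover have "1 + s = X\<^sup>2 + t\<^sup>2 / (1 - a\<^sup>2)" using s unfolding q .
  ultimately show ?thesis by linarith
qed

text \<open>\<open>10201 / 10000\<close> is \<open>(101 / 100)^2\<close>, the loss from using a
  coefficient \<open>\<zeta>\<close> slightly above the infimum \<open>\<iota>\<close>.\<close>

lemma sq_near_one:
  fixes \<iota> \<zeta> s :: real
  assumes "0 < \<iota>" "\<iota> \<le> \<zeta>" "\<zeta> < 101 / 100 * \<iota>" "0 \<le> s"
  shows "s * \<zeta>\<^sup>2 \<le> 10201 / 10000 * (s * \<iota>\<^sup>2)"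
proof -
  have "\<zeta>\<^sup>2 \<le> (101 / 100 * \<iota>)\<^sup>2" using assms by (intro power_mono) auto
  then have "s * \<zeta>\<^sup>2 \<le> s * (101 / 100 * \<iota>)\<^sup>2" using assms by (intro mult_left_mono)
  then show ?thesis by (simp add: power_mult_distrib power2_eq_square)
qed

text \<open>
  The conditions say that \<open>2 x\<close>, \<open>4 x\<^sup>2 - 1\<close> and \<open>8 x\<^sup>3 - 4 x\<close> are zero or at least \<open>100/101\<close> in absolute
  value.  These are the coefficients of \<open>\<sigma>\<close>, up to sign, in images of \<open>\<sigma>\<close> and \<open>r\<close> under the dihedral
  group generated by the reflections in two roots \<open>\<sigma>\<close> and \<open>r\<close> with form value \<open>x\<close>.
\<close>
definition gap_values :: "real \<Rightarrow> bool" where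
  "gap_values x \<longleftrightarrow> (x = 0 \<or> x \<ge> 50 / 101) \<and> (4 * x\<^sup>2 - 1 = 0 \<or> \<bar>4 * x\<^sup>2 - 1\<bar> \<ge> 100 / 101) \<and>
     (8 * x ^ 3 - 4 * x = 0 \<or> \<bar>8 * x ^ 3 - 4 * x\<bar> \<ge> 100 / 101)"

text \<open>Two nonzero coordinates would each be at least \<open>50/101\<close>, and the quadratic
  form would be at least \<open>(2 + 7/5) (50/101)^2 > 4/5\<close>. So exactly one of them is
  nonzero.\<close>

lemma one_dominant_coord:
  fixes \<kappa> \<kappa>' c N :: real
  assumes k: "gap_values \<kappa>" "gap_values \<kappa>'" and c: "c \<ge> 7 / 5"
    and N: "\<kappa>\<^sup>2 + \<kappa>'\<^sup>2 + c * \<kappa> * \<kappa>' = N" "0 < N" "N < 4 / 5"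
  obtains x where "gap_values x" "x \<ge> 50 / 101" "x\<^sup>2 = N"
proof -
  have False if x: "\<kappa> \<ge> 50 / 101" "\<kappa>' \<ge> 50 / 101"
  proof -
    have "\<kappa>\<^sup>2 \<ge> (50/101)\<^sup>2" "\<kappa>'\<^sup>2 \<ge> (50/101)\<^sup>2" using x by (auto intro!: power_mono)
    moreover have "c * \<kappa> * \<kappa>' \<ge> (7/5) * (50/101) * (50/101)" using x c by (intro mult_mono) auto
    ultimately show False using N by (simp add: power2_eq_square)
  qed
  then show ?thesis using that[of \<kappa>] that[of \<kappa>'] k N unfolding gap_values_def by fastforce
qed

text \<open>Here \<open>1 - c^2/4\<close> is at most \<open>19/100\<close> and \<open>s\<close> is
  below \<open>19/81\<close>, so the right-hand side is positive but below 0.236. The square of an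
  admissible nonzero coordinate is at least \<open>(50/101)^2 > 0.245\<close>.\<close>

lemma dominant_coords_large:
  fixes c s \<iota> \<zeta> \<kappa> \<kappa>' :: real
  assumes c: "81 / 25 \<le> c\<^sup>2" "0 < c" "c < 2" and s: "0 \<le> s" "s < 4 / c\<^sup>2 - 1"
    and z: "0 < \<iota>" "\<iota> \<le> 1" "\<iota> \<le> \<zeta>" "\<zeta> < 101 / 100 * \<iota>" and k: "gap_values \<kappa>" "gap_values \<kappa>'"
    and eq: "\<kappa>\<^sup>2 + \<kappa>'\<^sup>2 + c * \<kappa> * \<kappa>' = (1 - c\<^sup>2 / 4) * (1 + s * \<zeta>\<^sup>2)"
  shows False
proof -
  have c4: "c\<^sup>2 < 4" using c power_strict_mono[of c 2 2] by simp
  have "(7/5)\<^sup>2 \<le> c\<^sup>2" using c by (simp add: power2_eq_square)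
  then have cge: "c \<ge> 7/5" by (rule power2_le_imp_le) (use c in simp)
  have "4 / c\<^sup>2 \<le> 4 / (81/25)" using c by (intro divide_left_mono) auto
  then have s1: "s < 19/81" using s by simp
  have "s * \<iota>\<^sup>2 \<le> s * 1" using s z by (intro mult_left_mono) (auto simp: power_le_one)
  then have "s * \<zeta>\<^sup>2 \<le> 10201 / 10000 * (19/81)"
    using sq_near_one[OF z(1,3,4) s(1)] s1 by linarith
  then have "(1 - c\<^sup>2 / 4) * (1 + s * \<zeta>\<^sup>2) \<le> (19/100) * (1 + 10201 / 10000 * (19/81))"
    using c c4 s by (intro mult_mono) auto
  then have up: "(1 - c\<^sup>2 / 4) * (1 + s * \<zeta>\<^sup>2) < (50/101)\<^sup>2" by (simp add: power2_eq_square)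
  have lo: "(1 - c\<^sup>2 / 4) * (1 + s * \<zeta>\<^sup>2) > 0" using c4 s by (intro mult_pos_pos) (auto simp: add_pos_nonneg)
  have "(50/101)\<^sup>2 < (4/5 :: real)" by (simp add: power2_eq_square)
  then have "(1 - c\<^sup>2 / 4) * (1 + s * \<zeta>\<^sup>2) < 4/5" using up by linarith
  then obtain x where x: "x \<ge> 50/101" "x\<^sup>2 = (1 - c\<^sup>2 / 4) * (1 + s * \<zeta>\<^sup>2)"
    using one_dominant_coord[OF k cge eq lo] by blast
  have "(50/101)\<^sup>2 \<le> x\<^sup>2" using x(1) by (intro power_mono) auto
  then show False using up x(2) by linarith
qed

text \<open>The one nonzero coordinate satisfies \<open>4 x^2 - 1 = s \<zeta>^2 < 0.35\<close>, and
  the gap for \<open>4 x^2 - 1\<close> leaves only zero.\<close>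

lemma dominant_coords_three:
  fixes c s \<iota> \<zeta> \<kappa> \<kappa>' :: real
  assumes c: "c\<^sup>2 = 3" "0 < c" and s: "0 \<le> s" "s < 1 / 3"
    and z: "0 < \<iota>" "\<iota> \<le> 1" "\<iota> \<le> \<zeta>" "\<zeta> < 101 / 100 * \<iota>" and k: "gap_values \<kappa>" "gap_values \<kappa>'"
    and eq: "\<kappa>\<^sup>2 + \<kappa>'\<^sup>2 + c * \<kappa> * \<kappa>' = (1 - c\<^sup>2 / 4) * (1 + s * \<zeta>\<^sup>2)"
  shows "s = 0"
proof -
  have "(7/5)\<^sup>2 \<le> c\<^sup>2" unfolding c(1) by (simp add: power2_eq_square)
  then have cge: "c \<ge> 7/5" by (rule power2_le_imp_le) (use c in simp)
  define m where "m = s * \<zeta>\<^sup>2"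
  have "s * \<iota>\<^sup>2 \<le> s * 1" using s z by (intro mult_left_mono) (auto simp: power_le_one)
  then have m: "0 \<le> m" "m < 10201 / 10000 * (1/3)"
    using sq_near_one[OF z(1,3,4) s(1)] s unfolding m_def by (simp, linarith)
  have e: "\<kappa>\<^sup>2 + \<kappa>'\<^sup>2 + c * \<kappa> * \<kappa>' = 1/4 * (1 + m)" using eq c by (simp add: m_def)
  obtain x where x: "gap_values x" "x\<^sup>2 = 1/4 * (1 + m)"
    using one_dominant_coord[OF k cge e] m by auto
  then have "4 * x\<^sup>2 - 1 = m" by simp
  then have "m = 0" using x(1) m by (auto simp: gap_values_def)
  then show ?thesis using z by (simp add: m_def)
qed

text \<open>The one nonzero coordinate satisfies \<open>2 x^2 - 1 = s \<zeta>^2\<close>, so it is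
  the cubic condition that decides: \<open>8 x^3 - 4 x = 4 x s \<zeta>^2 < 0.52\<close>. The bound
  \<open>1/8\<close> needed for this comes from an extra reflection in the application.\<close>

lemma dominant_coords_two:
  fixes c s \<iota> \<zeta> \<kappa> \<kappa>' :: real
  assumes c: "c\<^sup>2 = 2" "0 < c" and s: "0 \<le> s" "s * \<iota>\<^sup>2 \<le> 1 / 8"
    and z: "0 < \<iota>" "\<iota> \<le> \<zeta>" "\<zeta> < 101 / 100 * \<iota>" and k: "gap_values \<kappa>" "gap_values \<kappa>'"
    and eq: "\<kappa>\<^sup>2 + \<kappa>'\<^sup>2 + c * \<kappa> * \<kappa>' = (1 - c\<^sup>2 / 4) * (1 + s * \<zeta>\<^sup>2)"
  shows "s = 0"
proof -
  have "(7/5)\<^sup>2 \<le> c\<^sup>2" unfolding c(1) by (simp add: power2_eq_square)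
  then have cge: "c \<ge> 7/5" by (rule power2_le_imp_le) (use c in simp)
  define m where "m = s * \<zeta>\<^sup>2"
  have m: "0 \<le> m" "m \<le> 10201 / 10000 * (1/8)"
    using sq_near_one[OF z s(1)] s unfolding m_def by (simp, linarith)
  have e: "\<kappa>\<^sup>2 + \<kappa>'\<^sup>2 + c * \<kappa> * \<kappa>' = 1/2 * (1 + m)" using eq c by (simp add: m_def)
  obtain x where x: "gap_values x" "x \<ge> 50/101" "x\<^sup>2 = 1/2 * (1 + m)"
    using one_dominant_coord[OF k cge e] m by auto
  have "8 * x ^ 3 - 4 * x = 4 * x * (2 * x\<^sup>2 - 1)" by (simp add: power3_eq_cube power2_eq_square algebra_simps)
  moreover have "2 * x\<^sup>2 - 1 = m" using x(3) by simp
  ultimately have xe: "8 * x ^ 3 - 4 * x = 4 * x * m" by (simp only:)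
  have "x \<le> 1" using x m by (intro power2_le_imp_le[of x 1]) auto
  then have "4 * x * m \<le> 4 * (10201 / 10000 * (1/8))"
    using m x(2) mult_mono[of x 1 m "10201 / 10000 * (1/8)"] by simp
  moreover have "4 * x * m \<ge> 0" using x(2) m by simp
  ultimately have "\<bar>8 * x ^ 3 - 4 * x\<bar> < 100/101" unfolding xe by (simp only: abs_of_nonneg)
  then have "4 * x * m = 0" using x(1) xe unfolding gap_values_def by linarith
  then show ?thesis using x z by (auto simp: m_def)
qed

subsection \<open>Roots and reflections\<close>

lemma convex_cone_nonneg: "linear (\<phi> :: 'b::real_vector \<Rightarrow> real) \<Longrightarrow> convex_cone {x. \<phi> x \<ge> 0}"
  by (simp add: convex_cone_iff linear_add linear_scale linear_0)

lemma cone_hull_nonneg: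
  assumes "linear (\<phi> :: 'b::real_vector \<Rightarrow> real)" "\<And>a. a \<in> A \<Longrightarrow> \<phi> a \<ge> 0" "x \<in> convex_cone hull A"
  shows "\<phi> x \<ge> 0"
proof -
  have "convex_cone hull A \<subseteq> {x. \<phi> x \<ge> 0}"
    by (rule hull_minimal) (use assms convex_cone_nonneg in auto)
  then show ?thesis using assms(3) by auto
qed

lemma cone_hull_pos:
  assumes "linear (\<phi> :: 'b::real_vector \<Rightarrow> real)" "\<And>a. a \<in> A \<Longrightarrow> \<phi> a > 0" "x \<in> convex_cone hull A" "x \<noteq> 0"
  shows "\<phi> x > 0"
proof -
  have "convex_cone {x. x = 0 \<or> \<phi> x > 0}"
    using assms(1) by (auto simp: convex_cone_iff linear_add linear_scale linear_0 add_pos_pos)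
  then have "convex_cone hull A \<subseteq> {x. x = 0 \<or> \<phi> x > 0}"
    by (intro hull_minimal) (use assms in auto)
  then show ?thesis using assms(3,4) by auto
qed

lemma cone_hull_insert_decomp:
  assumes "x \<in> convex_cone hull A" "a \<in> A"
  shows "\<exists>c\<ge>0. \<exists>y\<in>convex_cone hull (A - {a}). x = c *\<^sub>R a + y"
proof -
  let ?T = "{x. \<exists>c\<ge>0. \<exists>y\<in>convex_cone hull (A - {a}). x = c *\<^sub>R a + y}"
  have "convex_cone ?T"
  proof (subst convex_cone_iff, intro conjI ballI allI impI)
    show "0 \<in> ?T" using convex_cone_hull_contains_0 by force
  next
    fix x y assume "x \<in> ?T" "y \<in> ?T"
    then obtain c d u v where "c \<ge> 0" "d \<ge> 0" "u \<in> convex_cone hull (A - {a})" "v \<in> convex_cone hull (A - {a})"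
       "x = c *\<^sub>R a + u" "y = d *\<^sub>R a + v" by auto
    then show "x + y \<in> ?T"
      by (auto intro!: exI[of _ "c+d"] bexI[of _ "u+v"] convex_cone_hull_add simp: algebra_simps)
  next
    fix x and k :: real assume "x \<in> ?T" "0 \<le> k"
    then obtain c u where "c \<ge> 0" "u \<in> convex_cone hull (A - {a})"
       "x = c *\<^sub>R a + u" by auto
    then show "k *\<^sub>R x \<in> ?T" using \<open>0 \<le> k\<close>
      by (auto intro!: exI[of _ "k*c"] bexI[of _ "k *\<^sub>R u"] convex_cone_hull_mul simp: algebra_simps)
  qed
  moreover have "A \<subseteq> ?T"
  proof
    fix b assume "b \<in> A"
    show "b \<in> ?T"
    proof (cases "b = a")
      case True
      then show ?thesis using convex_cone_hull_contains_0[of "A - {a}"] by (auto intro!: exI[of _ 1])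
    next
      case False
      then show ?thesis using \<open>b \<in> A\<close> by (auto intro!: exI[of _ 0] hull_inc)
    qed
  qed
  ultimately have "convex_cone hull A \<subseteq> ?T" by (intro hull_minimal) auto
  then show ?thesis using assms by auto
qed

context geometric_representation
begin

lemma act_linear_simps:
  assumes "w \<in> carrier W"
  shows "act w (x + y) = act w x + act w y" "act w (x - y) = act w x - act w y"
    "act w (- x) = - act w x" "act w (c *\<^sub>R x) = c *\<^sub>R act w x" "act w 0 = 0"
  using act_linear[OF assms] by (simp_all add: linear_add linear_diff linear_neg linear_scale linear_0)

lemma B_simps [simp]:
  "B (x + y) z = B x z + B y z" "B x (y + z) = B x y + B x z"
  "B (x - y) z = B x z - B y z" "B x (y - z) = B x y - B x z"
  "B (c *\<^sub>R x) z = c * B x z" "B x (c *\<^sub>R z) = c * B x z"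
  "B (- x) z = - B x z" "B x (- z) = - B x z" "B 0 x = 0" "B x 0 = 0"
  using form_bilinear
  by (auto simp: bilinear_ladd bilinear_radd bilinear_lsub bilinear_rsub bilinear_lmul bilinear_rmul
      bilinear_lneg bilinear_rneg bilinear_lzero bilinear_rzero)

lemma gens [simp]: "s \<in> S \<Longrightarrow> s \<in> carrier W"
  using generators_carrier by auto

lemma act_inv [simp]:
  assumes "w \<in> carrier W"
  shows "act (inv w) (act w v) = v" "act w (act (inv w) v) = v"
  using act_mult[of "inv w" w v] act_mult[of w "inv w" v] assms by (auto simp: act_one)

lemma act_eqI:
  assumes "u \<in> carrier W" "w \<in> carrier W" "\<And>v. act u v = act w v"
  shows "u = w"
  using inj_onD[OF act_faithful _ assms(1,2)] assms(3) by blast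

lemma act_gen: "s \<in> S \<Longrightarrow> act s v = v - (2 * B (\<alpha> s) v) *\<^sub>R \<alpha> s"
  using act_simple[of s v] form_unit[of s] by simp

lemma act_gen_self: "s \<in> S \<Longrightarrow> act s (\<alpha> s) = - \<alpha> s"
  by (simp add: act_gen form_unit scaleR_2)

lemma gen_sq [simp]: "s \<in> S \<Longrightarrow> s \<otimes> s = \<one>"
  using generators_ord[of s] pow_ord_eq_1[of s] by (simp add: numeral_2_eq_2)

lemma gen_inv [simp]: "s \<in> S \<Longrightarrow> inv s = s"
  by (simp add: inv_equality)

lemma gen_sq_left [simp]: "s \<in> S \<Longrightarrow> w \<in> carrier W \<Longrightarrow> s \<otimes> (s \<otimes> w) = w"
  by (simp add: m_assoc[symmetric])

lemma gen_sq_right [simp]: "s \<in> S \<Longrightarrow> w \<in> carrier W \<Longrightarrow> w \<otimes> s \<otimes> s = w"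
  by (simp add: m_assoc)

lemma form_neq_le0: "s \<in> S \<Longrightarrow> t \<in> S \<Longrightarrow> s \<noteq> t \<Longrightarrow> B (\<alpha> s) (\<alpha> t) \<le> 0"
proof -
  assume st: "s \<in> S" "t \<in> S" "s \<noteq> t"
  show ?thesis
  proof (cases "ord (s \<otimes> t) = 0")
    case True then show ?thesis using form_infinite[of s t] st by simp
  next
    case False
    have "ord (s \<otimes> t) \<noteq> 1"
    proof
      assume "ord (s \<otimes> t) = 1"
      then have "s \<otimes> t = \<one>" using st ord_eq_1 by simp
      then have "s = inv t" using st by (metis gens inv_equality)
      then show False using st by simp
    qed
    then have "ord (s \<otimes> t) \<ge> 2" using False by linarith
    then have "pi / real (ord (s \<otimes> t)) \<le> pi / 2" by (intro divide_left_mono) auto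
    moreover have "0 \<le> pi / real (ord (s \<otimes> t))" by simp
    then have "- (pi / 2) \<le> pi / real (ord (s \<otimes> t))" using pi_gt_zero by linarith
    ultimately have "cos (pi / real (ord (s \<otimes> t))) \<ge> 0"
      by (intro cos_ge_zero)
    then show ?thesis using form_finite[of s t] st False by simp
  qed
qed

text \<open>A fixed point of the open fundamental chamber. Its sign on a root decides positivity,
  which turns statements about cones into linear inequalities.\<close>

definition f0 :: "'v \<Rightarrow> real" where
  "f0 = (SOME f. linear f \<and> (\<forall>s \<in> S. f (\<alpha> s) > 0))"

lemma f0_linear: "linear f0" and f0_simple: "s \<in> S \<Longrightarrow> f0 (\<alpha> s) > 0"
  using someI_ex[OF chamber_nonempty] unfolding f0_def by auto

lemma f0_simps [simp]:
  "f0 (x + y) = f0 x + f0 y" "f0 (x - y) = f0 x - f0 y" "f0 (- x) = - f0 x"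
  "f0 (c *\<^sub>R x) = c * f0 x" "f0 0 = 0"
  using f0_linear by (simp_all add: linear_add linear_diff linear_neg linear_scale linear_0)

lemma roots_act: "w \<in> carrier W \<Longrightarrow> \<beta> \<in> roots \<Longrightarrow> act w \<beta> \<in> roots"
  unfolding roots_def
  by (auto simp: act_mult[symmetric] intro!: bexI[of _ "w \<otimes> _"])

lemma rootsE:
  assumes "\<beta> \<in> roots"
  obtains w s where "w \<in> carrier W" "s \<in> S" "\<beta> = act w (\<alpha> s)"
  using assms unfolding roots_def simple_roots_def by auto

lemma simple_root [simp]: "s \<in> S \<Longrightarrow> \<alpha> s \<in> roots"
  unfolding roots_def simple_roots_def by (auto simp: act_one intro!: bexI[of _ \<one>])

lemma roots_uminus: "\<beta> \<in> roots \<Longrightarrow> - \<beta> \<in> roots"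
proof (elim rootsE)
  fix w s assume *: "w \<in> carrier W" "s \<in> S" "\<beta> = act w (\<alpha> s)"
  then have "- \<beta> = act (w \<otimes> s) (\<alpha> s)" by (simp add: act_mult act_gen_self act_linear_simps)
  then show ?thesis using * by (simp add: roots_act)
qed

lemma root_unit: "\<beta> \<in> roots \<Longrightarrow> B \<beta> \<beta> = 1"
  by (elim rootsE) (simp add: form_invariant form_unit)

lemma root_nonzero: "\<beta> \<in> roots \<Longrightarrow> \<beta> \<noteq> 0"
  using root_unit by force

lemma root_pos_or_neg:
  "\<beta> \<in> roots \<Longrightarrow> \<beta> \<in> convex_cone hull simple_roots \<or> - \<beta> \<in> convex_cone hull simple_roots"
  using roots_cover by (elim rootsE) (force simp: simple_roots_def)

lemma f0_cone: "v \<in> convex_cone hull simple_roots \<Longrightarrow> v \<noteq> 0 \<Longrightarrow> f0 v > 0"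
  by (rule cone_hull_pos[OF f0_linear]) (auto simp: simple_roots_def f0_simple)

lemma f0_root_nonzero: "\<beta> \<in> roots \<Longrightarrow> f0 \<beta> \<noteq> 0"
  using root_pos_or_neg[of \<beta>] f0_cone[of \<beta>] f0_cone[of "-\<beta>"] root_nonzero[of \<beta>] by force

lemma pos_roots_iff: "\<beta> \<in> pos_roots \<longleftrightarrow> \<beta> \<in> roots \<and> f0 \<beta> > 0"
  unfolding pos_roots_def
  using root_pos_or_neg[of \<beta>] f0_cone[of \<beta>] f0_cone[of "-\<beta>"] root_nonzero[of \<beta>] by force

lemma pos_root_nonneg:
  assumes "linear (\<phi> :: 'v \<Rightarrow> real)" "\<And>s. s \<in> S \<Longrightarrow> \<phi> (\<alpha> s) \<ge> 0" "\<beta> \<in> pos_roots"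
  shows "\<phi> \<beta> \<ge> 0"
  using assms cone_hull_nonneg[of \<phi> simple_roots \<beta>] unfolding pos_roots_def simple_roots_def by blast

lemma pos_rootsD: "\<beta> \<in> pos_roots \<Longrightarrow> \<beta> \<in> roots" "\<beta> \<in> pos_roots \<Longrightarrow> f0 \<beta> > 0"
  by (auto simp: pos_roots_iff)

lemma simple_pos [simp]: "s \<in> S \<Longrightarrow> \<alpha> s \<in> pos_roots"
  by (simp add: pos_roots_iff f0_simple)

lemma root_cases: "\<beta> \<in> roots \<Longrightarrow> (\<beta> \<in> pos_roots \<and> - \<beta> \<notin> pos_roots) \<or> (- \<beta> \<in> pos_roots \<and> \<beta> \<notin> pos_roots)"
  using f0_root_nonzero[of \<beta>] roots_uminus[of \<beta>] by (auto simp: pos_roots_iff)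

text \<open>Split off the multiples of \<open>\<alpha> s\<close> from \<open>u\<close> and
  \<open>v\<close>. The remainders lie in the cone of the other simple roots, hence have nonpositive
  form value with \<open>\<alpha> s\<close>; their sum is a multiple of \<open>\<alpha> s\<close>,
  so that multiple is nonpositive. As \<open>f0\<close> is positive on nonzero vectors of the cone,
  both remainders vanish.\<close>

lemma cone_simple_extremal:
  assumes "u \<in> convex_cone hull simple_roots" "v \<in> convex_cone hull simple_roots"
    "u + v = c *\<^sub>R \<alpha> s" "s \<in> S"
  shows "\<exists>k\<ge>0. u = k *\<^sub>R \<alpha> s"
proof -
  let ?A = "simple_roots - {\<alpha> s}"
  have a: "\<alpha> s \<in> simple_roots" using assms(4) by (simp add: simple_roots_def)
  obtain k u' where u: "k \<ge> 0" "u' \<in> convex_cone hull ?A" "u = k *\<^sub>R \<alpha> s + u'"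
    using cone_hull_insert_decomp[OF assms(1) a] by blast
  obtain l v' where v: "l \<ge> 0" "v' \<in> convex_cone hull ?A" "v = l *\<^sub>R \<alpha> s + v'"
    using cone_hull_insert_decomp[OF assms(2) a] by blast
  have sum: "u' + v' = (c - k - l) *\<^sub>R \<alpha> s"
    using assms(3) u(3) v(3) by (simp add: algebra_simps)
  have neg: "B (\<alpha> s) x \<le> 0" if "x \<in> convex_cone hull ?A" for x
  proof -
    have "0 \<le> - B (\<alpha> s) x"
    proof (rule cone_hull_nonneg[OF _ _ that])
      show "linear (\<lambda>x. - B (\<alpha> s) x)" by (rule linearI) auto
      fix a assume "a \<in> ?A"
      then obtain t where "t \<in> S" "a = \<alpha> t" "t \<noteq> s" by (auto simp: simple_roots_def)
      then show "0 \<le> - B (\<alpha> s) a" using form_neq_le0[of s t] assms(4) by simp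
    qed
    then show ?thesis by simp
  qed
  have sub: "x \<in> convex_cone hull ?A \<Longrightarrow> x \<in> convex_cone hull simple_roots" for x
    using hull_mono[of ?A simple_roots convex_cone] by auto
  have "c - k - l = B (\<alpha> s) (u' + v')" using sum assms(4) by (simp add: form_unit)
  also have "\<dots> \<le> 0" using neg[OF u(2)] neg[OF v(2)] by simp
  finally have "f0 (u' + v') \<le> 0" unfolding sum using f0_simple[OF assms(4)]
    by (simp add: mult_nonpos_nonneg)
  then have "u' = 0" using f0_cone[OF sub[OF u(2)]] f0_cone[OF sub[OF v(2)]] by force
  then show ?thesis using u by auto
qed

lemma pos_cone: "\<beta> \<in> pos_roots \<Longrightarrow> \<beta> \<in> convex_cone hull simple_roots"
  by (simp add: pos_roots_def)

lemma pos_roots_simple_extremal: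
  assumes "\<beta> \<in> pos_roots" "\<gamma> \<in> pos_roots" "a > 0" "b \<ge> 0" "a *\<^sub>R \<beta> + b *\<^sub>R \<gamma> = c *\<^sub>R \<alpha> s" "s \<in> S"
  shows "\<beta> = \<alpha> s"
proof -
  obtain k where k: "k \<ge> 0" "a *\<^sub>R \<beta> = k *\<^sub>R \<alpha> s"
    using cone_simple_extremal[of "a *\<^sub>R \<beta>" "b *\<^sub>R \<gamma>" c s] assms
    by (auto simp: convex_cone_hull_mul pos_cone)
  have "\<beta> = (1/a) *\<^sub>R (a *\<^sub>R \<beta>)" using assms(3) by simp
  then have eq: "\<beta> = (k/a) *\<^sub>R \<alpha> s" using k by simp
  have "B \<beta> \<beta> = 1" using assms by (simp add: root_unit pos_rootsD)
  then have "(k/a)^2 = 1" unfolding eq using form_unit[OF assms(6)]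
    by (simp only: power2_eq_square B_simps mult_1_right)
  moreover have "k/a \<ge> 0" using k assms by simp
  ultimately have "k/a = 1" unfolding power2_eq_1_iff by linarith
  then show ?thesis using eq by simp
qed

lemma gen_pos:
  assumes "s \<in> S" "\<beta> \<in> pos_roots" "\<beta> \<noteq> \<alpha> s"
  shows "act s \<beta> \<in> pos_roots"
proof (rule ccontr)
  assume "act s \<beta> \<notin> pos_roots"
  then have "- act s \<beta> \<in> pos_roots" using root_cases[of "act s \<beta>"] assms
    by (auto simp: roots_act pos_rootsD)
  moreover have "1 *\<^sub>R \<beta> + 1 *\<^sub>R (- act s \<beta>) = (2 * B (\<alpha> s) \<beta>) *\<^sub>R \<alpha> s"
    using assms by (simp add: act_gen)
  ultimately have "\<beta> = \<alpha> s" using pos_roots_simple_extremal[of \<beta> "- act s \<beta>" 1 1] assms by auto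
  then show False using assms by simp
qed

lemma gen_pos_iff:
  assumes "s \<in> S" "\<beta> \<in> pos_roots"
  shows "act s \<beta> \<in> pos_roots \<longleftrightarrow> \<beta> \<noteq> \<alpha> s"
  using gen_pos[OF assms] assms root_cases[of "\<alpha> s"] by (auto simp: act_gen_self)

section \<open>Reflections in arbitrary roots\<close>

definition reflect :: "'v \<Rightarrow> 'v \<Rightarrow> 'v" where
  "reflect \<beta> v = v - (2 * B \<beta> v) *\<^sub>R \<beta>"

lemma reflect_conj:
  assumes "w \<in> carrier W" "s \<in> S"
  shows "act (w \<otimes> s \<otimes> inv w) v = reflect (act w (\<alpha> s)) v"
proof -
  have "B (\<alpha> s) (act (inv w) v) = B (act w (\<alpha> s)) v"
    using form_invariant[of w "\<alpha> s" "act (inv w) v"] assms by simp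
  then show ?thesis using assms
    by (simp add: act_mult act_gen act_linear_simps reflect_def)
qed

lemma reflection_eq:
  assumes "w \<in> carrier W" "s \<in> S"
  shows "reflection (act w (\<alpha> s)) = w \<otimes> s \<otimes> inv w"
proof -
  have u: "B (act w (\<alpha> s)) (act w (\<alpha> s)) = 1" using assms by (simp add: form_invariant form_unit)
  show ?thesis unfolding reflection_def
  proof (rule the_equality)
    show "w \<otimes> s \<otimes> inv w \<in> carrier W \<and> (\<forall>v. act (w \<otimes> s \<otimes> inv w) v =
      v - (2 * (B (act w (\<alpha> s)) v / B (act w (\<alpha> s)) (act w (\<alpha> s)))) *\<^sub>R act w (\<alpha> s))"
      using reflect_conj[OF assms] assms by (simp add: u reflect_def)
  next
    fix t assume "t \<in> carrier W \<and> (\<forall>v. act t v =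
      v - (2 * (B (act w (\<alpha> s)) v / B (act w (\<alpha> s)) (act w (\<alpha> s)))) *\<^sub>R act w (\<alpha> s))"
    then show "t = w \<otimes> s \<otimes> inv w"
      by (intro act_eqI) (use assms reflect_conj[OF assms] in \<open>auto simp: u reflect_def\<close>)
  qed
qed

lemma reflection_closed [simp]: "\<beta> \<in> roots \<Longrightarrow> reflection \<beta> \<in> carrier W"
  by (elim rootsE) (simp add: reflection_eq)

lemma act_reflection: "\<beta> \<in> roots \<Longrightarrow> act (reflection \<beta>) v = reflect \<beta> v"
  by (elim rootsE) (simp add: reflection_eq reflect_conj)

lemma reflect_root: "\<beta> \<in> roots \<Longrightarrow> \<gamma> \<in> roots \<Longrightarrow> reflect \<beta> \<gamma> \<in> roots"
  by (metis act_reflection reflection_closed roots_act)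

lemma reflect_self: "\<beta> \<in> roots \<Longrightarrow> reflect \<beta> \<beta> = - \<beta>"
  by (simp add: reflect_def root_unit scaleR_2)

lemma reflect_reflect: "\<beta> \<in> roots \<Longrightarrow> reflect \<beta> (reflect \<beta> v) = v"
  by (simp add: reflect_def root_unit algebra_simps)

lemma B_reflect_reflect: "\<beta> \<in> roots \<Longrightarrow> B (reflect \<beta> u) (reflect \<beta> v) = B u v"
  by (simp add: act_reflection[symmetric] form_invariant)

lemma reflection_sq: "\<beta> \<in> roots \<Longrightarrow> reflection \<beta> \<otimes> reflection \<beta> = \<one>"
  by (rule act_eqI) (auto simp: act_mult act_reflection reflect_reflect act_one)

lemma inv_reflection: "\<beta> \<in> roots \<Longrightarrow> inv (reflection \<beta>) = reflection \<beta>"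
  using reflection_sq by (simp add: inv_equality)

lemma reflection_cancel: "\<beta> \<in> roots \<Longrightarrow> w \<in> carrier W \<Longrightarrow> reflection \<beta> \<otimes> (reflection \<beta> \<otimes> w) = w"
  by (simp add: m_assoc[symmetric] reflection_sq)

subsection \<open>Length and inversion sets\<close>
lemma word_prod_simps [simp]:
  "word_prod W [] = \<one>" "word_prod W (x # xs) = x \<otimes> word_prod W xs"
  by (simp_all add: word_prod_def)

lemma word_prod_closed [simp]: "ws \<in> lists S \<Longrightarrow> word_prod W ws \<in> carrier W"
  by (induction ws) auto

lemma word_prod_append:
  "us \<in> lists S \<Longrightarrow> vs \<in> lists S \<Longrightarrow> word_prod W (us @ vs) = word_prod W us \<otimes> word_prod W vs"
  by (induction us) (auto simp: m_assoc)

lemma word_exists: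
  assumes "w \<in> carrier W"
  shows "\<exists>ws\<in>lists S. word_prod W ws = w"
proof -
  have "w \<in> generate W S" using assms generate by simp
  then show ?thesis
  proof (induction rule: generate.induct)
    case one then show ?case by (intro bexI[of _ "[]"]) auto
  next
    case (incl h) then show ?case by (intro bexI[of _ "[h]"]) auto
  next
    case (inv h) then show ?case by (intro bexI[of _ "[h]"]) auto
  next
    case (eng h1 h2)
    then obtain us vs where "us \<in> lists S" "vs \<in> lists S" "word_prod W us = h1" "word_prod W vs = h2" by blast
    then show ?case by (intro bexI[of _ "us @ vs"]) (auto simp: word_prod_append)
  qed
qed

lemma len_le: "ws \<in> lists S \<Longrightarrow> len (word_prod W ws) \<le> length ws"
  unfolding len_def by (rule Least_le) auto

lemma len_word:
  assumes "w \<in> carrier W"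
  shows "\<exists>ws\<in>lists S. length ws = len w \<and> word_prod W ws = w"
  using LeastI_ex[of "\<lambda>n. \<exists>ws \<in> lists S. length ws = n \<and> word_prod W ws = w"] word_exists[OF assms]
  unfolding len_def by blast

lemma len_mult_le: "u \<in> carrier W \<Longrightarrow> v \<in> carrier W \<Longrightarrow> len (u \<otimes> v) \<le> len u + len v"
proof -
  assume "u \<in> carrier W" "v \<in> carrier W"
  then obtain us vs where "us \<in> lists S" "vs \<in> lists S" "word_prod W us = u" "word_prod W vs = v"
     "length us = len u" "length vs = len v" using len_word by meson
  then show ?thesis using len_le[of "us @ vs"] by (simp add: word_prod_append)
qed

lemma len_one [simp]: "len \<one> = 0"
  using len_le[of "[]"] by simp

lemma len_gen: "s \<in> S \<Longrightarrow> len s \<le> 1"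
  using len_le[of "[s]"] by simp

text \<open>Applying the letters from the right, the root \<open>\<alpha> s\<close> first becomes
  negative at some letter \<open>t\<close>. Just before, it is \<open>\<alpha> t\<close>, so
  \<open>u s = t u\<close> for the part \<open>u\<close> already applied, and multiplying by
  \<open>s\<close> amounts to deleting \<open>t\<close>.\<close>

lemma exchange:
  assumes "ws \<in> lists S" "s \<in> S" "f0 (act (word_prod W ws) (\<alpha> s)) < 0"
  shows "\<exists>vs \<in> lists S. Suc (length vs) = length ws \<and> word_prod W vs = word_prod W ws \<otimes> s"
  using assms
proof (induction ws)
  case Nil
  then show ?case using f0_simple[of s] by (simp add: act_one)
next
  case (Cons t us)
  let ?u = "word_prod W us"
  have t: "t \<in> S" "us \<in> lists S" using Cons.hyps by auto
  show ?case
  proof (cases "f0 (act ?u (\<alpha> s)) < 0")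
    case True
    then obtain vs where "vs \<in> lists S" "Suc (length vs) = length us" "word_prod W vs = ?u \<otimes> s"
      using Cons t by auto
    then show ?thesis using t Cons.prems by (intro bexI[of _ "t # vs"]) (auto simp: m_assoc)
  next
    case False
    have r: "act ?u (\<alpha> s) \<in> roots" using t Cons.prems by (simp add: roots_act)
    then have "act ?u (\<alpha> s) \<in> pos_roots" using False f0_root_nonzero[OF r] by (auto simp: pos_roots_iff)
    moreover have "act t (act ?u (\<alpha> s)) \<notin> pos_roots" using Cons.prems t
      by (simp add: act_mult pos_roots_iff)
    ultimately have eq: "act ?u (\<alpha> s) = \<alpha> t" using gen_pos_iff t by blast
    have "?u \<otimes> s \<otimes> inv ?u = t \<otimes> \<one> "
      using reflection_eq[of ?u s] reflection_eq[of \<one> t] t Cons.prems eq by (simp add: act_one)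
    then have "?u \<otimes> s = t \<otimes> ?u" using t Cons.prems
      by (metis gens inv_closed inv_solve_right m_closed r_one word_prod_closed)
    then have "word_prod W (t # us) \<otimes> s = ?u" using t Cons.prems by (simp add: m_assoc)
    then show ?thesis using t by (intro bexI[of _ us]) auto
  qed
qed

section \<open>Inversion sets of products and their sizes\<close>

lemma inversions_iff:
  assumes "w \<in> carrier W"
  shows "\<beta> \<in> inversions w \<longleftrightarrow> \<beta> \<in> pos_roots \<and> f0 (act (inv w) \<beta>) < 0"
proof -
  have "\<beta> \<in> act w ` neg_roots \<longleftrightarrow> - act (inv w) \<beta> \<in> pos_roots"
  proof
    assume "\<beta> \<in> act w ` neg_roots"
    then show "- act (inv w) \<beta> \<in> pos_roots"
      using assms by (auto simp: neg_roots_def act_linear_simps)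
  next
    assume "- act (inv w) \<beta> \<in> pos_roots"
    then have "act (inv w) \<beta> \<in> neg_roots" unfolding neg_roots_def by (metis imageI minus_minus)
    then show "\<beta> \<in> act w ` neg_roots" using assms by (metis act_inv(2) imageI)
  qed
  then show ?thesis unfolding inversions_def
    using assms roots_uminus[OF roots_act[of "inv w" \<beta>]] by (auto simp: pos_roots_iff)
qed

lemma inversionsI:
  "w \<in> carrier W \<Longrightarrow> \<beta> \<in> roots \<Longrightarrow> f0 \<beta> > 0 \<Longrightarrow> f0 (act (inv w) \<beta>) < 0 \<Longrightarrow> \<beta> \<in> inversions w"
  by (simp add: inversions_iff pos_roots_iff)

lemma inversionsD:
  assumes "w \<in> carrier W" "\<beta> \<in> inversions w"
  shows "\<beta> \<in> roots" "f0 \<beta> > 0" "\<beta> \<in> pos_roots" "f0 (act (inv w) \<beta>) < 0"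
  using assms by (auto simp: inversions_iff pos_roots_iff)

lemma inversions_one [simp]: "inversions \<one> = {}"
  by (auto simp: inversions_iff act_one pos_roots_iff)

lemma act_inv_mult: "u \<in> carrier W \<Longrightarrow> v \<in> carrier W \<Longrightarrow> act (inv (u \<otimes> v)) x = act (inv v) (act (inv u) x)"
  by (simp add: inv_mult_group act_mult)

lemma inversions_mult_subset:
  assumes "y \<in> carrier W" "v \<in> carrier W"
  shows "inversions (y \<otimes> v) \<subseteq> inversions y \<union> act y ` {\<delta> \<in> inversions v. f0 (act y \<delta>) > 0}"
proof
  fix \<beta> assume b: "\<beta> \<in> inversions (y \<otimes> v)"
  note bd = inversionsD[OF m_closed[OF assms] b]
  let ?d = "act (inv y) \<beta>"
  have r: "?d \<in> roots" using assms bd by (simp add: roots_act)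
  show "\<beta> \<in> inversions y \<union> act y ` {\<delta> \<in> inversions v. f0 (act y \<delta>) > 0}"
  proof (cases "f0 ?d < 0")
    case True then show ?thesis using assms bd by (simp add: inversions_iff)
  next
    case False
    then have "f0 ?d > 0" using f0_root_nonzero[OF r] by simp
    then have "?d \<in> inversions v" using assms bd r by (auto intro!: inversionsI simp: act_inv_mult)
    moreover have "\<beta> = act y ?d" using assms by simp
    ultimately show ?thesis using bd assms by (metis (mono_tags, lifting) UnI2 imageI mem_Collect_eq)
  qed
qed

lemma inversions_mult_eq:
  assumes "y \<in> carrier W" "v \<in> carrier W" "\<And>\<delta>. \<delta> \<in> inversions v \<Longrightarrow> f0 (act y \<delta>) > 0"
  shows "inversions (y \<otimes> v) = inversions y \<union> act y ` inversions v"
    and "inversions y \<inter> act y ` inversions v = {}"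
proof -
  have 1: "act y \<delta> \<in> inversions (y \<otimes> v)" if "\<delta> \<in> inversions v" for \<delta>
    using that assms inversionsD[OF assms(2) that]
    by (intro inversionsI) (auto simp: act_inv_mult roots_act)
  have 2: "\<beta> \<in> inversions (y \<otimes> v)" if "\<beta> \<in> inversions y" for \<beta>
  proof (rule ccontr)
    note bd = inversionsD[OF assms(1) that]
    assume "\<beta> \<notin> inversions (y \<otimes> v)"
    then have "\<not> f0 (act (inv v) (act (inv y) \<beta>)) < 0"
      using assms bd by (auto simp: inversions_iff act_inv_mult)
    moreover have r: "act (inv y) \<beta> \<in> roots" using assms bd by (simp add: roots_act)
    ultimately have "- act (inv y) \<beta> \<in> inversions v"
      using assms bd f0_root_nonzero[OF roots_act[OF _ r, of "inv v"]]
      by (intro inversionsI) (auto simp: roots_uminus act_linear_simps)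
    from assms(3)[OF this] show False using assms bd by (simp add: act_linear_simps)
  qed
  show "inversions (y \<otimes> v) = inversions y \<union> act y ` inversions v"
    using inversions_mult_subset[OF assms(1,2)] 1 2 assms(3) by blast
  show "inversions y \<inter> act y ` inversions v = {}"
    using inversionsD[OF assms(1)] inversionsD[OF assms(2)] assms by fastforce
qed

lemma act_inj: "w \<in> carrier W \<Longrightarrow> inj_on (act w) A"
  by (metis act_inv(1) inj_onI)

lemma inversions_gen: "s \<in> S \<Longrightarrow> inversions s = {\<alpha> s}"
proof -
  assume s: "s \<in> S"
  have "\<beta> \<in> inversions s \<longleftrightarrow> \<beta> = \<alpha> s" for \<beta>
    using s gen_pos[OF s, of \<beta>] f0_simple[OF s]
    by (cases "\<beta> = \<alpha> s") (auto simp: inversions_iff act_gen_self pos_roots_iff)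
  then show ?thesis by auto
qed

lemma inversions_snoc:
  assumes "w \<in> carrier W" "s \<in> S" "f0 (act w (\<alpha> s)) > 0"
  shows "inversions (w \<otimes> s) = insert (act w (\<alpha> s)) (inversions w)" "act w (\<alpha> s) \<notin> inversions w"
  using inversions_mult_eq[of w s] assms by (auto simp: inversions_gen)

text \<open>By \<open>exchange\<close>, the last letter of a reduced word cannot send its simple
  root to a negative one, so each letter adds exactly one inversion.\<close>

lemma len_eq_card_aux:
  "w \<in> carrier W \<Longrightarrow> len w = n \<Longrightarrow> finite (inversions w) \<and> card (inversions w) = n"
proof (induction n arbitrary: w)
  case 0
  then obtain ws where "length ws = 0" "word_prod W ws = w" using len_word by metis
  then show ?case by auto
next
  case (Suc n)
  obtain ws where ws: "ws \<in> lists S" "length ws = Suc n" "word_prod W ws = w"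
    using len_word[OF Suc.prems(1)] Suc.prems(2) by auto
  then obtain us s where us: "ws = us @ [s]" "length us = n" by (metis length_Suc_conv_rev)
  then have uS: "us \<in> lists S" "s \<in> S" using ws by auto
  let ?u = "word_prod W us"
  have w: "w = ?u \<otimes> s" using ws us uS by (simp add: word_prod_append)
  have "len w \<le> len ?u + 1" using len_mult_le[of ?u s] len_gen[of s] uS w by simp
  then have lu: "len ?u = n" using len_le[OF uS(1)] us Suc.prems by simp
  have IH: "finite (inversions ?u)" "card (inversions ?u) = n" using Suc.IH[of ?u] lu uS by auto
  have "\<not> f0 (act ?u (\<alpha> s)) < 0"
  proof
    assume "f0 (act ?u (\<alpha> s)) < 0"
    from exchange[OF uS this] obtain vs where "vs \<in> lists S" "Suc (length vs) = n" "word_prod W vs = w"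
      using us w by auto
    then show False using len_le[of vs] Suc.prems by simp
  qed
  then have p: "f0 (act ?u (\<alpha> s)) > 0" using f0_root_nonzero[of "act ?u (\<alpha> s)"] uS by (simp add: roots_act)
  show ?case using IH inversions_snoc[OF _ _ p] uS w by simp
qed

lemma finite_inversions [simp]: "w \<in> carrier W \<Longrightarrow> finite (inversions w)"
  and len_card: "w \<in> carrier W \<Longrightarrow> len w = card (inversions w)"
  using len_eq_card_aux by auto

lemma inversions_empty: "w \<in> carrier W \<Longrightarrow> inversions w = {} \<Longrightarrow> w = \<one>"
  using len_word[of w] len_card[of w] by auto

text \<open>An inversion \<open>\<gamma>\<close> of \<open>inv u \<otimes> v\<close> would give, as
  \<open>act u \<gamma>\<close> or its negative, a positive root inverted by exactly one of
  \<open>u\<close> and \<open>v\<close>.\<close>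

lemma inversions_inject:
  assumes "u \<in> carrier W" "v \<in> carrier W" "inversions u = inversions v"
  shows "u = v"
proof -
  let ?x = "inv u \<otimes> v"
  have "inversions ?x = {}"
  proof (rule ccontr)
    assume "inversions ?x \<noteq> {}"
    then obtain \<gamma> where "\<gamma> \<in> inversions ?x" by auto
    then have g: "\<gamma> \<in> roots" "f0 \<gamma> > 0" "f0 (act (inv v) (act u \<gamma>)) < 0"
      using inversionsD[of ?x \<gamma>] assms by (auto simp: act_inv_mult)
    let ?b = "act u \<gamma>"
    have r: "?b \<in> roots" using g assms by (simp add: roots_act)
    consider "f0 ?b > 0" | "f0 ?b < 0" using f0_root_nonzero[OF r] by linarith
    then show False
    proof cases
      case 1
      then have "?b \<in> inversions v" using r g assms by (intro inversionsI) auto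
      then have "?b \<in> inversions u" using assms by simp
      then show False using inversionsD(4)[of u] assms g by force
    next
      case 2
      then have "- ?b \<in> inversions u" using r g assms
        by (intro inversionsI) (auto simp: roots_uminus act_linear_simps)
      then have "- ?b \<in> inversions v" using assms by simp
      then show False using inversionsD(4)[of v] assms g by (force simp: act_linear_simps)
    qed
  qed
  then have "?x = \<one>" using inversions_empty assms by simp
  then show "u = v" using assms by (metis inv_closed inv_inv inv_equality inv_unique' l_inv r_inv m_closed inv_comm)
qed

lemma len_mult_iff:
  assumes "y \<in> carrier W" "v \<in> carrier W"
  shows "len (y \<otimes> v) = len y + len v \<longleftrightarrow> (\<forall>\<delta> \<in> inversions v. f0 (act y \<delta>) > 0)"
proof
  assume l: "len (y \<otimes> v) = len y + len v"
  let ?D = "{\<delta> \<in> inversions v. f0 (act y \<delta>) > 0}"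
  have fin: "finite ?D" using assms by simp
  have "len (y \<otimes> v) \<le> card (inversions y \<union> act y ` ?D)"
    unfolding len_card[OF m_closed[OF assms]]
    by (intro card_mono inversions_mult_subset assms) (use assms fin in auto)
  also have "\<dots> \<le> card (inversions y) + card ?D"
    using card_Un_le[of "inversions y" "act y ` ?D"] card_image_le[OF fin, of "act y"] by linarith
  finally have "card (inversions v) \<le> card ?D" using l assms by (simp add: len_card)
  then have "?D = inversions v" using assms by (intro card_seteq) auto
  then show "\<forall>\<delta> \<in> inversions v. f0 (act y \<delta>) > 0" by auto
next
  assume *: "\<forall>\<delta> \<in> inversions v. f0 (act y \<delta>) > 0"
  have "card (inversions (y \<otimes> v)) = card (inversions y) + card (act y ` inversions v)"
    using inversions_mult_eq[OF assms] * assms by (simp add: card_Un_disjoint)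
  then show "len (y \<otimes> v) = len y + len v" using assms by (simp add: len_card card_image act_inj)
qed

lemma len_snoc_up:
  "w \<in> carrier W \<Longrightarrow> s \<in> S \<Longrightarrow> f0 (act w (\<alpha> s)) > 0 \<Longrightarrow> len (w \<otimes> s) = Suc (len w)"
  using inversions_snoc[of w s] by (simp add: len_card)

lemma snoc_down:
  assumes "w \<in> carrier W" "s \<in> S" "f0 (act w (\<alpha> s)) < 0"
  shows "inversions w = insert (- act w (\<alpha> s)) (inversions (w \<otimes> s))"
    "- act w (\<alpha> s) \<notin> inversions (w \<otimes> s)" "len w = Suc (len (w \<otimes> s))"
    "f0 (act (w \<otimes> s) (\<alpha> s)) > 0" "act (w \<otimes> s) (\<alpha> s) = - act w (\<alpha> s)"
proof -
  show e: "act (w \<otimes> s) (\<alpha> s) = - act w (\<alpha> s)" using assms by (simp add: act_mult act_gen_self act_linear_simps)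
  then show p: "f0 (act (w \<otimes> s) (\<alpha> s)) > 0" using assms by simp
  show "inversions w = insert (- act w (\<alpha> s)) (inversions (w \<otimes> s))"
    "- act w (\<alpha> s) \<notin> inversions (w \<otimes> s)"
    using inversions_snoc[OF _ _ p] assms by (auto simp: e)
  show "len w = Suc (len (w \<otimes> s))" using len_snoc_up[OF _ _ p] assms by simp
qed

subsection \<open>Short inversions\<close>
text \<open>A reduced word of \<open>w\<close> cut at the letter \<open>q\<close> that produces the
  inversion \<open>\<beta>\<close>. Reflecting \<open>w\<close> in \<open>\<beta>\<close> deletes
  this letter, so \<open>\<beta>\<close> is short iff \<open>y \<otimes> v\<close> has length
  \<open>len y + len v\<close>.\<close>

definition splits :: "'a \<Rightarrow> 'v \<Rightarrow> 'a \<Rightarrow> 'a \<Rightarrow> 'a \<Rightarrow> bool" where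
  "splits w \<beta> y q v \<longleftrightarrow> y \<in> carrier W \<and> q \<in> S \<and> v \<in> carrier W \<and> w = y \<otimes> q \<otimes> v \<and>
     \<beta> = act y (\<alpha> q) \<and> len (y \<otimes> q) = Suc (len y) \<and> len w = Suc (len y + len v)"

lemma act_gen_gen: "s \<in> S \<Longrightarrow> act s (act s v) = v"
  by (metis act_mult act_one gen_sq gens)

lemma splitsD:
  assumes "splits w \<beta> y q v"
  shows "y \<in> carrier W" "q \<in> S" "v \<in> carrier W" "w = y \<otimes> q \<otimes> v" "w \<in> carrier W"
    "\<beta> = act y (\<alpha> q)" "\<beta> \<in> roots" "f0 \<beta> > 0" "\<beta> \<in> pos_roots"
    "inversions (y \<otimes> q) = insert \<beta> (inversions y)" "\<beta> \<notin> inversions y"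
    "inversions w = insert \<beta> (inversions y) \<union> act (y \<otimes> q) ` inversions v"
    "insert \<beta> (inversions y) \<inter> act (y \<otimes> q) ` inversions v = {}"
    "reflection \<beta> \<otimes> w = y \<otimes> v"
proof -
  show s: "y \<in> carrier W" "q \<in> S" "v \<in> carrier W" "w = y \<otimes> q \<otimes> v" "\<beta> = act y (\<alpha> q)"
    using assms by (auto simp: splits_def)
  then show r: "w \<in> carrier W" "\<beta> \<in> roots" by (auto simp: roots_act)
  show p: "f0 \<beta> > 0"
  proof (rule ccontr)
    assume "\<not> f0 \<beta> > 0"
    then have "f0 (act y (\<alpha> q)) < 0" using f0_root_nonzero[OF r(2)] s by auto
    from snoc_down(3)[OF s(1,2) this] assms show False by (simp add: splits_def)
  qed
  then show "\<beta> \<in> pos_roots" using r by (simp add: pos_roots_iff)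
  show i: "inversions (y \<otimes> q) = insert \<beta> (inversions y)" "\<beta> \<notin> inversions y"
    using inversions_snoc[OF s(1,2)] p s by auto
  have "len (y \<otimes> q \<otimes> v) = len (y \<otimes> q) + len v" using assms by (auto simp: splits_def)
  then have "\<forall>\<delta>\<in>inversions v. 0 < f0 (act (y \<otimes> q) \<delta>)"
    using len_mult_iff[of "y \<otimes> q" v] s by simp
  then show "inversions w = insert \<beta> (inversions y) \<union> act (y \<otimes> q) ` inversions v"
    "insert \<beta> (inversions y) \<inter> act (y \<otimes> q) ` inversions v = {}"
    using inversions_mult_eq[of "y \<otimes> q" v] s i by auto
  have "reflection \<beta> = y \<otimes> q \<otimes> inv y" using reflection_eq s by simp
  then have "reflection \<beta> \<otimes> w = y \<otimes> (q \<otimes> (inv y \<otimes> (y \<otimes> (q \<otimes> v))))" using s by (simp add: m_assoc)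
  also have "inv y \<otimes> (y \<otimes> (q \<otimes> v)) = q \<otimes> v" using s by (simp add: m_assoc[symmetric])
  finally show "reflection \<beta> \<otimes> w = y \<otimes> v" using s by simp
qed

text \<open>\<open>pos\<close> records the order in which a reduced word produces the inversions;
  its prefixes become initial segments. Later arguments choose a first or last inversion of some
  kind by \<open>pos\<close> and need no words.\<close>

lemma inversion_enumeration:
  assumes "w \<in> carrier W"
  shows "\<exists>pos :: 'v \<Rightarrow> nat. inj_on pos (inversions w) \<and> (\<forall>\<beta> \<in> inversions w.
    \<exists>y q v. splits w \<beta> y q v \<and> inversions y = {\<gamma> \<in> inversions w. pos \<gamma> < pos \<beta>})"
proof -
  obtain ws where ws: "ws \<in> lists S" "length ws = len w" "word_prod W ws = w"
    using len_word[OF assms] by auto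
  define n where "n = len w"
  define p where "p i = word_prod W (take i ws)" for i
  define r where "r i = word_prod W (drop i ws)" for i
  have S: "take i ws \<in> lists S" "drop i ws \<in> lists S" for i
    using ws(1) by (auto dest: in_set_takeD in_set_dropD)
  have cl: "p i \<in> carrier W" "r i \<in> carrier W" for i using S by (auto simp: p_def r_def)
  have w: "w = p i \<otimes> r i" for i
    using word_prod_append[OF S(1)[of i] S(2)[of i]] ws(3) unfolding p_def r_def append_take_drop_id by simp
  have lens: "len (p i) = i \<and> len (r i) = n - i" if "i \<le> n" for i
  proof -
    have "len (p i) \<le> i" "len (r i) \<le> n - i"
      using len_le[OF S(1)[of i]] len_le[OF S(2)[of i]] that ws(2) by (auto simp: p_def r_def n_def)
    moreover have "n \<le> len (p i) + len (r i)"
      using len_mult_le[OF cl(1)[of i] cl(2)[of i]] w[of i] by (simp add: n_def)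
    ultimately show ?thesis using that by linarith
  qed
  have step: "p (Suc i) = p i \<otimes> (ws ! i)" "ws ! i \<in> S" if "i < n" for i
  proof -
    show "ws ! i \<in> S" using that ws nth_mem[of i ws] by (auto simp: n_def)
    then show "p (Suc i) = p i \<otimes> (ws ! i)" using that S[of i] ws(2)
      by (simp add: p_def take_Suc_conv_app_nth n_def word_prod_append del: word_prod_simps(2))
         (simp)
  qed
  have sp: "splits w (act (p i) (\<alpha> (ws ! i))) (p i) (ws ! i) (r (Suc i))" if "i < n" for i
    unfolding splits_def using that cl step[OF that] w[of "Suc i"] lens[of "Suc i"] lens[of i] n_def
    by simp
  \<comment> \<open>Counted from one: the inversion produced by \<open>ws ! i\<close> first occurs
    in the prefix of length \<open>i + 1\<close>.\<close>
  define pos where "pos \<gamma> = (LEAST i. \<gamma> \<in> inversions (p i))" for \<gamma>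
  have inc: "inversions (p (Suc i)) = insert (act (p i) (\<alpha> (ws ! i))) (inversions (p i))" if "i < n" for i
    using splitsD(10)[OF sp[OF that]] step[OF that] by simp
  have mono: "inversions (p i) \<subseteq> inversions (p j)" if "i \<le> j" "j \<le> n" for i j
    using that by (induction j) (auto simp: inc le_Suc_eq)
  have pn: "p n = w" using ws by (simp add: p_def n_def)
  have p0: "inversions (p 0) = {}" by (simp add: p_def)
  have pos: "\<gamma> \<in> inversions (p (pos \<gamma>))" "pos \<gamma> \<le> n" "i < pos \<gamma> \<Longrightarrow> \<gamma> \<notin> inversions (p i)"
    if "\<gamma> \<in> inversions w" for \<gamma> i
    using that pn LeastI[of "\<lambda>i. \<gamma> \<in> inversions (p i)" n] Least_le[of "\<lambda>i. \<gamma> \<in> inversions (p i)" n]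
      not_less_Least[of i "\<lambda>i. \<gamma> \<in> inversions (p i)"] by (auto simp: pos_def)
  have iff: "\<gamma> \<in> inversions (p i) \<longleftrightarrow> pos \<gamma> \<le> i" if "\<gamma> \<in> inversions w" "i \<le> n" for \<gamma> i
    using pos[OF that(1)] mono[of "pos \<gamma>" i] that(2) by (meson not_le subsetD)
  have key: "\<exists>i<n. pos \<beta> = Suc i \<and> \<beta> = act (p i) (\<alpha> (ws ! i))" if b: "\<beta> \<in> inversions w" for \<beta>
  proof -
    have "pos \<beta> \<noteq> 0" using pos(1)[OF b] p0 by (metis emptyE)
    then obtain i where i: "pos \<beta> = Suc i" by (cases "pos \<beta>") auto
    then have "i < n" using pos(2)[OF b] by simp
    moreover have "\<beta> \<notin> inversions (p i)" using pos(3)[OF b, of i] i by simp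
    ultimately show ?thesis using pos(1)[OF b] inc[of i] i by auto
  qed
  show ?thesis
  proof (rule exI[of _ pos], intro conjI ballI)
    fix \<beta> assume b: "\<beta> \<in> inversions w"
    obtain i where i: "i < n" "pos \<beta> = Suc i" "\<beta> = act (p i) (\<alpha> (ws ! i))" using key[OF b] by auto
    have "inversions (p i) = {\<gamma> \<in> inversions w. pos \<gamma> < pos \<beta>}"
      using iff[of _ i] i mono[of i n] pn by auto
    then show "\<exists>y q v. splits w \<beta> y q v \<and> inversions y = {\<gamma> \<in> inversions w. pos \<gamma> < pos \<beta>}"
      using sp[OF i(1)] i by auto
  next
    show "inj_on pos (inversions w)"
      by (rule inj_onI) (metis Suc_inject key)
  qed
qed

lemma split_exists:
  assumes "w \<in> carrier W" "\<beta> \<in> inversions w"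
  obtains y q v where "splits w \<beta> y q v"
  using inversion_enumeration[OF assms(1)] assms(2) that by blast

lemma len_reflection_inversion:
  assumes "w \<in> carrier W" "\<beta> \<in> inversions w"
  shows "len (reflection \<beta> \<otimes> w) < len w"
proof -
  obtain y q v where s: "splits w \<beta> y q v" using split_exists[OF assms] .
  then have "len w = Suc (len y + len v)" by (auto simp: splits_def)
  then show ?thesis using splitsD(1,3,14)[OF s] len_mult_le[of y v] by simp
qed

lemma short_inversions_subset:
  assumes "w \<in> carrier W"
  shows "short_inversions w \<subseteq> inversions w"
proof
  fix \<beta> assume "\<beta> \<in> short_inversions w"
  then have b: "\<beta> \<in> pos_roots" "len (reflection \<beta> \<otimes> w) < len w" by (auto simp: short_inversions_def)
  then have r: "\<beta> \<in> roots" "f0 \<beta> > 0" by (auto simp: pos_rootsD)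
  show "\<beta> \<in> inversions w"
  proof (rule ccontr)
    assume "\<beta> \<notin> inversions w"
    then have pos: "f0 (act (inv w) \<beta>) > 0"
      using assms b f0_root_nonzero[of "act (inv w) \<beta>"] r by (auto simp: inversions_iff roots_act)
    let ?w = "reflection \<beta> \<otimes> w"
    have "f0 (act (inv ?w) \<beta>) < 0"
      using assms r pos by (simp add: act_inv_mult inv_reflection act_reflection reflect_self act_linear_simps)
    then have "\<beta> \<in> inversions ?w" using r assms by (intro inversionsI) auto
    from len_reflection_inversion[OF _ this] have "len w < len ?w"
      using assms r by (simp add: reflection_cancel)
    then show False using b by simp
  qed
qed

lemma short_iff:
  assumes "splits w \<beta> y q v"
  shows "\<beta> \<in> short_inversions w \<longleftrightarrow> (\<forall>\<delta> \<in> inversions v. f0 (act y \<delta>) > 0)"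
proof -
  note s = splitsD[OF assms]
  have "len w = Suc (len y + len v)" using assms by (auto simp: splits_def)
  then have "\<beta> \<in> short_inversions w \<longleftrightarrow> len (y \<otimes> v) = len y + len v"
    using s by (auto simp: short_inversions_def)
  then show ?thesis using len_mult_iff s by simp
qed

text \<open>Cut a reduced word at \<open>\<beta>\<close>. If \<open>\<delta>\<close> is produced
  earlier, it remains an inversion after \<open>\<beta>\<close> is deleted, that is, of
  \<open>reflection \<beta> \<otimes> w\<close>. If it is produced later, it is
  \<open>act (y \<otimes> q) e\<close> with \<open>e\<close> an inversion of \<open>v\<close>, and
  reflecting in \<open>\<beta>\<close> turns it into \<open>act y e\<close>, which is positive
  because \<open>\<beta>\<close> is short.\<close>

lemma short_cases:
  assumes "\<beta> \<in> short_inversions w" "w \<in> carrier W" "\<delta> \<in> inversions w" "\<delta> \<noteq> \<beta>"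
  shows "f0 (act (inv w) (reflect \<beta> \<delta>)) < 0 \<or> f0 (reflect \<beta> \<delta>) > 0"
proof -
  have "\<beta> \<in> inversions w" using short_inversions_subset assms by auto
  then obtain y q v where sp: "splits w \<beta> y q v" using split_exists assms by metis
  note s = splitsD[OF sp]
  have pos: "\<forall>\<delta> \<in> inversions v. f0 (act y \<delta>) > 0" using short_iff[OF sp] assms by simp
  have "\<delta> \<in> inversions y \<or> \<delta> \<in> act (y \<otimes> q) ` inversions v" using assms s by auto
  then show ?thesis
  proof
    assume "\<delta> \<in> inversions y"
    then have "\<delta> \<in> inversions (y \<otimes> v)" using inversions_mult_eq(1)[OF s(1,3)] pos by auto
    then have "f0 (act (inv (reflection \<beta> \<otimes> w)) \<delta>) < 0"
      unfolding s(14) using s(1,3) inversionsD[of "y \<otimes> v"] by simp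
    then show ?thesis using s(5,7) by (simp add: act_inv_mult inv_reflection act_reflection)
  next
    assume "\<delta> \<in> act (y \<otimes> q) ` inversions v"
    then obtain e where e: "e \<in> inversions v" "\<delta> = act (y \<otimes> q) e" by auto
    have "reflect \<beta> \<delta> = act (y \<otimes> q \<otimes> inv y) (act (y \<otimes> q) e)"
      unfolding s(6) e(2) reflect_conj[OF s(1,2)] ..
    also have "\<dots> = act y e" using s(1,2) by (simp add: act_mult act_gen_gen)
    finally show ?thesis using pos e by simp
  qed
qed

text \<open>An inversion \<open>\<delta>\<close> of \<open>v\<close> that witnesses the failure of
  shortness gives the earlier inversion \<open>a = - act y \<delta>\<close> and the later one
  \<open>b = act (y \<otimes> q) \<delta>\<close>. Their sum is a multiple of
  \<open>\<beta>\<close>, positive by \<open>f0\<close>.\<close>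

lemma nonshort_decomp:
  assumes "splits w \<beta> y q v" "\<beta> \<notin> short_inversions w"
  obtains a b x z where "a \<in> inversions y" "b \<in> inversions w" "x > 0" "z > 0" "\<beta> = x *\<^sub>R a + z *\<^sub>R b"
    "b \<notin> insert \<beta> (inversions y)"
proof -
  note s = splitsD[OF assms(1)]
  obtain \<delta> where d: "\<delta> \<in> inversions v" "\<not> f0 (act y \<delta>) > 0" using short_iff[OF assms(1)] assms(2) by auto
  note dv = inversionsD[OF s(3) d(1)]
  let ?b = "act (y \<otimes> q) \<delta>"
  let ?a = "- act y \<delta>"
  have r: "act y \<delta> \<in> roots" using dv s by (simp add: roots_act)
  then have neg: "f0 (act y \<delta>) < 0" using d f0_root_nonzero by force
  have a: "?a \<in> inversions y"
    using r neg s dv by (intro inversionsI) (auto simp: roots_uminus act_linear_simps)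
  have b: "?b \<in> inversions w" "?b \<notin> insert \<beta> (inversions y)" using d s(12,13) by auto
  have bp: "f0 ?b > 0" using inversionsD b s by blast
  have "?b = act y \<delta> - (2 * B (\<alpha> q) \<delta>) *\<^sub>R \<beta>"
    using s by (simp add: act_mult act_gen act_linear_simps)
  then have eq: "?b = - ?a - (2 * B (\<alpha> q) \<delta>) *\<^sub>R \<beta>" by simp
  define k where "k = - (2 * B (\<alpha> q) \<delta>)"
  have kb: "k *\<^sub>R \<beta> = ?a + ?b" using eq by (simp add: k_def algebra_simps)
  have "k * f0 \<beta> = f0 (?a + ?b)" using arg_cong[OF kb, of f0] by simp
  also have "\<dots> > 0" using bp neg by simp
  finally have k: "k > 0" using s by (simp add: zero_less_mult_iff)
  have "\<beta> = (1/k) *\<^sub>R (k *\<^sub>R \<beta>)" using k by simp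
  then have "\<beta> = (1/k) *\<^sub>R ?a + (1/k) *\<^sub>R ?b" unfolding kb by (simp only: scaleR_add_right)
  then show ?thesis using a b k that[of ?a ?b "1/k" "1/k"] by simp
qed

text \<open>Reflect the combination in \<open>\<beta>\<close>. By \<open>short_cases\<close> the
  images of \<open>a\<close> and \<open>b\<close> are each positive or made negative by
  \<open>inv w\<close>. If both are positive, so is \<open>- \<beta>\<close>; if both are made
  negative, so is \<open>- \<beta>\<close>; both are absurd. The mixed case is excluded by
  \<open>key\<close>.\<close>

lemma short_extremal:
  assumes "\<beta> \<in> short_inversions w" "w \<in> carrier W" "a \<in> inversions w" "b \<in> inversions w"
    "a \<noteq> \<beta>" "b \<noteq> \<beta>" "x > 0" "z > 0" "\<beta> = x *\<^sub>R a + z *\<^sub>R b"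
  shows False
proof -
  have bi: "\<beta> \<in> inversions w" using short_inversions_subset[OF assms(2)] assms(1) by blast
  note bd = inversionsD[OF assms(2) bi]
  have key: False
    if "x > 0" "z > 0" and eq: "\<beta> = x *\<^sub>R a + z *\<^sub>R b" and a: "a \<in> inversions w" "a \<noteq> \<beta>"
      and b: "b \<in> inversions w" "b \<noteq> \<beta>"
      and A: "f0 (act (inv w) (reflect \<beta> a)) < 0" and Bp: "f0 (reflect \<beta> b) > 0" for a b x z
  proof -
    note ad = inversionsD[OF assms(2) a(1)] and bbd = inversionsD[OF assms(2) b(1)]
    have one: "1 = x * B \<beta> a + z * B \<beta> b"
      using root_unit[OF bd(1)] eq by (metis B_simps(2) B_simps(6))
    define p q where "p = B \<beta> a" and "q = B \<beta> b"
    have ra: "reflect \<beta> a = (1 - 2 * p * x) *\<^sub>R a + (- 2 * p * z) *\<^sub>R b"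
      unfolding reflect_def p_def[symmetric] by (subst eq) (simp add: algebra_simps)
    have rb: "reflect \<beta> b = (- 2 * q * x) *\<^sub>R a + (1 - 2 * q * z) *\<^sub>R b"
      unfolding reflect_def q_def[symmetric] by (subst eq) (simp add: algebra_simps)
    have w: "inv w \<in> carrier W" using assms by simp
    show False
    \<comment> \<open>Since \<open>p x + q z = 1\<close>, one of \<open>2 p x\<close> and
      \<open>2 q z\<close> is at least 1. Then \<open>reflect \<beta> a\<close>, respectively
      \<open>reflect \<beta> b\<close>, has nonpositive coefficients in \<open>a\<close> and
      \<open>b\<close>, against the assumed sign.\<close>
    proof (cases "2 * p * x \<ge> 1")
      case True
      then have "0 < (2 * p) * x" by linarith
      then have "p > 0" using that(1) by (auto simp: zero_less_mult_iff)
      then have "2 * p * z \<ge> 0" using that(2) by simp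
      have "f0 (act (inv w) (reflect \<beta> a)) = (1 - 2 * p * x) * f0 (act (inv w) a) + (- 2 * p * z) * f0 (act (inv w) b)"
        unfolding ra by (simp add: act_linear_simps[OF w])
      moreover have "(1 - 2 * p * x) * f0 (act (inv w) a) \<ge> 0"
        using True ad by (intro mult_nonpos_nonpos) auto
      moreover have "(- 2 * p * z) * f0 (act (inv w) b) \<ge> 0"
        using \<open>2 * p * z \<ge> 0\<close> bbd by (intro mult_nonpos_nonpos) auto
      ultimately show False using A by linarith
    next
      case False
      then have "2 * q * z > 1" using one unfolding p_def q_def by (simp add: algebra_simps)
      then have "0 < (2 * q) * z" by linarith
      then have "q > 0" using that(2) by (auto simp: zero_less_mult_iff)
      then have "2 * q * x \<ge> 0" using that(1) by simp
      have "f0 (reflect \<beta> b) = (- 2 * q * x) * f0 a + (1 - 2 * q * z) * f0 b"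
        unfolding rb by simp
      moreover have "(- 2 * q * x) * f0 a \<le> 0" using \<open>2 * q * x \<ge> 0\<close> ad by (simp add: mult_nonneg_nonneg)
      moreover have "(1 - 2 * q * z) * f0 b \<le> 0" using \<open>2 * q * z > 1\<close> bbd by (intro mult_nonpos_nonneg) auto
      ultimately show False using Bp by linarith
    qed
  qed
  have w: "inv w \<in> carrier W" using assms by simp
  have r: "reflect \<beta> \<beta> = x *\<^sub>R reflect \<beta> a + z *\<^sub>R reflect \<beta> b"
    using assms(9) unfolding reflect_def by (subst (2 4) assms(9)) (simp add: algebra_simps)
  have bb: "reflect \<beta> \<beta> = - \<beta>" using reflect_self bd by simp
  consider "f0 (reflect \<beta> a) > 0" "f0 (reflect \<beta> b) > 0"
    | "f0 (act (inv w) (reflect \<beta> a)) < 0" "f0 (act (inv w) (reflect \<beta> b)) < 0"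
    | "f0 (act (inv w) (reflect \<beta> a)) < 0" "f0 (reflect \<beta> b) > 0"
    | "f0 (act (inv w) (reflect \<beta> b)) < 0" "f0 (reflect \<beta> a) > 0"
    using short_cases[OF assms(1,2,3,5)] short_cases[OF assms(1,2,4,6)] by blast
  then show False
  proof cases
    case 1
    have "f0 (reflect \<beta> \<beta>) = x * f0 (reflect \<beta> a) + z * f0 (reflect \<beta> b)" unfolding r by simp
    also have "\<dots> > 0" using 1 assms by (intro add_pos_pos mult_pos_pos)
    finally show False using bb bd by simp
  next
    case 2
    have "f0 (act (inv w) (reflect \<beta> \<beta>)) = x * f0 (act (inv w) (reflect \<beta> a)) + z * f0 (act (inv w) (reflect \<beta> b))"
      unfolding r by (simp add: act_linear_simps[OF w])
    also have "\<dots> < 0" using 2 assms by (intro add_neg_neg mult_pos_neg)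
    finally show False using bb bd by (simp add: act_linear_simps[OF w])
  next
    case 3 then show False using key[of x z a b] assms by simp
  next
    case 4 then show False using key[of z x b a] assms by (simp add: add.commute)
  qed
qed

lemma inversions_subset_if_short_subset:
  assumes "w \<in> carrier W" "u \<in> carrier W" "short_inversions w \<subseteq> inversions u"
  shows "inversions w \<subseteq> inversions u"
proof (rule ccontr)
  assume "\<not> inversions w \<subseteq> inversions u"
  then obtain b where b: "b \<in> inversions w" "b \<notin> inversions u" by auto
  define \<phi> where "\<phi> x = f0 (act (inv u) x)" for x
  have u: "inv u \<in> carrier W" using assms by simp
  have lin: "\<phi> (x + y) = \<phi> x + \<phi> y" "\<phi> (c *\<^sub>R x) = c * \<phi> x" for x y c
    by (auto simp: \<phi>_def act_linear_simps[OF u])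
  define M where "M = Max ((\<lambda>x. \<phi> x / f0 x) ` inversions w)"
  have fin: "finite ((\<lambda>x. \<phi> x / f0 x) ` inversions w)" using assms by simp
  have le: "\<phi> x \<le> M * f0 x" if "x \<in> inversions w" for x
  proof -
    have "\<phi> x / f0 x \<le> M" unfolding M_def using that fin by (intro Max_ge) auto
    then show ?thesis using inversionsD[OF assms(1) that] by (simp add: divide_le_eq)
  qed
  have "\<phi> b > 0" using b inversionsD[OF assms(1) b(1)] assms f0_root_nonzero[of "act (inv u) b"]
    by (auto simp: \<phi>_def inversions_iff roots_act)
  then have M: "M > 0" using le[OF b(1)] inversionsD[OF assms(1) b(1)]
    by (smt (verit) mult_nonpos_nonneg)
  define T where "T = {x \<in> inversions w. \<phi> x = M * f0 x}"
  have "M \<in> (\<lambda>x. \<phi> x / f0 x) ` inversions w" unfolding M_def using fin b by (intro Max_in) auto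
  then obtain x0 where "x0 \<in> inversions w" "M = \<phi> x0 / f0 x0" by auto
  then have "x0 \<in> T" using inversionsD[OF assms(1), of x0] by (simp add: T_def)
  obtain pos :: "'v \<Rightarrow> nat" where pos: "\<forall>\<beta> \<in> inversions w. \<exists>y q v. splits w \<beta> y q v \<and> inversions y = {\<gamma> \<in> inversions w. pos \<gamma> < pos \<beta>}"
    using inversion_enumeration[OF assms(1)] by (elim exE conjE)
  define \<beta> where "\<beta> = arg_min pos (\<lambda>x. x \<in> T)"
  have bT: "\<beta> \<in> T" and min: "\<And>x. x \<in> T \<Longrightarrow> pos \<beta> \<le> pos x"
    using arg_min_nat_lemma[of "\<lambda>x. x \<in> T" x0 pos] \<open>x0 \<in> T\<close> by (auto simp: \<beta>_def)
  have bw: "\<beta> \<in> inversions w" using bT by (simp add: T_def)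
  note bd = inversionsD[OF assms(1) bw]
  have "\<phi> \<beta> > 0" using bT M bd by (simp add: T_def)
  then have "\<beta> \<notin> inversions u" using inversionsD(4)[OF assms(2)] by (force simp: \<phi>_def)
  then have ns: "\<beta> \<notin> short_inversions w" using assms by auto
  obtain y q v where sp: "splits w \<beta> y q v" "inversions y = {\<gamma> \<in> inversions w. pos \<gamma> < pos \<beta>}"
    using bspec[OF pos bw] by (elim exE conjE)
  obtain a c x z where ac: "a \<in> inversions y" "c \<in> inversions w" "x > 0" "z > 0" "\<beta> = x *\<^sub>R a + z *\<^sub>R c"
    using nonshort_decomp[OF sp(1) ns] by metis
  have aw: "a \<in> inversions w" "pos a < pos \<beta>" using ac sp by auto
  have "x * \<phi> a + z * \<phi> c = M * (x * f0 a + z * f0 c)"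
    using bT unfolding T_def by (simp add: ac(5) lin)
  moreover have "x * \<phi> a \<le> x * (M * f0 a)" "z * \<phi> c \<le> z * (M * f0 c)"
    using le[OF aw(1)] le[OF ac(2)] ac by auto
  ultimately have "x * \<phi> a = x * (M * f0 a)" by (smt (verit) distrib_left mult.left_commute)
  then have "a \<in> T" using ac aw by (simp add: T_def)
  then show False using min[of a] aw by simp
qed

text \<open>If \<open>\<beta>\<close> ceased to be short when the wall \<open>\<gamma>\<close> is
  removed, \<open>reflect \<beta> \<gamma>\<close> would be negative, and its negative
  \<open>\<delta>\<close> would be an inversion of \<open>w\<close> with
  \<open>\<gamma> + \<delta>\<close> a positive multiple of \<open>\<beta>\<close>.
  \<open>short_extremal\<close> forbids this.\<close>

lemma short_snoc_down:
  assumes "w \<in> carrier W" "t \<in> S" "f0 (act w (\<alpha> t)) < 0" "\<beta> \<in> short_inversions w" "\<beta> \<noteq> - act w (\<alpha> t)"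
  shows "\<beta> \<in> short_inversions (w \<otimes> t)"
proof -
  have bi: "\<beta> \<in> inversions w" using short_inversions_subset[OF assms(1)] assms(4) by blast
  note bd = inversionsD[OF assms(1) bi]
  have lr: "len w = Suc (len (reflection \<beta> \<otimes> w))" using assms(4) by (auto simp: short_inversions_def)
  define \<gamma> where "\<gamma> = - act w (\<alpha> t)"
  have gi: "\<gamma> \<in> inversions w" using snoc_down(1)[OF assms(1-3)] by (simp add: \<gamma>_def)
  note gd = inversionsD[OF assms(1) gi]
  have w: "inv w \<in> carrier W" using assms by simp
  have wg: "act (inv w) \<gamma> = - \<alpha> t" using assms by (simp add: \<gamma>_def act_linear_simps[OF w])
  have "f0 (act (reflection \<beta> \<otimes> w) (\<alpha> t)) < 0"
  proof (rule ccontr)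
    have e: "act (reflection \<beta> \<otimes> w) (\<alpha> t) = - reflect \<beta> \<gamma>"
      using assms bd by (simp add: act_mult act_reflection \<gamma>_def reflect_def algebra_simps)
    assume "\<not> f0 (act (reflection \<beta> \<otimes> w) (\<alpha> t)) < 0"
    moreover have r: "reflect \<beta> \<gamma> \<in> roots" using reflect_root bd gd by simp
    ultimately have neg: "f0 (reflect \<beta> \<gamma>) < 0" using e f0_root_nonzero[OF r] by simp
    let ?k = "2 * B \<beta> \<gamma>"
    define \<delta> where "\<delta> = - reflect \<beta> \<gamma>"
    have sum: "?k *\<^sub>R \<beta> = \<gamma> + \<delta>" by (simp add: \<delta>_def reflect_def)
    have dp: "\<delta> \<in> roots" "f0 \<delta> > 0" using neg r by (auto simp: \<delta>_def roots_uminus)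
    have "?k * f0 \<beta> > 0" using arg_cong[OF sum, of f0] dp gd by simp
    then have k: "?k > 0" using bd by (simp add: zero_less_mult_iff)
    have wd: "?k *\<^sub>R act (inv w) \<beta> = - \<alpha> t + act (inv w) \<delta>"
      using arg_cong[OF sum, of "act (inv w)"] wg by (simp add: act_linear_simps[OF w])
    \<comment> \<open>Otherwise \<open>\<alpha> t\<close> would be a combination of the positive
      roots \<open>- act (inv w) \<beta>\<close> and \<open>act (inv w) \<delta>\<close>, which
      forces \<open>\<beta> = \<gamma>\<close>.\<close>
    have "f0 (act (inv w) \<delta>) < 0"
    proof (rule ccontr)
      assume n: "\<not> f0 (act (inv w) \<delta>) < 0"
      have rd: "act (inv w) \<delta> \<in> roots" using dp w by (simp add: roots_act)
      then have p: "act (inv w) \<delta> \<in> pos_roots" using n f0_root_nonzero[OF rd] by (simp add: pos_roots_iff)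
      have p2: "- act (inv w) \<beta> \<in> pos_roots" using bd w by (simp add: pos_roots_iff roots_act roots_uminus)
      have "?k *\<^sub>R (- act (inv w) \<beta>) + 1 *\<^sub>R act (inv w) \<delta> = 1 *\<^sub>R \<alpha> t" using wd by simp
      from pos_roots_simple_extremal[OF p2 p k _ this assms(2)] have "- act (inv w) \<beta> = \<alpha> t" by simp
      then have "act w (- act (inv w) \<beta>) = act w (\<alpha> t)" by simp
      then have "\<beta> = \<gamma>" using assms(1) by (simp add: act_linear_simps \<gamma>_def)
        (metis minus_minus)
      then show False using assms by (simp add: \<gamma>_def)
    qed
    then have di: "\<delta> \<in> inversions w" using dp assms by (intro inversionsI) auto
    have eq: "\<beta> = (1/?k) *\<^sub>R \<gamma> + (1/?k) *\<^sub>R \<delta>"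
    proof -
      have "\<beta> = (1/?k) *\<^sub>R (?k *\<^sub>R \<beta>)" using k by simp
      then show ?thesis unfolding sum by (simp add: scaleR_add_right)
    qed
    have "\<delta> \<noteq> \<beta>"
    proof
      assume "\<delta> = \<beta>"
      then have "\<gamma> = (?k - 1) *\<^sub>R \<beta>" using sum by (simp add: algebra_simps)
      then have a: "\<gamma> = (?k - 1) *\<^sub>R \<beta>" .
      then have "B \<gamma> \<gamma> = (?k - 1) * (?k - 1)" using root_unit[OF bd(1)] by (metis B_simps(5) B_simps(6) mult.right_neutral)
      moreover have "f0 \<gamma> = (?k - 1) * f0 \<beta>" using a by (metis f0_simps(4))
      then have "?k - 1 > 0" using gd bd by (simp add: zero_less_mult_iff)
      ultimately have "?k - 1 = 1" using root_unit[OF gd(1)]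
        by (metis abs_of_pos power2_eq_square real_sqrt_abs real_sqrt_one)
      then have "\<gamma> = \<beta>" using a by simp
      then show False using assms by (simp add: \<gamma>_def)
    qed
    moreover have "\<gamma> \<noteq> \<beta>" using assms by (simp add: \<gamma>_def)
    ultimately show False using short_extremal[OF assms(4,1) gi di _ _ _ _ eq] k by simp
  qed
  then have "len (reflection \<beta> \<otimes> w) = Suc (len (reflection \<beta> \<otimes> w \<otimes> t))"
    using snoc_down(3)[of "reflection \<beta> \<otimes> w" t] assms bd by simp
  moreover have "len w = Suc (len (w \<otimes> t))" using snoc_down(3) assms by simp
  ultimately have "len (w \<otimes> t) = Suc (len (reflection \<beta> \<otimes> (w \<otimes> t)))"
    using lr assms bd by (simp add: m_assoc)
  then show ?thesis using bd by (auto simp: short_inversions_def)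
qed

text \<open>The new root stays positive when reflected in \<open>\<beta>\<close>, because a
  nonnegative multiple of \<open>\<beta>\<close> is added. So the lengths of \<open>w\<close> and of
  its reflection both grow by one.\<close>

lemma short_snoc_up:
  assumes "w \<in> carrier W" "t \<in> S" "f0 (act w (\<alpha> t)) > 0" "\<beta> \<in> short_inversions w" "B \<beta> (act w (\<alpha> t)) \<le> 0"
  shows "\<beta> \<in> short_inversions (w \<otimes> t)"
proof -
  have bi: "\<beta> \<in> inversions w" using short_inversions_subset[OF assms(1)] assms(4) by blast
  note bd = inversionsD[OF assms(1) bi]
  have "act (reflection \<beta> \<otimes> w) (\<alpha> t) = reflect \<beta> (act w (\<alpha> t))" using assms bd by (simp add: act_mult act_reflection)
  moreover have "f0 (reflect \<beta> (act w (\<alpha> t))) > 0"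
    using assms(3) mult_nonpos_nonneg[OF assms(5), of "f0 \<beta>"] bd unfolding reflect_def by simp
  ultimately have "len (reflection \<beta> \<otimes> w \<otimes> t) = Suc (len (reflection \<beta> \<otimes> w))"
    using len_snoc_up[of "reflection \<beta> \<otimes> w" t] assms bd by simp
  moreover have "len (w \<otimes> t) = Suc (len w)" using len_snoc_up assms by simp
  moreover have "len w = Suc (len (reflection \<beta> \<otimes> w))" using assms(4) by (auto simp: short_inversions_def)
  ultimately have "len (w \<otimes> t) = Suc (len (reflection \<beta> \<otimes> (w \<otimes> t)))"
    using assms bd by (simp add: m_assoc)
  then show ?thesis using bd by (auto simp: short_inversions_def)
qed

subsection \<open>Dominance\<close>

text \<open>Dominance extended from positive to all roots, which makes it invariant under \<open>W\<close>.\<close>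
definition edom :: "'v \<Rightarrow> 'v \<Rightarrow> bool" where
  "edom a b \<longleftrightarrow> (\<forall>w \<in> carrier W. f0 (act w b) < 0 \<longrightarrow> f0 (act w a) < 0)"

lemma dominated_by_iff:
  assumes "a \<in> pos_roots" "b \<in> pos_roots"
  shows "dominated_by a b \<longleftrightarrow> edom a b"
proof
  assume *: "dominated_by a b"
  show "edom a b" unfolding edom_def
  proof (intro ballI impI)
    fix w assume w: "w \<in> carrier W" "f0 (act w b) < 0"
    then have "b \<in> inversions (inv w)" using assms by (simp add: inversions_iff)
    then have "a \<in> inversions (inv w)" using * w unfolding dominated_by_def by simp
    then show "f0 (act w a) < 0" using w by (simp add: inversions_iff)
  qed
next
  assume "edom a b"
  then show "dominated_by a b" unfolding dominated_by_def edom_def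
    using assms by (auto simp: inversions_iff)
qed

lemma edom_trans: "edom a b \<Longrightarrow> edom b c \<Longrightarrow> edom a c" by (auto simp: edom_def)

lemma edom_act:
  assumes "edom a b" "w \<in> carrier W"
  shows "edom (act w a) (act w b)"
  unfolding edom_def
proof (intro ballI impI)
  fix u assume u: "u \<in> carrier W" "f0 (act u (act w b)) < 0"
  then have "f0 (act (u \<otimes> w) b) < 0" using assms by (simp add: act_mult)
  then have "f0 (act (u \<otimes> w) a) < 0" using assms u unfolding edom_def by (meson m_closed)
  then show "f0 (act u (act w a)) < 0" using assms u by (simp add: act_mult)
qed

lemma edom_refl_root: "edom a b \<Longrightarrow> c \<in> roots \<Longrightarrow> edom (reflect c a) (reflect c b)"
  using edom_act[of a b "reflection c"] by (simp add: act_reflection)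

lemma edom_uminus:
  assumes "edom a b" "a \<in> roots" "b \<in> roots"
  shows "edom (- b) (- a)"
  unfolding edom_def
proof (intro ballI impI)
  fix w assume w: "w \<in> carrier W" "f0 (act w (- a)) < 0"
  then have "\<not> f0 (act w a) < 0" by (simp add: act_linear_simps)
  then have "\<not> f0 (act w b) < 0" using assms w unfolding edom_def by auto
  then show "f0 (act w (- b)) < 0"
    using f0_root_nonzero[of "act w b"] assms w by (auto simp: roots_act act_linear_simps)
qed

text \<open>Up to sign these roots belong to the orbits of \<open>a\<close> and \<open>b\<close>
  under the group generated by their two reflections. Pairs are iterated because the recursion looks
  back two terms.\<close>

lemma root_sequence:
  assumes "a \<in> roots" "b \<in> roots"
  obtains u :: "nat \<Rightarrow> 'v" where "u 0 = a" "u 1 = b"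
    "\<And>n. u (Suc (Suc n)) = (2 * B a b) *\<^sub>R u (Suc n) - u n"
    "\<And>n. u n \<in> roots" "\<And>n. B (u n) (u (Suc n)) = B a b"
    "\<And>n. u (Suc (Suc n)) = - reflect (u (Suc n)) (u n)"
proof -
  define p where "p n = ((\<lambda>(x, y). (y, (2 * B a b) *\<^sub>R y - x)) ^^ n) (a, b)" for n
  define u where "u n = fst (p n)" for n
  have s: "snd (p n) = u (Suc n)" for n by (simp add: u_def p_def case_prod_beta)
  have rec: "u (Suc (Suc n)) = (2 * B a b) *\<^sub>R u (Suc n) - u n" for n
    unfolding s[symmetric] u_def by (simp add: p_def case_prod_beta)
  have u0: "u 0 = a" by (simp add: u_def p_def)
  have u1: "u 1 = b" using s[of 0] by (simp add: p_def)
  have main: "u n \<in> roots \<and> u (Suc n) \<in> roots \<and> B (u n) (u (Suc n)) = B a b" for n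
  proof (induction n)
    case 0 then show ?case using assms u0 u1 by simp
  next
    case (Suc n)
    have "B (u (Suc n)) (u n) = B a b" using Suc form_sym by metis
    then have r: "u (Suc (Suc n)) = - reflect (u (Suc n)) (u n)" by (simp add: rec reflect_def)
    have "B (u (Suc n)) (u (Suc (Suc n))) = B a b"
      using Suc root_unit[of "u (Suc n)"] form_sym[of "u (Suc n)" "u n"] by (simp add: rec)
    then show ?case using Suc r reflect_root roots_uminus by metis
  qed
  have "u (Suc (Suc n)) = - reflect (u (Suc n)) (u n)" for n
    using main[of n] form_sym[of "u (Suc n)" "u n"] by (simp add: rec reflect_def)
  then show ?thesis using that[of u] u0 u1 rec main by blast
qed

lemma edom_sequence:
  assumes "edom a b" "a \<in> roots" "b \<in> roots"
  shows "edom b ((2 * B a b) *\<^sub>R b - a)"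
proof -
  have "edom (reflect b a) (reflect b b)" using edom_refl_root assms by simp
  then have "edom (- reflect b b) (- reflect b a)" using edom_uminus reflect_root assms by simp
  then show ?thesis using assms form_sym[of b a] by (simp add: reflect_self) (simp add: reflect_def)
qed

text \<open>Dominance passes along the whole sequence \<open>u\<close>, so all its roots are
  positive; by \<open>positive_recurrence_false\<close> this is impossible for a form value below
  1.\<close>

lemma edom_form_ge_1_pos:
  assumes "edom a b" "a \<in> pos_roots" "b \<in> roots"
  shows "B a b \<ge> 1"
proof (rule ccontr)
  assume "\<not> B a b \<ge> 1"
  have ar: "a \<in> roots" using assms by (simp add: pos_rootsD)
  obtain u where u: "u 0 = a" "u 1 = b" "\<And>n. u (Suc (Suc n)) = (2 * B a b) *\<^sub>R u (Suc n) - u n"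
    "\<And>n. u n \<in> roots" "\<And>n. B (u n) (u (Suc n)) = B a b"
    using root_sequence[OF ar assms(3)] by metis
  have dom: "edom (u n) (u (Suc n))" for n
  proof (induction n)
    case 0 then show ?case using assms u by simp
  next
    case (Suc n)
    from edom_sequence[OF Suc u(4,4)] show ?case using u(3,5) by simp
  qed
  have pos: "f0 (u n) > 0" for n
  proof (induction n)
    case 0 then show ?case using assms u by (simp add: pos_rootsD)
  next
    case (Suc n)
    have "\<not> f0 (u (Suc n)) < 0"
      using dom[of n] Suc unfolding edom_def by (metis act_one one_closed order_less_asym)
    then show ?case using f0_root_nonzero[OF u(4), of "Suc n"] by linarith
  qed
  show False using positive_recurrence_false[of "\<lambda>n. f0 (u n)" "B a b"] pos u(3) \<open>\<not> B a b \<ge> 1\<close> by simp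
qed

lemma root_made_positive:
  assumes "a \<in> roots"
  obtains w where "w \<in> carrier W" "act w a \<in> pos_roots"
  using assms by (elim rootsE) (metis act_inv(1) inv_closed simple_pos)

lemma edom_form_ge_1:
  assumes "edom a b" "a \<in> roots" "b \<in> roots"
  shows "B a b \<ge> 1"
proof -
  obtain w where w: "w \<in> carrier W" "act w a \<in> pos_roots" using root_made_positive assms by metis
  then show ?thesis using edom_form_ge_1_pos[of "act w a" "act w b"] edom_act assms
    by (simp add: roots_act form_invariant)
qed

text \<open>Otherwise the roots \<open>u\<^sub>n\<^sub>+\<^sub>1 = 2 k u\<^sub>n - u\<^sub>n\<^sub>-\<^sub>1\<close> starting from \<open>- d\<close>, \<open>c\<close> are infinitely many inversions of \<open>g\<^sup>-\<^sup>1\<close>.\<close>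
lemma no_common_negative:
  assumes "c \<in> roots" "d \<in> roots" "f0 c > 0" "f0 d > 0" "k \<ge> 1" "B c d = - k" "g \<in> carrier W"
    "f0 (act g c) < 0" "f0 (act g d) + k * f0 (act g c) \<le> 0"
  shows False
proof -
  have Bk: "B (- d) c = k" using assms form_sym[of c d] by simp
  obtain u where u: "u 0 = - d" "u 1 = c" "\<And>n. u (Suc (Suc n)) = (2 * k) *\<^sub>R u (Suc n) - u n"
    "\<And>n. u n \<in> roots"
    using root_sequence[of "- d" c] assms Bk roots_uminus by metis
  have a: "f0 (u (Suc n)) > 0 \<and> f0 (u n) < f0 (u (Suc n))" for n
  proof (induction n)
    case 0 then show ?case using assms u by simp
  next
    case (Suc n)
    have "f0 (u (Suc (Suc n))) - f0 (u (Suc n)) = (2 * k - 2) * f0 (u (Suc n)) + (f0 (u (Suc n)) - f0 (u n))"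
      by (simp add: u algebra_simps)
    moreover have "(2 * k - 2) * f0 (u (Suc n)) \<ge> 0" using Suc assms by simp
    ultimately show ?case using Suc by linarith
  qed
  define \<phi> where "\<phi> x = f0 (act g x)" for x
  have lin: "\<phi> (c *\<^sub>R x - y) = c * \<phi> x - \<phi> y" "\<phi> (c *\<^sub>R x + y) = c * \<phi> x + \<phi> y" for x y c
    using assms by (auto simp: \<phi>_def act_linear_simps)
  have b: "\<phi> (u (Suc n)) < 0 \<and> \<phi> (u (Suc (Suc n))) \<le> \<phi> (u (Suc n))" for n
  proof (induction n)
    case 0
    \<comment> \<open>The second new root is \<open>2 k c + d\<close>. The last hypothesis of the
      lemma makes its value at most \<open>k \<phi> c\<close>, hence at most
      \<open>\<phi> c\<close>, which starts the descent.\<close>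
    have "\<phi> (u (Suc (Suc 0))) = k * \<phi> c + (\<phi> d + k * \<phi> c)" using u by (simp add: lin)
    moreover have c: "\<phi> c < 0" "\<phi> d + k * \<phi> c \<le> 0" using assms by (auto simp: \<phi>_def)
    moreover have "k * \<phi> c \<le> 1 * \<phi> c" using assms c by (intro mult_right_mono_neg) auto
    moreover have "\<phi> (u (Suc 0)) = \<phi> c" using u by simp
    ultimately show ?case by (intro conjI) linarith+
  next
    case (Suc n)
    have "\<phi> (u (Suc (Suc (Suc n)))) - \<phi> (u (Suc (Suc n))) = (2 * k - 2) * \<phi> (u (Suc (Suc n))) + (\<phi> (u (Suc (Suc n))) - \<phi> (u (Suc n)))"
      by (simp add: u(3)[of "Suc n"] lin algebra_simps)
    moreover have "(2 * k - 2) * \<phi> (u (Suc (Suc n))) \<le> 0" using Suc assms by (intro mult_nonneg_nonpos) auto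
    ultimately show ?case using Suc by linarith
  qed
  have "strict_mono (\<lambda>n. f0 (u (Suc n)))" by (rule strict_monoI_Suc) (use a in blast)
  then have inj: "inj (\<lambda>n. u (Suc n))"
    by (metis (mono_tags, lifting) injI strict_mono_eq)
  have "range (\<lambda>n. u (Suc n)) \<subseteq> inversions (inv g)"
    using a b u assms by (auto simp: \<phi>_def intro!: inversionsI)
  then show False using inj assms by (metis finite_inversions finite_subset infinite_UNIV_nat finite_imageD inv_closed)
qed

text \<open>If both directions fail, at \<open>w\<close> and at \<open>v\<close>, move by
  \<open>w\<close>: \<open>act w a\<close> and \<open>- act w b\<close> are positive roots with form
  value at most -1, and \<open>v \<otimes> inv w\<close> makes both of them negative or worse for
  \<open>no_common_negative\<close>.\<close>

lemma edom_total:
  assumes "a \<in> roots" "b \<in> roots" "B a b \<ge> 1"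
  shows "edom a b \<or> edom b a"
proof (rule ccontr)
  assume "\<not> (edom a b \<or> edom b a)"
  then obtain w v where w: "w \<in> carrier W" "f0 (act w b) < 0" "\<not> f0 (act w a) < 0"
    and v: "v \<in> carrier W" "f0 (act v a) < 0" "\<not> f0 (act v b) < 0"
    unfolding edom_def by auto
  have p: "f0 (act w a) > 0" "f0 (act v b) > 0"
    using w v f0_root_nonzero[of "act w a"] f0_root_nonzero[of "act v b"] assms
    by (auto simp: roots_act)
  show False
  proof (rule no_common_negative[of "act w a" "- act w b" "B a b" "v \<otimes> inv w"])
    have "B a b * f0 (act v a) \<le> 0" using assms v by (intro mult_nonneg_nonpos) auto
    then show "f0 (act (v \<otimes> inv w) (- act w b)) + B a b * f0 (act (v \<otimes> inv w) (act w a)) \<le> 0"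
      using w v p by (simp add: act_mult act_linear_simps)
  qed (use assms w v p in \<open>auto simp: roots_act roots_uminus form_invariant act_mult\<close>)
qed

lemma inversion_reflection: "b \<in> pos_roots \<Longrightarrow> b \<in> inversions (reflection b)"
  using pos_rootsD[of b] by (intro inversionsI) (auto simp: inv_reflection act_reflection reflect_self)

text \<open>Follow a reduced word of the reflection in \<open>b\<close> to the letter producing
  \<open>b\<close>. The prefix inverting \<open>b\<close> must invert \<open>a\<close> as well; only
  \<open>b\<close> is new, so \<open>a\<close> came strictly earlier, and then so did
  \<open>b\<close>.\<close>

lemma edom_antisym:
  assumes "edom a b" "edom b a" "a \<in> roots" "b \<in> roots"
  shows "a = b"
proof -
  have *: "a = b" if "edom a b" "edom b a" "a \<in> pos_roots" "b \<in> roots" for a b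
  proof (rule ccontr)
    assume ne: "a \<noteq> b"
    have "f0 b > 0" using that f0_root_nonzero[of b] pos_rootsD[of a] unfolding edom_def
      by (metis act_one linorder_neqE_linordered_idom one_closed order_less_asym)
    then have b: "b \<in> pos_roots" using that by (simp add: pos_roots_iff)
    have r: "reflection b \<in> carrier W" using that by simp
    obtain y q v where "splits (reflection b) b y q v" using split_exists[OF r inversion_reflection[OF b]] .
    note s = splitsD[OF this]
    have d: "dominated_by a b" "dominated_by b a" using that b dominated_by_iff by auto
    have "b \<in> inversions (y \<otimes> q)" using s(10) by simp
    then have "a \<in> inversions (y \<otimes> q)" using d(1) s(1,2) unfolding dominated_by_def by simp
    then have "a \<in> inversions y" using s(10) ne by simp
    then have "b \<in> inversions y" using d(2) s(1) unfolding dominated_by_def by simp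
    then show False using s(11) by simp
  qed
  obtain w where w: "w \<in> carrier W" "act w a \<in> pos_roots" using root_made_positive assms by metis
  then have "act w a = act w b" using *[of "act w a" "act w b"] assms edom_act by (simp add: roots_act)
  then show ?thesis using w by (metis act_inv(1))
qed

text \<open>The vector \<open>a - B a b *\<^sub>R b\<close> is orthogonal to \<open>b\<close>, and
  the claim is that every element leaves its \<open>f0\<close> value negative. A failure, together
  with an element that makes \<open>a\<close> but not \<open>b\<close> negative, meets the
  hypotheses of \<open>no_common_negative\<close>.\<close>

lemma edom_strict:
  assumes "edom a b" "a \<noteq> b" "a \<in> roots" "b \<in> roots" "w \<in> carrier W"
  shows "f0 (act w a) < B a b * f0 (act w b)"
proof (rule ccontr)
  let ?k = "B a b"
  assume neg: "\<not> f0 (act w a) < ?k * f0 (act w b)"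
  have k: "?k \<ge> 1" using edom_form_ge_1 assms by simp
  have "\<not> edom b a" using edom_antisym assms by auto
  then obtain x where x: "x \<in> carrier W" "f0 (act x a) < 0" "\<not> f0 (act x b) < 0"
    unfolding edom_def by auto
  then have xb: "f0 (act x b) > 0" using f0_root_nonzero[of "act x b"] assms by (auto simp: roots_act)
  \<comment> \<open>Composing with the reflection in \<open>b\<close> changes the sign of
    \<open>b\<close> and fixes the orthogonal component, so \<open>b\<close> may be assumed to
    become negative.\<close>
  obtain g where g: "g \<in> carrier W" "f0 (act g b) < 0" "f0 (act g a) \<ge> ?k * f0 (act g b)"
  proof (cases "f0 (act w b) < 0")
    case True then show ?thesis using that[of w] neg assms by simp
  next
    case False
    let ?g = "w \<otimes> reflection b"
    have "f0 (act w b) \<noteq> 0" using f0_root_nonzero assms by (simp add: roots_act)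
    moreover have "act ?g b = - act w b" using assms by (simp add: act_mult act_reflection reflect_self act_linear_simps)
    moreover have "act ?g a = act w a - (2 * ?k) *\<^sub>R act w b"
      using assms form_sym[of b a] by (simp add: act_mult act_reflection reflect_def act_linear_simps)
    then have "f0 (act ?g a) = f0 (act w a) - 2 * ?k * f0 (act w b)" by simp
    ultimately show ?thesis using that[of ?g] False neg assms by simp
  qed
  show False
  proof (rule no_common_negative[of "act x b" "- act x a" ?k "g \<otimes> inv x"])
    show "B (act x b) (- act x a) = - ?k" using x form_sym[of b a] by (simp add: form_invariant)
    show "f0 (act (g \<otimes> inv x) (- act x a)) + ?k * f0 (act (g \<otimes> inv x) (act x b)) \<le> 0"
      using x g by (simp add: act_mult act_linear_simps)
  qed (use assms x xb k g in \<open>auto simp: roots_act roots_uminus act_mult\<close>)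
qed

text \<open>One test element suffices. Otherwise \<open>b\<close> dominates in the other direction,
  and \<open>edom_strict\<close> gives \<open>f0 (act w b) < k f0 (act w a)\<close>, which is at
  most \<open>k^2 f0 (act w b)\<close> and so at most \<open>f0 (act w b)\<close>.\<close>

lemma edomI:
  assumes "a \<in> roots" "b \<in> roots" "B a b \<ge> 1" "w \<in> carrier W" "f0 (act w b) < 0"
    "f0 (act w a) \<le> B a b * f0 (act w b)"
  shows "edom a b"
proof (rule ccontr)
  let ?k = "B a b"
  assume n: "\<not> edom a b"
  then have "edom b a" "b \<noteq> a" using edom_total[OF assms(1-3)] by auto
  then have "f0 (act w b) < ?k * f0 (act w a)" using edom_strict[of b a w] assms form_sym[of b a] by simp
  also have "\<dots> \<le> ?k * (?k * f0 (act w b))" using assms by (intro mult_left_mono) auto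
  also have "\<dots> \<le> ?k * f0 (act w b)"
    using assms mult_right_mono_neg[of 1 ?k "f0 (act w b)"] by (intro mult_left_mono) auto
  also have "\<dots> \<le> f0 (act w b)" using assms mult_right_mono_neg[of 1 ?k "f0 (act w b)"] by auto
  finally show False by simp
qed

section \<open>Dominance depth as the size of a finite set\<close>

definition dom_set :: "'v \<Rightarrow> 'v set" where
  "dom_set b = {a \<in> pos_roots. a \<noteq> b \<and> edom a b}"

lemma finite_dom_set: "b \<in> pos_roots \<Longrightarrow> finite (dom_set b)"
proof (rule finite_subset)
  assume b: "b \<in> pos_roots"
  show "finite (inversions (reflection b))" using b by (simp add: pos_rootsD)
  show "dom_set b \<subseteq> inversions (reflection b)"
  proof
    fix a assume "a \<in> dom_set b"
    then have "dominated_by a b" using dominated_by_iff[OF _ b] by (simp add: dom_set_def)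
    then show "a \<in> inversions (reflection b)"
      using inversion_reflection[OF b] b unfolding dominated_by_def by (simp add: pos_rootsD)
  qed
qed

lemma dominance_depth_eq:
  assumes "b \<in> pos_roots"
  shows "dominance_depth b = enat (card (dom_set b))"
proof -
  have "{\<gamma> \<in> pos_roots - {b}. dominated_by \<gamma> b} = dom_set b"
    using assms dominated_by_iff by (auto simp: dom_set_def)
  then show ?thesis using finite_dom_set[OF assms] by (simp add: dominance_depth_def)
qed

lemma dominance_depth_le:
  assumes "a \<in> pos_roots" "b \<in> pos_roots" "inj_on h (dom_set a)" "h ` dom_set a \<subseteq> dom_set b"
  shows "dominance_depth a \<le> dominance_depth b"
  using card_inj_on_le[OF assms(3,4) finite_dom_set] assms by (simp add: dominance_depth_eq)

lemma dominance_depth_edom: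
  assumes "a \<in> pos_roots" "b \<in> pos_roots" "edom a b"
  shows "dominance_depth a \<le> dominance_depth b"
proof (rule dominance_depth_le[where h = id])
  show "id ` dom_set a \<subseteq> dom_set b"
    using assms edom_trans[OF _ assms(3)] edom_antisym[OF assms(3)] pos_rootsD(1)
    by (auto simp: dom_set_def)
qed (use assms in auto)

lemma reflect_pos:
  assumes "a \<in> pos_roots" "c \<in> pos_roots" "B c a \<le> 0"
  shows "reflect c a \<in> pos_roots"
  using assms reflect_root mult_nonpos_nonneg[OF assms(3), of "f0 c"]
  by (simp add: pos_roots_iff) (simp add: reflect_def)

text \<open>Dominated roots with form value at least 1 with \<open>\<beta>\<close> are kept, the
  others are replaced by \<open>g\<close>. Kept roots have form value at least 1 with
  \<open>a\<close>, replacements less than 1, so the two kinds of images cannot collide.\<close>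

lemma dominance_depth_le_exchange:
  assumes ab: "a \<in> pos_roots" "\<beta> \<in> pos_roots" and less: "B \<beta> a < 1"
    and g: "\<And>\<delta>. \<delta> \<in> dom_set a \<Longrightarrow> B \<delta> \<beta> < 1 \<Longrightarrow> g \<delta> \<in> dom_set \<beta> \<and> B (g \<delta>) a < 1"
    and inj: "inj_on g {\<delta> \<in> dom_set a. B \<delta> \<beta> < 1}"
  shows "dominance_depth a \<le> dominance_depth \<beta>"
proof -
  have r: "a \<in> roots" "\<beta> \<in> roots" using ab by (auto simp: pos_rootsD)
  have D: "\<delta> \<in> pos_roots" "\<delta> \<in> roots" "edom \<delta> a" "B \<delta> a \<ge> 1" if "\<delta> \<in> dom_set a" for \<delta>
    using that edom_form_ge_1[of \<delta> a] r by (auto simp: dom_set_def pos_rootsD)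
  have stay: "\<delta> \<in> dom_set \<beta>" if d: "\<delta> \<in> dom_set a" "\<not> B \<delta> \<beta> < 1" for \<delta>
  proof -
    have "\<not> edom \<beta> \<delta>"
    proof
      assume "edom \<beta> \<delta>"
      then have "edom \<beta> a" using D[OF d(1)] edom_trans by blast
      then show False using edom_form_ge_1[OF _ r(2,1)] less by simp
    qed
    then have "edom \<delta> \<beta>" using edom_total[OF D(2)[OF d(1)] r(2)] d(2) by auto
    moreover have "\<delta> \<noteq> \<beta>" using D(4)[OF d(1)] less by auto
    ultimately show ?thesis using D[OF d(1)] by (simp add: dom_set_def)
  qed
  define h where "h \<delta> = (if B \<delta> \<beta> < 1 then g \<delta> else \<delta>)" for \<delta>
  show ?thesis
  proof (rule dominance_depth_le[OF ab])
    show "h ` dom_set a \<subseteq> dom_set \<beta>"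
      using g stay by (auto simp: h_def)
    show "inj_on h (dom_set a)"
    proof (rule inj_onI)
      fix x y assume xy: "x \<in> dom_set a" "y \<in> dom_set a" "h x = h y"
      show "x = y"
      proof (cases "B x \<beta> < 1"; cases "B y \<beta> < 1")
        assume "B x \<beta> < 1" "B y \<beta> < 1"
        then show ?thesis using xy inj_onD[OF inj] by (simp add: h_def)
      next
        assume c: "B x \<beta> < 1" "\<not> B y \<beta> < 1"
        then have "g x = y" using xy by (simp add: h_def)
        then show ?thesis using g[OF xy(1) c(1)] D(4)[OF xy(2)] by simp
      next
        assume c: "\<not> B x \<beta> < 1" "B y \<beta> < 1"
        then have "g y = x" using xy by (simp add: h_def)
        then show ?thesis using g[OF xy(2) c(2)] D(4)[OF xy(1)] by simp
      next
        assume "\<not> B x \<beta> < 1" "\<not> B y \<beta> < 1"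
        then show ?thesis using xy by (simp add: h_def)
      qed
    qed
  qed
qed

text \<open>The replacement is the reflection itself. A root \<open>\<delta>\<close> has to be moved
  only if its form value drops in passing from \<open>\<rho>\<close> to the reflected root, and this
  makes \<open>B \<tau> \<delta>\<close> negative, so the image of \<open>\<delta>\<close> is
  positive.\<close>

lemma dominance_depth_le_reflect:
  assumes "\<rho> \<in> pos_roots" "\<tau> \<in> pos_roots" "B \<rho> \<tau> < 0"
  shows "dominance_depth \<rho> \<le> dominance_depth (reflect \<tau> \<rho>)"
proof -
  let ?\<rho> = "reflect \<tau> \<rho>"
  have s: "B \<tau> \<rho> = B \<rho> \<tau>" by (rule form_sym)
  have r: "\<rho> \<in> roots" "\<tau> \<in> roots" using assms by (auto simp: pos_rootsD)
  have p: "?\<rho> \<in> pos_roots" using reflect_pos assms s by simp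
  have less: "B ?\<rho> \<rho> < 1"
    using assms root_unit[OF r(1)] mult_neg_neg[of "B \<rho> \<tau>" "B \<rho> \<tau>"] by (simp add: reflect_def s)
  show ?thesis
  proof (rule dominance_depth_le_exchange[OF assms(1) p less, where g = "reflect \<tau>"])
    fix \<delta> assume d: "\<delta> \<in> dom_set \<rho>" "B \<delta> ?\<rho> < 1"
    then have dd: "\<delta> \<in> pos_roots" "\<delta> \<in> roots" "\<delta> \<noteq> \<rho>" "edom \<delta> \<rho>" by (auto simp: dom_set_def pos_rootsD)
    have "B \<delta> ?\<rho> = B \<delta> \<rho> - 2 * (B \<rho> \<tau> * B \<delta> \<tau>)" by (simp add: reflect_def s)
    moreover have "B \<delta> \<rho> \<ge> 1" using edom_form_ge_1 dd r by simp
    ultimately have "B \<rho> \<tau> * B \<delta> \<tau> > 0" using d(2) by linarith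
    then have "B \<tau> \<delta> < 0" using assms form_sym[of \<tau> \<delta>] by (simp add: zero_less_mult_iff)
    then have "reflect \<tau> \<delta> \<in> pos_roots" using reflect_pos dd assms by simp
    moreover have "reflect \<tau> \<delta> \<noteq> ?\<rho>" using dd(3) reflect_reflect[OF r(2)] by metis
    moreover have "edom (reflect \<tau> \<delta>) ?\<rho>" by (rule edom_refl_root[OF dd(4) r(2)])
    moreover have "B (reflect \<tau> \<delta>) \<rho> < 1"
      using B_reflect_reflect[OF r(2), of \<delta> ?\<rho>] reflect_reflect[OF r(2)] d(2) by simp
    ultimately show "reflect \<tau> \<delta> \<in> dom_set ?\<rho> \<and> B (reflect \<tau> \<delta>) \<rho> < 1" by (simp add: dom_set_def)
  next
    show "inj_on (reflect \<tau>) {\<delta> \<in> dom_set \<rho>. B \<delta> ?\<rho> < 1}"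
      by (metis inj_onI reflect_reflect[OF r(2)])
  qed
qed

subsection \<open>Finite dihedral root systems\<close>
definition plane :: "'v \<Rightarrow> 'v \<Rightarrow> 'v set" where
  "plane a b = {x *\<^sub>R a + y *\<^sub>R b | x y. True}"

lemma planeI: "x *\<^sub>R a + y *\<^sub>R b \<in> plane a b"
  by (auto simp: plane_def)

lemma plane_self [simp]: "a \<in> plane a b" "b \<in> plane a b"
  using planeI[of 1 a 0 b] planeI[of 0 a 1 b] by auto

lemma plane_commute: "plane b a = plane a b"
  by (auto simp: plane_def) (metis add.commute)+

lemma plane_add: "u \<in> plane a b \<Longrightarrow> v \<in> plane a b \<Longrightarrow> u + v \<in> plane a b"
proof -
  assume "u \<in> plane a b" "v \<in> plane a b"
  then obtain x y x' y' where "u = x *\<^sub>R a + y *\<^sub>R b" "v = x' *\<^sub>R a + y' *\<^sub>R b" by (auto simp: plane_def)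
  then have "u + v = (x + x') *\<^sub>R a + (y + y') *\<^sub>R b" by (simp add: algebra_simps)
  then show ?thesis by (simp add: planeI)
qed

lemma plane_scale: "u \<in> plane a b \<Longrightarrow> k *\<^sub>R u \<in> plane a b"
proof -
  assume "u \<in> plane a b"
  then obtain x y where "u = x *\<^sub>R a + y *\<^sub>R b" by (auto simp: plane_def)
  then have "k *\<^sub>R u = (k * x) *\<^sub>R a + (k * y) *\<^sub>R b" by (simp add: algebra_simps)
  then show ?thesis by (simp add: planeI)
qed

lemma plane_minus: "u \<in> plane a b \<Longrightarrow> - u \<in> plane a b"
  using plane_scale[of u a b "-1"] by simp

lemma plane_diff: "u \<in> plane a b \<Longrightarrow> v \<in> plane a b \<Longrightarrow> u - v \<in> plane a b"
  using plane_add[of u a b "- v"] plane_minus by simp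

lemma plane_reflect: "u \<in> plane a b \<Longrightarrow> r \<in> plane a b \<Longrightarrow> reflect r u \<in> plane a b"
  unfolding reflect_def by (intro plane_diff plane_scale)

lemma reflect_coords:
  shows "B a a = 1 \<Longrightarrow> reflect a (x *\<^sub>R a + y *\<^sub>R b) = (- x - 2 * B a b * y) *\<^sub>R a + y *\<^sub>R b"
    and "B b b = 1 \<Longrightarrow> reflect b (x *\<^sub>R a + y *\<^sub>R b) = x *\<^sub>R a + (- y - 2 * B b a * x) *\<^sub>R b"
proof -
  have *: "reflect a (x *\<^sub>R a + y *\<^sub>R b) = (- x - 2 * B a b * y) *\<^sub>R a + y *\<^sub>R b" if "B a a = 1" for a b x y
  proof -
    have e: "- x - 2 * B a b * y = x - 2 * (x + y * B a b)" by (simp add: algebra_simps)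
    have B: "B a (x *\<^sub>R a + y *\<^sub>R b) = x + y * B a b" using that by simp
    show ?thesis unfolding reflect_def B e scaleR_diff_left by (simp only: diff_add_eq)
  qed
  show "B a a = 1 \<Longrightarrow> reflect a (x *\<^sub>R a + y *\<^sub>R b) = (- x - 2 * B a b * y) *\<^sub>R a + y *\<^sub>R b"
    by (rule *)
  show "B b b = 1 \<Longrightarrow> reflect b (x *\<^sub>R a + y *\<^sub>R b) = x *\<^sub>R a + (- y - 2 * B b a * x) *\<^sub>R b"
    using *[of b y x a] by (simp add: add.commute)
qed

text \<open>The hypothesis is the Cayley-Hamilton identity for trace \<open>t\<close> and
  determinant 1; the conclusion is the same identity for the square, whose trace is
  \<open>t^2 - 2\<close>.\<close>

lemma rotation_square:
  assumes g: "g \<in> carrier W" "\<And>v. v \<in> plane a b \<Longrightarrow> act g v \<in> plane a b \<and> act g (act g v) = t *\<^sub>R act g v - v"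
    and v: "v \<in> plane a b"
  shows "act (g \<otimes> g) v \<in> plane a b \<and> act (g \<otimes> g) (act (g \<otimes> g) v) = (t\<^sup>2 - 2) *\<^sub>R act (g \<otimes> g) v - v"
proof -
  let ?x = "act g v"
  let ?h = "act g ?x"
  have x: "?x \<in> plane a b" "?h \<in> plane a b" using g(2) v by blast+
  have h: "?h = t *\<^sub>R ?x - v" using g v by simp
  have 1: "act g ?h = t *\<^sub>R ?h - ?x" using g(2)[OF x(1)] by simp
  have 2: "act g (act g ?h) = t *\<^sub>R act g ?h - ?h" using g(2)[OF x(2)] by simp
  have "act g (act g ?h) = (t\<^sup>2) *\<^sub>R ?h - t *\<^sub>R ?x - ?h"
    unfolding 2 unfolding 1 by (simp add: algebra_simps power2_eq_square)
  also have "t *\<^sub>R ?x = ?h + v" using h by simp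
  finally have "act g (act g ?h) = (t\<^sup>2 - 2) *\<^sub>R ?h - v" by (simp add: algebra_simps scaleR_2)
  then show ?thesis using g x by (simp add: act_mult)
qed

text \<open>
  Squaring a rotation of the plane changes its trace from \<open>t\<close> to \<open>t\<^sup>2 - 2\<close>, which at least doubles
  \<open>2 - t\<close> as long as \<open>t > 0\<close>.  So some power \<open>g\<close> of the product of the two reflections has \<open>t \<le> 0\<close>,
  and then \<open>g\<^sup>2 \<rho> = t g \<rho> - \<rho>\<close> shows that \<open>g\<close> or \<open>g\<^sup>2\<close> makes a given positive root negative.
\<close>
lemma finite_plane_roots:
  assumes a: "a \<in> roots" and b: "b \<in> roots" and k: "\<bar>B a b\<bar> < 1"
  shows "finite (roots \<inter> plane a b)"
proof -
  define Q where "Q g t \<longleftrightarrow> g \<in> carrier W \<and> (\<forall>v \<in> plane a b. act g v \<in> plane a b \<and> act g (act g v) = t *\<^sub>R act g v - v)" for g t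
  define k where "k = B a b"
  have kb: "B b a = k" using form_sym k_def by metis
  let ?g = "reflection a \<otimes> reflection b"
  have ra: "reflect a (x *\<^sub>R a + y *\<^sub>R b) = (- x - 2 * k * y) *\<^sub>R a + y *\<^sub>R b" for x y
    using reflect_coords(1)[OF root_unit[OF a]] by (simp add: k_def)
  have rb: "reflect b (x *\<^sub>R a + y *\<^sub>R b) = x *\<^sub>R a + (- y - 2 * k * x) *\<^sub>R b" for x y
    using reflect_coords(2)[OF root_unit[OF b]] by (simp add: kb)
  have g: "act ?g (x *\<^sub>R a + y *\<^sub>R b) = ((4 * k^2 - 1) * x + 2 * k * y) *\<^sub>R a + (- y - 2 * k * x) *\<^sub>R b" for x y
    using a b by (simp add: act_mult act_reflection rb ra) (simp add: algebra_simps power2_eq_square)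
  \<comment> \<open>With \<open>k = cos x\<close> the product of the reflections rotates by
    \<open>2 x\<close>, and \<open>4 k^2 - 2 = 2 cos (2 x)\<close> is its trace.\<close>
  have Q0: "Q ?g (4 * k^2 - 2)"
    unfolding Q_def
  proof (intro conjI ballI)
    fix v assume "v \<in> plane a b"
    then obtain x y where v: "v = x *\<^sub>R a + y *\<^sub>R b" by (auto simp: plane_def)
    show "act ?g v \<in> plane a b" unfolding v g by (rule planeI)
    define P Q where "P = (4 * k^2 - 1) * x + 2 * k * y" and "Q = - y - 2 * k * x"
    have e: "(4 * k^2 - 1) * P + 2 * k * Q = (4 * k^2 - 2) * P - x" "- Q - 2 * k * P = (4 * k^2 - 2) * Q - y"
      by (simp_all add: P_def Q_def algebra_simps power2_eq_square)
    have "act ?g v = P *\<^sub>R a + Q *\<^sub>R b" unfolding v g P_def Q_def ..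
    moreover have "act ?g (P *\<^sub>R a + Q *\<^sub>R b) = ((4 * k^2 - 2) * P - x) *\<^sub>R a + ((4 * k^2 - 2) * Q - y) *\<^sub>R b"
      unfolding g e ..
    ultimately show "act ?g (act ?g v) = (4 * k^2 - 2) *\<^sub>R act ?g v - v"
      by (simp only: v scaleR_add_right scaleR_diff_left scaleR_scaleR) simp
  qed (use a b in simp)
  have pos: "2 - (4 * k^2 - 2) > 0" using k abs_square_less_1[of k] by (simp add: k_def)
  have step: "(\<exists>g t. Q g t \<and> t \<le> 0) \<or> (\<exists>g t. Q g t \<and> 2 - t \<ge> 2 ^ n * (2 - (4 * k^2 - 2)))" for n
  proof (induction n)
    case 0 then show ?case using Q0 by (auto intro!: exI[of _ ?g] exI[of _ "4 * k^2 - 2"])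
  next
    case (Suc n)
    then consider "\<exists>g t. Q g t \<and> t \<le> 0"
      | g t where "Q g t" "2 - t \<ge> 2 ^ n * (2 - (4 * k^2 - 2))" "t > 0" by force
    then show ?case
    proof cases
      case 2
      have "Q (g \<otimes> g) (t\<^sup>2 - 2)"
        using rotation_square[of g a b t] 2(1) unfolding Q_def by auto
      moreover have "2 - (t\<^sup>2 - 2) \<ge> 2 * (2 - t)"
      proof -
        have "2 ^ n * (2 - (4 * k^2 - 2)) \<ge> 0" using pos by simp
        then have "2 - t \<ge> 0" using 2(2) by linarith
        then have "0 \<le> (2 - t) * t" using 2(3) by simp
        then show ?thesis by (simp add: algebra_simps power2_eq_square)
      qed
      ultimately have "\<exists>g t. Q g t \<and> 2 - t \<ge> 2 ^ Suc n * (2 - (4 * k^2 - 2))"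
        using 2(2) by (intro exI[of _ "g \<otimes> g"] exI[of _ "t\<^sup>2 - 2"]) simp
      then show ?thesis ..
    qed blast
  qed
  obtain n where n: "2 ^ n * (2 - (4 * k^2 - 2)) > (2::real)"
    using real_arch_pow[of 2 "2 / (2 - (4 * k^2 - 2))"] pos by (auto simp: divide_less_eq)
  obtain g t where gt: "Q g t" "t \<le> 0"
    using step[of n] n by force
  have gW: "g \<in> carrier W" using gt by (simp add: Q_def)
  have sub: "{\<rho> \<in> roots \<inter> plane a b. f0 \<rho> > 0} \<subseteq> inversions (inv g) \<union> inversions (inv (g \<otimes> g))"
  proof
    fix \<rho> assume "\<rho> \<in> {\<rho> \<in> roots \<inter> plane a b. f0 \<rho> > 0}"
    then have r: "\<rho> \<in> roots" "\<rho> \<in> plane a b" "f0 \<rho> > 0" by auto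
    have "act g (act g \<rho>) = t *\<^sub>R act g \<rho> - \<rho>" using gt r by (simp add: Q_def)
    then have e: "f0 (act g (act g \<rho>)) = t * f0 (act g \<rho>) - f0 \<rho>" by simp
    have "f0 (act g \<rho>) < 0 \<or> f0 (act g (act g \<rho>)) < 0"
    proof (rule ccontr)
      assume n: "\<not> ?thesis"
      then have "t * f0 (act g \<rho>) \<le> 0" using gt by (simp add: mult_nonpos_nonneg)
      then show False using e r n by linarith
    qed
    then show "\<rho> \<in> inversions (inv g) \<union> inversions (inv (g \<otimes> g))"
    proof
      assume "f0 (act g \<rho>) < 0"
      then have "\<rho> \<in> inversions (inv g)" using r gW by (intro inversionsI) auto
      then show ?thesis ..
    next
      assume "f0 (act g (act g \<rho>)) < 0"
      then have "\<rho> \<in> inversions (inv (g \<otimes> g))" using r gW by (intro inversionsI) (auto simp: act_mult)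
      then show ?thesis ..
    qed
  qed
  have fin: "finite {\<rho> \<in> roots \<inter> plane a b. f0 \<rho> > 0}"
    using finite_subset[OF sub] gW by simp
  have "roots \<inter> plane a b \<subseteq> {\<rho> \<in> roots \<inter> plane a b. f0 \<rho> > 0} \<union> uminus ` {\<rho> \<in> roots \<inter> plane a b. f0 \<rho> > 0}"
  proof
    fix \<rho> assume r: "\<rho> \<in> roots \<inter> plane a b"
    show "\<rho> \<in> {\<rho> \<in> roots \<inter> plane a b. f0 \<rho> > 0} \<union> uminus ` {\<rho> \<in> roots \<inter> plane a b. f0 \<rho> > 0}"
    proof (cases "f0 \<rho> > 0")
      case False
      then have "- \<rho> \<in> {\<rho> \<in> roots \<inter> plane a b. f0 \<rho> > 0}"
        using r f0_root_nonzero[of \<rho>] by (auto simp: roots_uminus plane_minus)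
      then show ?thesis by (intro UnI2 image_eqI[of \<rho> uminus "- \<rho>"]) simp_all
    qed (use r in simp)
  qed
  then show ?thesis using fin finite_subset by blast
qed

text \<open>The two simple roots of the rank two root system in their plane, characterised by the
  common sign of coordinates. The lower bound on the form value makes this system finite.\<close>

definition simple_pair :: "'v \<Rightarrow> 'v \<Rightarrow> bool" where
  "simple_pair a b \<longleftrightarrow> a \<in> pos_roots \<and> b \<in> pos_roots \<and> - 1 < B a b \<and> a \<noteq> b \<and>
     (\<forall>x y. x *\<^sub>R a + y *\<^sub>R b \<in> roots \<longrightarrow> (0 \<le> x \<and> 0 \<le> y) \<or> (x \<le> 0 \<and> y \<le> 0))"

lemma simple_pairD:
  assumes "simple_pair a b"
  shows "a \<in> pos_roots" "b \<in> pos_roots" "a \<in> roots" "b \<in> roots" "f0 a > 0" "f0 b > 0"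
    "B a a = 1" "B b b = 1" "B b a = B a b" "- 1 < B a b" "B a b \<le> 0"
    "x *\<^sub>R a + y *\<^sub>R b \<in> roots \<Longrightarrow> (0 \<le> x \<and> 0 \<le> y) \<or> (x \<le> 0 \<and> y \<le> 0)"
proof -
  show ab: "a \<in> pos_roots" "b \<in> pos_roots" "- 1 < B a b" using assms by (auto simp: simple_pair_def)
  then show r: "a \<in> roots" "b \<in> roots" "f0 a > 0" "f0 b > 0" by (auto simp: pos_rootsD)
  then show "B a a = 1" "B b b = 1" by (auto simp: root_unit)
  show "B b a = B a b" by (rule form_sym)
  show coh: "(0 \<le> x \<and> 0 \<le> y) \<or> (x \<le> 0 \<and> y \<le> 0)" if "x *\<^sub>R a + y *\<^sub>R b \<in> roots" for x y
    using assms that unfolding simple_pair_def by blast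
  have "reflect a b = (- 2 * B a b) *\<^sub>R a + 1 *\<^sub>R b" by (simp add: reflect_def)
  then have "(- 2 * B a b) *\<^sub>R a + 1 *\<^sub>R b \<in> roots" using reflect_root r by metis
  from coh[OF this] show "B a b \<le> 0" by auto
qed

lemma simple_pair_sym: "simple_pair a b \<Longrightarrow> simple_pair b a"
  unfolding simple_pair_def form_sym[of a b] by (metis add.commute)

lemma finite_simple_pair: "simple_pair a b \<Longrightarrow> finite (roots \<inter> plane a b)"
  using finite_plane_roots[of a b] simple_pairD[of a b] by auto

lemma simple_pair_coords:
  assumes "simple_pair a b" "\<rho> \<in> pos_roots" "\<rho> \<in> plane a b"
  obtains x y where "x \<ge> 0" "y \<ge> 0" "\<rho> = x *\<^sub>R a + y *\<^sub>R b"
proof -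
  obtain x y where r: "\<rho> = x *\<^sub>R a + y *\<^sub>R b" using assms by (auto simp: plane_def)
  have "\<not> (x \<le> 0 \<and> y \<le> 0)"
  proof
    assume "x \<le> 0 \<and> y \<le> 0"
    then have "f0 \<rho> \<le> 0" using simple_pairD(5,6)[OF assms(1)]
      by (simp add: r add_nonpos_nonpos mult_nonpos_nonneg)
    then show False using assms by (simp add: pos_roots_iff)
  qed
  moreover have "x *\<^sub>R a + y *\<^sub>R b \<in> roots" using assms r by (simp add: pos_rootsD)
  ultimately show ?thesis using that r simple_pairD(12)[OF assms(1)] by blast
qed

lemma simple_pair_reflect:
  assumes "simple_pair a b" "\<rho> \<in> pos_roots" "\<rho> \<in> plane a b" "\<rho> \<noteq> a"
  shows "reflect a \<rho> \<in> pos_roots"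
proof -
  note ab = simple_pairD[OF assms(1)]
  obtain x y where r: "x \<ge> 0" "y \<ge> 0" "\<rho> = x *\<^sub>R a + y *\<^sub>R b" using simple_pair_coords assms by metis
  have "y \<noteq> 0"
  proof
    assume "y = 0"
    then have "x * x = 1" using root_unit[of \<rho>] assms r ab by (simp add: pos_rootsD)
    then have "x = 1" using r by (simp add: square_eq_1_iff)
    then show False using assms r \<open>y = 0\<close> by simp
  qed
  then have y: "y > 0" using r by simp
  have e: "reflect a \<rho> = (- x - 2 * B a b * y) *\<^sub>R a + y *\<^sub>R b"
    unfolding r(3) by (rule reflect_coords(1)[OF ab(7)])
  have rr: "reflect a \<rho> \<in> roots" using assms ab reflect_root by (simp add: pos_rootsD)
  then have "- x - 2 * B a b * y \<ge> 0" using ab(12)[of "- x - 2 * B a b * y" y] y e by auto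
  then have "f0 (reflect a \<rho>) > 0" unfolding e using y ab
    by (simp add: add_nonneg_pos)
  then show ?thesis using rr by (simp add: pos_roots_iff)
qed

text \<open>All that is used of the dihedral group generated by the reflections in roots of the plane.\<close>
definition plane_elt :: "'v \<Rightarrow> 'v \<Rightarrow> 'a \<Rightarrow> bool" where
  "plane_elt a b d \<longleftrightarrow> d \<in> carrier W \<and> (\<forall>v. B a v = 0 \<longrightarrow> B b v = 0 \<longrightarrow> act d v = v) \<and>
     (\<forall>v \<in> plane a b. act d v \<in> plane a b)"

lemma plane_elt_mult:
  assumes "plane_elt a b d" "plane_elt a b e"
  shows "plane_elt a b (d \<otimes> e)"
  using assms unfolding plane_elt_def by (auto simp: act_mult)

lemma plane_elt_one: "plane_elt a b \<one>"
  unfolding plane_elt_def by (auto simp: act_one)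

lemma plane_elt_reflection:
  assumes "r \<in> roots" "r \<in> plane a b"
  shows "plane_elt a b (reflection r)"
proof -
  obtain x y where "r = x *\<^sub>R a + y *\<^sub>R b" using assms by (auto simp: plane_def)
  then show ?thesis using assms plane_reflect[of _ a b r]
    by (simp add: plane_elt_def act_reflection) (simp add: reflect_def)
qed

text \<open>The two roots form an obtuse pair, so their inverse Gram matrix has nonnegative
  entries.\<close>

lemma dominant_coords:
  assumes "simple_pair a b" "p \<in> plane a b" "B a p \<ge> 0" "B b p \<ge> 0"
  obtains x y where "x \<ge> 0" "y \<ge> 0" "p = x *\<^sub>R a + y *\<^sub>R b"
proof -
  note ab = simple_pairD[OF assms(1)]
  obtain x y where p: "p = x *\<^sub>R a + y *\<^sub>R b" using assms by (auto simp: plane_def)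
  define k where "k = - B a b"
  have k: "0 \<le> k" "k < 1" using ab by (auto simp: k_def)
  have "0 \<le> x + B a b * y" "0 \<le> B a b * x + y" using assms(3,4) ab(7-9) by (auto simp: p mult.commute)
  then have 1: "x \<ge> k * y" "y \<ge> k * x" by (auto simp: k_def)
  have "x \<ge> k * (k * x)" using 1 mult_left_mono[OF 1(2) k(1)] by linarith
  moreover have "k * k < 1" using k by (metis mult_1_right mult_left_le mult_strict_mono order_le_less_trans less_eq_real_def)
  ultimately have "(1 - k * k) * x \<ge> 0" by (simp add: algebra_simps)
  then have "x \<ge> 0" using \<open>k * k < 1\<close> by (simp add: zero_le_mult_iff)
  moreover have "y \<ge> 0" using 1 k calculation by (meson mult_nonneg_nonneg order_trans)
  ultimately show ?thesis using that p by blast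
qed

text \<open>Count the positive roots of the plane that pair negatively with \<open>p\<close>.
  Reflecting in such a simple root permutes the other positive roots of the plane, so the count
  drops.\<close>

lemma exists_dominant:
  assumes ab: "simple_pair a b" and "p \<in> plane a b"
  shows "\<exists>d. plane_elt a b d \<and> B a (act d p) \<ge> 0 \<and> B b (act d p) \<ge> 0"
proof -
  define N where "N p = {\<rho> \<in> roots \<inter> plane a b. f0 \<rho> > 0 \<and> B \<rho> p < 0}" for p
  have fin: "finite (N p)" for p unfolding N_def by (rule finite_subset[OF _ finite_simple_pair[OF ab]]) auto
  have card_less: "card (N (reflect r p)) < card (N p)"
    if sp: "simple_pair r r'" and eq: "plane r r' = plane a b" and neg: "B r p < 0" for r r' p
  proof -
    note rd = simple_pairD[OF sp]
    have rN: "r \<in> N p" using rd neg eq plane_self(1)[of r r'] by (simp add: N_def)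
    have "N (reflect r p) \<subseteq> reflect r ` (N p - {r})"
    proof
      fix \<rho> assume "\<rho> \<in> N (reflect r p)"
      then have \<rho>: "\<rho> \<in> roots" "\<rho> \<in> plane r r'" "f0 \<rho> > 0" "B \<rho> (reflect r p) < 0" by (auto simp: N_def eq)
      have e: "B \<rho> (reflect r p) = B (reflect r \<rho>) p"
        using B_reflect_reflect[OF rd(3), of "reflect r \<rho>" p] reflect_reflect[OF rd(3)] by simp
      have "\<rho> \<noteq> r" using e neg \<rho>(4) reflect_self[OF rd(3)] by auto
      then have "reflect r \<rho> \<in> pos_roots" using simple_pair_reflect[OF sp] \<rho> by (simp add: pos_roots_iff)
      moreover have "reflect r \<rho> \<in> plane r r'" using \<rho> plane_reflect by simp
      moreover have "reflect r \<rho> \<noteq> r" using \<rho>(3) rd(5) reflect_reflect[OF rd(3), of \<rho>] reflect_self[OF rd(3)] by force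
      ultimately have "reflect r \<rho> \<in> N p - {r}" using e \<rho> by (simp add: N_def eq pos_roots_iff)
      then show "\<rho> \<in> reflect r ` (N p - {r})" using reflect_reflect[OF rd(3), of \<rho>] by (metis imageI)
    qed
    then have "card (N (reflect r p)) \<le> card (N p - {r})"
      using fin surj_card_le[of "N p - {r}"] by simp
    also have "\<dots> < card (N p)" using rN fin by (intro psubset_card_mono) auto
    finally show ?thesis .
  qed
  show ?thesis using assms(2)
  proof (induction "card (N p)" arbitrary: p rule: less_induct)
    case less
    have red: ?case if sp: "simple_pair r r'" and eq: "plane r r' = plane a b" and neg: "B r p < 0" for r r'
    proof -
      note rd = simple_pairD[OF sp]
      have rp: "r \<in> plane a b" using eq plane_self(1)[of r r'] by simp
      obtain d where d: "plane_elt a b d" "B a (act d (reflect r p)) \<ge> 0" "B b (act d (reflect r p)) \<ge> 0"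
        using less.hyps[OF card_less[OF sp eq neg]]
          plane_reflect[OF less.prems rp] by blast
      have "plane_elt a b (d \<otimes> reflection r)" using d rd rp plane_elt_mult plane_elt_reflection by blast
      moreover have "act (d \<otimes> reflection r) p = act d (reflect r p)"
        using d rd by (simp add: act_mult act_reflection plane_elt_def)
      ultimately show ?thesis using d by metis
    qed
    show ?case
    proof (cases "B a p < 0")
      case True then show ?thesis using red[OF ab] by simp
    next
      case False
      show ?thesis
      proof (cases "B b p < 0")
        case True then show ?thesis using red[OF simple_pair_sym[OF ab] plane_commute] by simp
      next
        case F: False
        then show ?thesis using False by (intro exI[of _ \<one>]) (simp add: plane_elt_one act_one)
      qed
    qed
  qed
qed

text \<open>Take an element that makes \<open>- a - b\<close> dominant. Both \<open>a\<close> and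
  \<open>b\<close> pair negatively with that vector, whereas a positive root of the plane pairs
  nonnegatively with a dominant one.\<close>

lemma exists_longest:
  assumes "simple_pair a b"
  shows "\<exists>d. plane_elt a b d \<and> f0 (act d a) < 0 \<and> f0 (act d b) < 0"
proof -
  note ab = simple_pairD[OF assms]
  let ?p = "(- 1) *\<^sub>R a + (- 1) *\<^sub>R b"
  obtain d where d: "plane_elt a b d" "B a (act d ?p) \<ge> 0" "B b (act d ?p) \<ge> 0"
    using exists_dominant[OF assms planeI] by blast
  have dW: "d \<in> carrier W" using d by (simp add: plane_elt_def)
  have neg: "f0 (act d r) < 0" if r: "r \<in> roots" "r \<in> plane a b" "B r ?p < 0" for r
  proof (rule ccontr)
    assume "\<not> f0 (act d r) < 0"
    moreover have rr: "act d r \<in> roots" using r dW roots_act by simp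
    ultimately have "act d r \<in> pos_roots" using f0_root_nonzero[OF rr] by (simp add: pos_roots_iff)
    moreover have "act d r \<in> plane a b" using d r by (simp add: plane_elt_def)
    ultimately obtain x y where xy: "x \<ge> 0" "y \<ge> 0" "act d r = x *\<^sub>R a + y *\<^sub>R b"
      using simple_pair_coords[OF assms] by metis
    have "B r ?p = B (act d r) (act d ?p)" using dW form_invariant by simp
    also have "\<dots> = x * B a (act d ?p) + y * B b (act d ?p)" unfolding xy(3) by simp
    also have "\<dots> \<ge> 0" using xy d by simp
    finally show False using r by simp
  qed
  have "f0 (act d a) < 0" "f0 (act d b) < 0" using ab by (auto intro!: neg)
  then show ?thesis using d by blast
qed

text \<open>
  The possible values are \<open>c = 2 cos (\<pi> / k)\<close> for \<open>k = 3, 4, 5, 6\<close> and \<open>k \<ge> 7\<close>, and \<open>81/25 < 4 cos\<^sup>2 (\<pi> / 7)\<close>.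
  They are read off the signs of the coefficients of the roots \<open>s\<^sub>b a\<close>, \<open>s\<^sub>a s\<^sub>b a\<close>, \<open>s\<^sub>b s\<^sub>a s\<^sub>b a\<close>, and so on.
\<close>
lemma simple_pair_values:
  assumes "simple_pair a b" and c: "c = - 2 * B a b" and "c > 0"
  shows "c < 2" "c = 1 \<or> c\<^sup>2 = 2 \<or> c\<^sup>2 = c + 1 \<or> c\<^sup>2 = 3 \<or> c\<^sup>2 \<ge> 81 / 25"
proof -
  note ab = simple_pairD[OF assms(1)]
  show "c < 2" using ab c by simp
  have ra: "(c * y - x) *\<^sub>R a + y *\<^sub>R b \<in> roots" if "x *\<^sub>R a + y *\<^sub>R b \<in> roots" for x y
  proof -
    have "reflect a (x *\<^sub>R a + y *\<^sub>R b) = (c * y - x) *\<^sub>R a + y *\<^sub>R b"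
      unfolding reflect_coords(1)[OF ab(7)] by (simp add: c)
    then show ?thesis using reflect_root[OF ab(3) that] by simp
  qed
  have rb: "x *\<^sub>R a + (c * x - y) *\<^sub>R b \<in> roots" if "x *\<^sub>R a + y *\<^sub>R b \<in> roots" for x y
  proof -
    have "reflect b (x *\<^sub>R a + y *\<^sub>R b) = x *\<^sub>R a + (c * x - y) *\<^sub>R b"
      unfolding reflect_coords(2)[OF ab(8)] ab(9) by (simp add: c)
    then show ?thesis using reflect_root[OF ab(4) that] by simp
  qed
  have "1 *\<^sub>R a + 0 *\<^sub>R b \<in> roots" using ab by simp
  note r1 = rb[OF this]
  note r2 = ra[OF r1]
  note r3 = rb[OF r2]
  note r4 = ra[OF r3]
  note r5 = rb[OF r4]
  note r6 = ra[OF r5]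
  have c1: "c\<^sup>2 - 1 \<ge> 0" using ab(12)[OF r2] assms(3) by (auto simp: power2_eq_square)
  show "c = 1 \<or> c\<^sup>2 = 2 \<or> c\<^sup>2 = c + 1 \<or> c\<^sup>2 = 3 \<or> c\<^sup>2 \<ge> 81 / 25"
  proof (cases "c\<^sup>2 = 1")
    case True then show ?thesis using assms(3) by (simp add: power2_eq_1_iff)
  next
    case False
    then have g1: "c\<^sup>2 > 1" using c1 by simp
    have e3: "c * (c * (c * 1 - 0) - 1) - (c * 1 - 0) = c * (c\<^sup>2 - 2)" by (simp add: algebra_simps power2_eq_square)
    have "c * (c\<^sup>2 - 2) \<ge> 0" using ab(12)[OF r3] g1 unfolding e3 by (auto simp: power2_eq_square)
    then have g2: "c\<^sup>2 \<ge> 2" using assms(3) by (simp add: zero_le_mult_iff)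
    show ?thesis
    proof (cases "c\<^sup>2 = 2")
      case F2: False
      then have g2': "c * (c\<^sup>2 - 2) > 0" using g2 assms(3) by simp
      have e4: "c * (c * (c\<^sup>2 - 2)) - (c * (c * 1 - 0) - 1) = (c\<^sup>2 - c - 1) * (c\<^sup>2 + c - 1)"
        by (simp add: algebra_simps power2_eq_square)
      have "(c\<^sup>2 - c - 1) * (c\<^sup>2 + c - 1) \<ge> 0" using ab(12)[OF r4] g2' unfolding e3 e4 by auto
      moreover have p: "c\<^sup>2 + c - 1 > 0" using g1 assms(3) by simp
      ultimately have g3: "c\<^sup>2 \<ge> c + 1" by (simp add: zero_le_mult_iff)
      show ?thesis
      proof (cases "c\<^sup>2 = c + 1")
        case F3: False
        then have g3': "(c\<^sup>2 - c - 1) * (c\<^sup>2 + c - 1) > 0" using g3 p by simp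
        have e5: "c * ((c\<^sup>2 - c - 1) * (c\<^sup>2 + c - 1)) - c * (c\<^sup>2 - 2) = c * ((c\<^sup>2 - 1) * (c\<^sup>2 - 3))"
          by (simp add: algebra_simps power2_eq_square)
        have "c * ((c\<^sup>2 - 1) * (c\<^sup>2 - 3)) \<ge> 0" using ab(12)[OF r5] g3' unfolding e3 e4 e5 by auto
        then have g4: "c\<^sup>2 \<ge> 3" using assms(3) g1 by (simp add: zero_le_mult_iff)
        show ?thesis
        proof (cases "c\<^sup>2 = 3")
          case F4: False
          then have g4': "c * ((c\<^sup>2 - 1) * (c\<^sup>2 - 3)) > 0" using g4 assms(3) g1 by simp
          have e6: "c * (c * ((c\<^sup>2 - 1) * (c\<^sup>2 - 3))) - (c\<^sup>2 - c - 1) * (c\<^sup>2 + c - 1) = c\<^sup>2 * ((c\<^sup>2 - 2) * (c\<^sup>2 - 3)) - 1"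
            by (simp add: algebra_simps power2_eq_square)
          have 1: "c\<^sup>2 * ((c\<^sup>2 - 2) * (c\<^sup>2 - 3)) \<ge> 1" using ab(12)[OF r6] g4' unfolding e3 e4 e5 e6 by auto
          have "c\<^sup>2 \<ge> 81 / 25"
          proof (rule ccontr)
            assume n: "\<not> c\<^sup>2 \<ge> 81 / 25"
            have "(c\<^sup>2 - 2) * (c\<^sup>2 - 3) \<le> (31/25) * (6/25)" using n g4 by (intro mult_mono) auto
            then have "c\<^sup>2 * ((c\<^sup>2 - 2) * (c\<^sup>2 - 3)) \<le> (81/25) * ((31/25) * (6/25))"
              using n g4 by (intro mult_mono) auto
            then show False using 1 by simp
          qed
          then show ?thesis by simp
        qed simp
      qed simp
    qed simp
  qed
qed

subsection \<open>Dominance depth in a finite dihedral root system\<close>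

text \<open>
  Up to the dihedral group \<open>v\<close> is dominant.  If \<open>\<zeta>\<close> is small, then \<open>\<zeta> e + v\<close> is positive and the
  longest element makes it negative, so that only finitely many \<open>\<zeta>\<close> occur.
\<close>
lemma perp_coefficient_bound:
  assumes sp: "simple_pair a b" and e: "B a e = 0" "B b e = 0" "f0 e < 0" "B e e \<le> 0"
  shows "\<exists>\<iota>>0. \<forall>\<zeta> v. v \<in> plane a b \<longrightarrow> \<zeta> *\<^sub>R e + v \<in> roots \<longrightarrow> \<zeta> > 0 \<longrightarrow> \<zeta> \<ge> \<iota>"
proof -
  note ab = simple_pairD[OF sp]
  obtain w0 where w0: "plane_elt a b w0" "f0 (act w0 a) < 0" "f0 (act w0 b) < 0"
    using exists_longest[OF sp] by blast
  have w0W: "w0 \<in> carrier W" using w0 by (simp add: plane_elt_def)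
  have ev: "B v e = 0" if "v \<in> plane a b" for v using that e by (auto simp: plane_def)
  define k where "k = - B a b"
  have k: "0 \<le> k" "k < 1" using ab by (auto simp: k_def)
  have k2: "1 - k\<^sup>2 > 0" using k by (simp add: abs_square_less_1)
  \<comment> \<open>The orthogonal projection to the plane, by the inverse Gram matrix.\<close>
  define proj where "proj v = ((B a v + k * B b v) / (1 - k\<^sup>2)) *\<^sub>R a + ((B b v + k * B a v) / (1 - k\<^sup>2)) *\<^sub>R b" for v
  have proj_plane: "proj v = v" if pv: "v \<in> plane a b" for v
  proof -
    obtain x y where v: "v = x *\<^sub>R a + y *\<^sub>R b" using pv by (auto simp: plane_def)
    have B: "B a v = x - k * y" "B b v = y - k * x" using ab by (auto simp: v k_def)
    have "B a v + k * B b v = x * (1 - k\<^sup>2)" "B b v + k * B a v = y * (1 - k\<^sup>2)"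
      unfolding B by (simp_all add: algebra_simps power2_eq_square)
    then show ?thesis using k2 by (simp add: proj_def v)
  qed
  have proj_add: "proj (\<zeta> *\<^sub>R e + v) = proj v" for \<zeta> v using e by (simp add: proj_def)
  \<comment> \<open>\<open>h\<close> recovers the coefficient \<open>\<zeta>\<close> from
    \<open>\<zeta> *\<^sub>R e + v\<close>, so finitely many roots give finitely many
    coefficients.\<close>
  define h where "h v = f0 (v - proj v) / f0 e" for v
  have h: "h (\<zeta> *\<^sub>R e + v) = \<zeta>" if "v \<in> plane a b" for \<zeta> v
    using e(3) proj_plane[OF that] by (simp add: h_def proj_add)
  define \<mu> where "\<mu> = min (f0 a) (f0 b)"
  have mu: "\<mu> > 0" using ab by (simp add: \<mu>_def)
  \<comment> \<open>Below the first entry, \<open>\<zeta> *\<^sub>R e\<close> cannot outweigh a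
    dominant \<open>v\<close>, and the root becomes an inversion of \<open>inv w0\<close>. The other
    entries are the positive coefficients of these inversions.\<close>
  define E where "E = insert (\<mu> / (- f0 e)) (h ` {\<eta> \<in> inversions (inv w0). h \<eta> > 0})"
  have fin: "finite E" using w0W by (simp add: E_def)
  define \<iota> where "\<iota> = Min E"
  have "\<iota> \<in> E" unfolding \<iota>_def using fin by (intro Min_in) (auto simp: E_def)
  moreover have "\<mu> / (- f0 e) > 0" using mu e(3) by (intro divide_pos_pos) auto
  ultimately have "\<iota> > 0" unfolding E_def by auto
  moreover have "\<zeta> \<ge> \<iota>" if v: "v \<in> plane a b" "\<zeta> *\<^sub>R e + v \<in> roots" "\<zeta> > 0" for \<zeta> v
  proof (cases "\<zeta> \<ge> \<mu> / (- f0 e)")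
    case True
    moreover have "\<iota> \<le> \<mu> / (- f0 e)" unfolding \<iota>_def using fin by (intro Min_le) (auto simp: E_def)
    ultimately show ?thesis by simp
  next
    case False
    then have sm: "\<zeta> * (- f0 e) < \<mu>"
      using pos_less_divide_eq[of "- f0 e" \<zeta> \<mu>] e(3) by (simp only: not_le neg_0_less_iff_less)
    obtain d where d: "plane_elt a b d" "B a (act d v) \<ge> 0" "B b (act d v) \<ge> 0"
      using exists_dominant[OF sp v(1)] by blast
    have dW: "d \<in> carrier W" and de: "act d e = e" and w0e: "act w0 e = e"
      using d w0 e by (auto simp: plane_elt_def)
    have dv: "act d v \<in> plane a b" using d v by (simp add: plane_elt_def)
    obtain x y where xy: "x \<ge> 0" "y \<ge> 0" "act d v = x *\<^sub>R a + y *\<^sub>R b"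
      using dominant_coords[OF sp dv d(2,3)] .
    let ?\<eta> = "\<zeta> *\<^sub>R e + act d v"
    have \<eta>: "?\<eta> = act d (\<zeta> *\<^sub>R e + v)" using dW by (simp add: act_linear_simps de)
    have \<eta>r: "?\<eta> \<in> roots" unfolding \<eta> using v dW by (simp add: roots_act)
    \<comment> \<open>As \<open>e\<close> has nonpositive norm, the dominant part has norm at least
      1. Hence \<open>x + y\<close> is at least 1 and its \<open>f0\<close> value at least
      \<open>\<mu>\<close>.\<close>
    have "1 = B ?\<eta> ?\<eta>" using root_unit[OF \<eta>r] by (simp only:)
    also have "\<dots> = \<zeta>\<^sup>2 * B e e + B (act d v) (act d v)"
      using ev[OF dv] form_sym[of e "act d v"] by (simp add: power2_eq_square)
    also have "\<dots> \<le> B (act d v) (act d v)" using e(4) by (simp add: mult_nonneg_nonpos)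
    also have "\<dots> = x\<^sup>2 + y\<^sup>2 - 2 * k * (x * y)"
      unfolding xy(3) using ab by (simp add: k_def power2_eq_square algebra_simps)
    also have "\<dots> \<le> x\<^sup>2 + y\<^sup>2 + 2 * (x * y)" using k xy mult_nonneg_nonneg[OF k(1) mult_nonneg_nonneg[OF xy(1,2)]]
      mult_nonneg_nonneg[OF xy(1,2)] by linarith
    also have "\<dots> = (x + y)\<^sup>2" by (simp add: power2_sum)
    finally have "x + y \<ge> 1" using xy by (intro power2_le_imp_le[of 1]) auto
    moreover have "f0 (act d v) \<ge> x * \<mu> + y * \<mu>" unfolding xy(3) using xy
      by (simp add: \<mu>_def add_mono mult_left_mono)
    moreover have "(x + y) * \<mu> \<ge> 1 * \<mu>" using calculation(1) mu by (intro mult_right_mono) auto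
    ultimately have "f0 (act d v) \<ge> \<mu>" by (simp add: algebra_simps)
    then have pos: "f0 ?\<eta> > 0" using sm by simp
    have "f0 (act w0 (act d v)) \<le> 0"
      unfolding xy(3) using w0 w0W xy by (simp add: act_linear_simps add_nonpos_nonpos mult_nonneg_nonpos)
    moreover have "\<zeta> * f0 e < 0" using v(3) e(3) by (simp add: mult_pos_neg)
    ultimately have "f0 (act w0 ?\<eta>) < 0" using w0W by (simp add: act_linear_simps w0e)
    then have "?\<eta> \<in> inversions (inv w0)" using \<eta>r pos w0W by (intro inversionsI) auto
    moreover have "h ?\<eta> = \<zeta>" by (rule h[OF dv])
    ultimately have "\<zeta> \<in> E" using v(3) unfolding E_def by force
    then show ?thesis unfolding \<iota>_def using fin by (intro Min_le)
  qed
  ultimately show ?thesis by blast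
qed

text \<open>
  A root \<open>\<sigma> = \<zeta> e + v\<close> with \<open>v\<close> dominant and \<open>\<zeta>\<close> within one percent of the infimum \<open>\<iota>\<close>: the coefficient
  of \<open>\<sigma>\<close> in a root spanned by \<open>\<sigma>\<close> and the plane is zero or at least \<open>100/101\<close>.  The infimum itself
  need not be attained.
\<close>
lemma near_minimal_root:
  assumes sp: "simple_pair a b" and e: "B a e = 0" "B b e = 0" "f0 e < 0" "B e e \<le> 0"
    and p: "p \<in> plane a b" "e + p \<in> roots"
  shows "\<exists>\<iota> \<zeta> \<kappa> \<kappa>'. 0 < \<iota> \<and> \<iota> \<le> 1 \<and> \<iota> \<le> \<zeta> \<and> \<zeta> < 101 / 100 * \<iota> \<and>
    (\<forall>\<xi> v. v \<in> plane a b \<longrightarrow> \<xi> *\<^sub>R e + v \<in> roots \<longrightarrow> \<xi> = 0 \<or> \<bar>\<xi>\<bar> \<ge> \<iota>) \<and>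
    gap_values \<kappa> \<and> gap_values \<kappa>' \<and>
    \<kappa>\<^sup>2 + \<kappa>'\<^sup>2 + (- 2 * B a b) * \<kappa> * \<kappa>' = (1 - (- 2 * B a b)\<^sup>2 / 4) * (1 + (- B e e) * \<zeta>\<^sup>2)"
proof -
  note ab = simple_pairD[OF sp]
  define Z where "Z = {\<zeta>. \<zeta> > 0 \<and> (\<exists>v \<in> plane a b. \<zeta> *\<^sub>R e + v \<in> roots)}"
  obtain \<iota>0 where i0: "\<iota>0 > 0" "\<And>\<zeta>. \<zeta> \<in> Z \<Longrightarrow> \<zeta> \<ge> \<iota>0"
    using perp_coefficient_bound[OF sp e] unfolding Z_def by blast
  have 1: "1 \<in> Z" using p by (auto simp: Z_def)
  have bdd: "bdd_below Z" using i0 by (meson bdd_belowI)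
  define \<iota> where "\<iota> = Inf Z"
  have i: "\<iota> \<ge> \<iota>0" unfolding \<iota>_def using 1 i0 by (intro cInf_greatest) auto
  have ile: "\<iota> \<le> \<zeta>" if "\<zeta> \<in> Z" for \<zeta> unfolding \<iota>_def using that bdd by (rule cInf_lower)
  have ipos: "\<iota> > 0" using i i0 by simp
  then have "Inf Z < 101 / 100 * \<iota>" by (simp add: \<iota>_def)
  then obtain \<zeta> where z: "\<zeta> \<in> Z" "\<zeta> < 101 / 100 * \<iota>" using cInf_lessD[of Z] 1 by blast
  then obtain v0 where v0: "v0 \<in> plane a b" "\<zeta> *\<^sub>R e + v0 \<in> roots" and zpos: "\<zeta> > 0" by (auto simp: Z_def)
  obtain d where d: "plane_elt a b d" "B a (act d v0) \<ge> 0" "B b (act d v0) \<ge> 0"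
    using exists_dominant[OF sp v0(1)] by blast
  define v where "v = act d v0"
  define \<sigma> where "\<sigma> = \<zeta> *\<^sub>R e + v"
  have vp: "v \<in> plane a b" using d v0 by (simp add: plane_elt_def v_def)
  have "\<sigma> = act d (\<zeta> *\<^sub>R e + v0)" using d e by (simp add: plane_elt_def act_linear_simps \<sigma>_def v_def)
  then have \<sigma>: "\<sigma> \<in> roots" using v0 d by (simp add: plane_elt_def roots_act)
  have gap: "\<xi> = 0 \<or> \<bar>\<xi>\<bar> \<ge> \<iota>" if u: "u \<in> plane a b" "\<xi> *\<^sub>R e + u \<in> roots" for \<xi> u
  proof -
    consider "\<xi> = 0" | "\<xi> > 0" | "\<xi> < 0" by linarith
    then show ?thesis
    proof cases
      case 2 then have "\<xi> \<in> Z" using u by (auto simp: Z_def)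
      then show ?thesis using ile by fastforce
    next
      case 3
      have "- (\<xi> *\<^sub>R e + u) = (- \<xi>) *\<^sub>R e + (- u)" by simp
      then have "(- \<xi>) *\<^sub>R e + (- u) \<in> roots" using roots_uminus[OF u(2)] by metis
      moreover have "- \<xi> > 0" using 3 by simp
      ultimately have "- \<xi> \<in> Z" using plane_minus[OF u(1)] unfolding Z_def by blast
      then show ?thesis using ile by fastforce
    qed simp
  qed
  have scaled: "x = 0 \<or> \<bar>x\<bar> \<ge> 100/101" if "u \<in> plane a b" "(x * \<zeta>) *\<^sub>R e + u \<in> roots" for x u
  proof -
    have "x * \<zeta> = 0 \<or> \<bar>x * \<zeta>\<bar> \<ge> \<iota>" using gap that by blast
    moreover have "\<bar>x\<bar> \<ge> 100/101" if "\<bar>x * \<zeta>\<bar> \<ge> \<iota>"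
    proof -
      have "\<iota> \<le> \<bar>x\<bar> * \<zeta>" using that zpos by (simp add: abs_mult)
      also have "\<dots> \<le> \<bar>x\<bar> * (101/100 * \<iota>)" using z by (intro mult_left_mono) auto
      finally have "1 * \<iota> \<le> (\<bar>x\<bar> * (101/100)) * \<iota>" by simp
      then have "1 \<le> \<bar>x\<bar> * (101/100)" using ipos by (rule mult_right_le_imp_le)
      then show ?thesis by simp
    qed
    ultimately show ?thesis using zpos by auto
  qed
  have vals: "gap_values x" if r: "r \<in> roots" "r \<in> plane a b" "B r e = 0" and x: "x = B r v" "x \<ge> 0" for r x
  proof -
    have sr: "B \<sigma> r = x" "B r \<sigma> = x" using r x form_sym[of v r] form_sym[of e r] by (auto simp: \<sigma>_def)
    have rr: "B r r = 1" "B \<sigma> \<sigma> = 1" using r \<sigma> root_unit by auto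
    define U where "U y z = y *\<^sub>R \<sigma> + z *\<^sub>R r" for y z
    have U: "U y z = (y * \<zeta>) *\<^sub>R e + (y *\<^sub>R v + z *\<^sub>R r)" for y z
      by (simp add: U_def \<sigma>_def scaleR_add_right)
    have Up: "y *\<^sub>R v + z *\<^sub>R r \<in> plane a b" for y z using vp r by (intro plane_add plane_scale)
    have g: "y = 0 \<or> \<bar>y\<bar> \<ge> 100/101" if "U y z \<in> roots" for y z
      using scaled[OF Up] that unfolding U by blast
    have R: "U (- y - 2 * x * z) z \<in> roots" if "U y z \<in> roots" for y z
      using reflect_root[OF \<sigma> that] reflect_coords(1)[OF rr(2), of y z r] sr by (simp add: U_def)
    have R': "U y (- z - 2 * x * y) \<in> roots" if "U y z \<in> roots" for y z
      using reflect_root[OF r(1) that] reflect_coords(2)[OF rr(1), of y \<sigma> z] sr by (simp add: U_def)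
    have "U 0 1 \<in> roots" using r by (simp add: U_def)
    from R[OF this] have u1: "U (- 2 * x) 1 \<in> roots" by simp
    from R'[OF this] have u2: "U (- 2 * x) (4 * x\<^sup>2 - 1) \<in> roots" by (simp add: power2_eq_square algebra_simps)
    from R[OF this] have u3: "U (4 * x - 8 * x ^ 3) (4 * x\<^sup>2 - 1) \<in> roots"
      by (simp add: power2_eq_square power3_eq_cube algebra_simps)
    have "U 1 0 \<in> roots" using \<sigma> by (simp add: U_def)
    from R[OF R'[OF this]] have u4: "U (4 * x\<^sup>2 - 1) (- 2 * x) \<in> roots" by (simp add: power2_eq_square algebra_simps)
    have "x = 0 \<or> x \<ge> 50 / 101" using g[OF u1] x(2) by auto
    moreover have "8 * x ^ 3 - 4 * x = 0 \<or> \<bar>8 * x ^ 3 - 4 * x\<bar> \<ge> 100 / 101"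
      using g[OF u3] by (smt (verit))
    ultimately show ?thesis using g[OF u4] unfolding gap_values_def by blast
  qed
  define \<kappa> \<kappa>' where "\<kappa> = B a v" and "\<kappa>' = B b v"
  have k: "\<kappa> \<ge> 0" "\<kappa>' \<ge> 0" using d by (auto simp: \<kappa>_def \<kappa>'_def v_def)
  have all: "gap_values \<kappa>" "gap_values \<kappa>'"
    using vals[of a \<kappa>] vals[of b \<kappa>'] ab e k by (auto simp: \<kappa>_def \<kappa>'_def)
  \<comment> \<open>By the Gram matrix the left-hand side is \<open>(1 - k^2) B v v\<close> with
    \<open>k = B a b\<close>, and the unit norm of \<open>\<sigma>\<close> determines
    \<open>B v v\<close>.\<close>
  have eq: "\<kappa>\<^sup>2 + \<kappa>'\<^sup>2 + (- 2 * B a b) * \<kappa> * \<kappa>' = (1 - (- 2 * B a b)\<^sup>2 / 4) * (1 + (- B e e) * \<zeta>\<^sup>2)"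
  proof -
    obtain x y where xy: "v = x *\<^sub>R a + y *\<^sub>R b" using vp by (auto simp: plane_def)
    define k where "k = B a b"
    have "1 = B \<sigma> \<sigma>" using \<sigma> root_unit by simp
    also have "\<dots> = \<zeta>\<^sup>2 * B e e + B v v"
      using e form_sym[of e a] form_sym[of e b] by (simp add: \<sigma>_def xy power2_eq_square)
    finally have vv: "B v v = 1 + (- B e e) * \<zeta>\<^sup>2" by (simp add: algebra_simps)
    have "\<kappa> = x + y * k" "\<kappa>' = x * k + y" "B v v = x * x + y * y + 2 * k * x * y"
      using ab by (auto simp: \<kappa>_def \<kappa>'_def xy k_def algebra_simps)
    then have "\<kappa>\<^sup>2 + \<kappa>'\<^sup>2 + (- 2 * k) * \<kappa> * \<kappa>' = (1 - k\<^sup>2) * B v v"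
      by (simp add: algebra_simps power2_eq_square)
    moreover have "(1 - (- 2 * B a b)\<^sup>2 / 4) = 1 - k\<^sup>2" by (simp add: k_def power2_eq_square)
    ultimately show ?thesis unfolding vv[symmetric] k_def by simp
  qed
  show ?thesis
    using ipos ile[OF 1] ile[OF z(1)] z(2) gap all eq by blast
qed

text \<open>The longest element makes \<open>a\<close> negative, hence also \<open>\<delta>\<close>,
  and it makes \<open>b\<close> negative. Two positive roots with form value at most -1 cannot both
  become negative.\<close>

lemma dominated_not_below_one:
  assumes sp: "simple_pair a b" and d: "\<delta> \<in> dom_set a"
  shows "B \<delta> b > - 1"
proof (rule ccontr)
  note ab = simple_pairD[OF sp]
  assume "\<not> B \<delta> b > - 1"
  then have k: "- B \<delta> b \<ge> 1" by simp
  obtain w where w: "plane_elt a b w" "f0 (act w a) < 0" "f0 (act w b) < 0" using exists_longest[OF sp] by blast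
  have wW: "w \<in> carrier W" using w by (simp add: plane_elt_def)
  have dd: "\<delta> \<in> roots" "f0 \<delta> > 0" "edom \<delta> a" using d by (auto simp: dom_set_def pos_rootsD)
  have n: "f0 (act w \<delta>) < 0" using dd w wW unfolding edom_def by blast
  have "- B \<delta> b * f0 (act w \<delta>) < 0" using k n by (intro mult_pos_neg) auto
  then show False using no_common_negative[OF dd(1) ab(4) dd(2) ab(6) k _ wW n] w by simp
qed

text \<open>
  The root \<open>\<delta>\<close> is dominated by \<open>a\<close>, but incomparable to the image of \<open>b\<close> under the reflection in \<open>a\<close>.
  The component \<open>e\<close> of \<open>\<delta>\<close> orthogonal to the plane is negative for every element of the dihedral
  group, and by the estimates for a nearly minimal root no other form values remain.
\<close>
lemma dom_set_shadow:
  assumes sp: "simple_pair a b" and c: "c = - 2 * B a b" "c > 0"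
    and d: "\<delta> \<in> dom_set a" "B \<delta> (reflect a b) < 1"
  shows "c\<^sup>2 < 81 / 25" "c\<^sup>2 = 3 \<Longrightarrow> B \<delta> a = 1 \<and> B \<delta> b = - c / 2" "c\<^sup>2 = 2 \<Longrightarrow> B \<delta> a = - c * B \<delta> b"
proof -
  note ab = simple_pairD[OF sp]
  have c2: "c < 2" using ab c by simp
  have dd: "\<delta> \<in> roots" "f0 \<delta> > 0" "edom \<delta> a" "\<delta> \<noteq> a" using d by (auto simp: dom_set_def pos_rootsD)
  define X t where "X = B \<delta> a" and "t = c * B \<delta> a / 2 + B \<delta> b"
  have X: "X \<ge> 1" using edom_form_ge_1[OF dd(3,1) ab(3)] by (simp add: X_def)
  have Db: "B \<delta> b = t - c * X / 2" by (simp add: t_def X_def)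
  \<comment> \<open>The values of \<open>\<delta>\<close> at \<open>b\<close> and at
    \<open>reflect a b\<close> are \<open>t - c X / 2\<close> and \<open>t + c X / 2\<close>. The
    first exceeds -1 and the second is below 1, which bounds \<open>t\<close> on both sides.\<close>
  have "B \<delta> (reflect a b) = t + c * X / 2"
    using c by (simp add: reflect_def t_def X_def algebra_simps)
  then have t: "\<bar>t\<bar> < 1 - c * X / 2" using d(2) dominated_not_below_one[OF sp d(1)] Db by linarith
  define b2 where "b2 = 1 - c\<^sup>2 / 4"
  have c4: "c\<^sup>2 < 4" using c c2 power_strict_mono[of c 2 2] by simp
  then have b2: "b2 > 0" by (simp add: b2_def)
  define n where "n = b + (c / 2) *\<^sub>R a"
  have nb: "B a n = 0" "B n a = 0" "B b n = b2" "B n b = b2" "B n n = b2"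
    using ab c by (auto simp: n_def b2_def power2_eq_square)
  define p where "p = X *\<^sub>R a + (t / b2) *\<^sub>R n"
  have n_plane: "n \<in> plane a b" unfolding n_def by (intro plane_add plane_scale) auto
  have p_plane: "p \<in> plane a b" unfolding p_def by (intro plane_add plane_scale n_plane) auto
  define e where "e = \<delta> - p"
  have ea: "B a e = 0" using ab nb by (simp add: e_def p_def X_def form_sym[of a \<delta>])
  have eb: "B b e = 0" using ab nb b2 c Db by (simp add: e_def p_def form_sym[of b \<delta>])
  have ep: "B v e = 0" if "v \<in> plane a b" for v using that ea eb by (auto simp: plane_def)
  have pp: "B p p = X\<^sup>2 + t\<^sup>2 / b2"
    using ab nb b2 by (simp add: p_def power2_eq_square field_simps)
  define s where "s = - B e e"
  have "B \<delta> \<delta> = B e e + B p p" using ep[OF p_plane] form_sym[of e p] by (simp add: e_def)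
  then have s: "1 + s = X\<^sup>2 + t\<^sup>2 / b2" using root_unit[OF dd(1)] pp by (simp add: s_def)
  have X2: "X\<^sup>2 \<ge> 1" using X by simp
  have tb: "t\<^sup>2 / b2 \<ge> 0" using b2 by simp
  have s0: "s \<ge> 0" using s X2 tb by linarith
  \<comment> \<open>Some element of the dihedral group makes the component along \<open>n\<close>
    dominant, with nonnegative \<open>f0\<close>, and fixes \<open>e\<close>. There
    \<open>edom_strict\<close> says that even \<open>e\<close> plus this component has negative
    value.\<close>
  have ef: "f0 e < 0"
  proof -
    have q: "(t / b2) *\<^sub>R n \<in> plane a b" using n_plane plane_scale by blast
    obtain d where d: "plane_elt a b d" "B a (act d ((t / b2) *\<^sub>R n)) \<ge> 0" "B b (act d ((t / b2) *\<^sub>R n)) \<ge> 0"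
      using exists_dominant[OF sp q] by blast
    have dW: "d \<in> carrier W" and de: "act d e = e" using d ea eb by (auto simp: plane_elt_def)
    have "act d ((t / b2) *\<^sub>R n) \<in> plane a b" using d q by (simp add: plane_elt_def)
    then obtain x y where xy: "x \<ge> 0" "y \<ge> 0" "act d ((t / b2) *\<^sub>R n) = x *\<^sub>R a + y *\<^sub>R b"
      using dominant_coords[OF sp _ d(2,3)] by blast
    have nn: "f0 (act d ((t / b2) *\<^sub>R n)) \<ge> 0" unfolding xy(3) using xy ab by simp
    have "f0 (act d \<delta>) < X * f0 (act d a)" unfolding X_def using edom_strict[OF dd(3,4,1) ab(3) dW] .
    moreover have "f0 (act d e) = f0 (act d \<delta>) - X * f0 (act d a) - f0 (act d ((t / b2) *\<^sub>R n))"
      using dW by (simp add: e_def p_def act_linear_simps)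
    ultimately show ?thesis using nn de by simp
  qed
  have pr: "e + p \<in> roots" using dd by (simp add: e_def)
  obtain \<iota> \<zeta> \<kappa> \<kappa>' where
    z: "0 < \<iota>" "\<iota> \<le> 1" "\<iota> \<le> \<zeta>" "\<zeta> < 101 / 100 * \<iota>" and
    gap: "\<And>\<xi> v. v \<in> plane a b \<Longrightarrow> \<xi> *\<^sub>R e + v \<in> roots \<Longrightarrow> \<xi> = 0 \<or> \<bar>\<xi>\<bar> \<ge> \<iota>" and
    k: "gap_values \<kappa>" "gap_values \<kappa>'" and
    eq: "\<kappa>\<^sup>2 + \<kappa>'\<^sup>2 + c * \<kappa> * \<kappa>' = (1 - c\<^sup>2 / 4) * (1 + s * \<zeta>\<^sup>2)"
    using near_minimal_root[OF sp ea eb ef _ p_plane pr] s0 unfolding c(1) s_def by auto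
  have sb: "s < 4 / c\<^sup>2 - 1" using shadow_bound[OF c(2) c2 X t] s by (simp add: b2_def)
  show "c\<^sup>2 < 81 / 25"
    using dominant_coords_large[OF _ c(2) c2 s0 sb z k eq] by (meson not_le)
  show "B \<delta> a = 1 \<and> B \<delta> b = - c / 2" if c3: "c\<^sup>2 = 3"
  proof -
    have "s < 1/3" using sb c3 by simp
    then have "s = 0" using dominant_coords_three[OF c3 c(2) s0 _ z k eq] by simp
    then have "X\<^sup>2 = 1" "t\<^sup>2 / b2 = 0" using s X2 tb by linarith+
    then have "X = 1" "t = 0" using X b2 by (auto simp: power2_eq_1_iff)
    then show ?thesis using Db X_def by simp
  qed
  show "B \<delta> a = - c * B \<delta> b" if c2': "c\<^sup>2 = 2"
  proof -
    have b2h: "b2 = 1/2" by (simp add: b2_def c2')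
    have s2: "s = X\<^sup>2 + 2 * t\<^sup>2 - 1" using s b2h by simp
    have "t = 0"
    proof (rule ccontr)
      assume tn: "t \<noteq> 0"
      \<comment> \<open>For \<open>c^2 = 2\<close> this root is orthogonal to \<open>a\<close>; it
        equals \<open>c *\<^sub>R n\<close>. Reflected in \<open>\<delta>\<close> it has coefficient
        \<open>- 2 c t\<close> at \<open>e\<close>, so a nonzero \<open>t\<close> bounds the infimum
        \<open>\<iota>\<close> by \<open>2 c \<bar>t\<bar>\<close>.\<close>
      define \<tau> where "\<tau> = reflect b a"
      have te: "\<tau> = a + c *\<^sub>R b" using ab c by (simp add: \<tau>_def reflect_def)
      have tr: "\<tau> \<in> roots" "\<tau> \<in> plane a b"
        using ab reflect_root plane_reflect by (auto simp: \<tau>_def)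
      have dt: "B \<delta> \<tau> = c * t"
      proof -
        have "B \<delta> \<tau> = X + c * (t - c * X / 2)" by (simp add: te X_def Db[unfolded X_def])
        also have "\<dots> = X - c\<^sup>2 * X / 2 + c * t" by (simp add: algebra_simps power2_eq_square)
        finally show ?thesis using c2' by simp
      qed
      have "reflect \<delta> \<tau> = (- 2 * (c * t)) *\<^sub>R e + (\<tau> - (2 * (c * t)) *\<^sub>R p)"
        by (simp add: reflect_def dt e_def algebra_simps)
      moreover have "\<tau> - (2 * (c * t)) *\<^sub>R p \<in> plane a b" using tr p_plane by (intro plane_diff plane_scale)
      ultimately have "- 2 * (c * t) = 0 \<or> \<bar>- 2 * (c * t)\<bar> \<ge> \<iota>"
        using gap reflect_root[OF dd(1) tr(1)] by metis
      then have "2 * c * \<bar>t\<bar> \<ge> \<iota>" using tn c by (simp add: abs_mult)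
      then have "\<iota>\<^sup>2 \<le> (2 * c * \<bar>t\<bar>)\<^sup>2" using z by (intro power_mono) auto
      then have i2: "\<iota>\<^sup>2 \<le> 8 * t\<^sup>2" by (simp add: power_mult_distrib c2')
      have "c * X < 2 * (1 - \<bar>t\<bar>)" using t by simp
      moreover have "c * X \<ge> 0" by (rule mult_nonneg_nonneg) (use c(2) X in auto)
      ultimately have "(c * X)\<^sup>2 < (2 * (1 - \<bar>t\<bar>))\<^sup>2" by (intro power_strict_mono) auto
      then have "X\<^sup>2 < 2 * (1 - \<bar>t\<bar>)\<^sup>2" unfolding power_mult_distrib c2' by simp
      then have "s < 2 * (1 - \<bar>t\<bar>)\<^sup>2 + 2 * \<bar>t\<bar>\<^sup>2 - 1" using s2 by simp
      also have "\<dots> = (1 - 2 * \<bar>t\<bar>)\<^sup>2" by (simp add: power2_eq_square algebra_simps)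
      finally have s3: "s \<le> (1 - 2 * \<bar>t\<bar>)\<^sup>2" by simp
      have "s * \<iota>\<^sup>2 \<le> (1 - 2 * \<bar>t\<bar>)\<^sup>2 * (8 * t\<^sup>2)" using s3 i2 s0 by (intro mult_mono) auto
      also have "\<dots> = 2 * (2 * \<bar>t\<bar> * (1 - 2 * \<bar>t\<bar>))\<^sup>2" by (simp add: power_mult_distrib)
      \<comment> \<open>The maximum of \<open>u (1 - u)\<close> is \<open>1/4\<close>, here with
        \<open>u = 2 \<bar>t\<bar>\<close>. This is the source of the bound
        \<open>1/8\<close>.\<close>
      also have "\<dots> \<le> 2 * (1/4)\<^sup>2"
      proof -
        have "2 * \<bar>t\<bar> * (1 - 2 * \<bar>t\<bar>) \<le> 1/4"
          using zero_le_power2[of "2 * \<bar>t\<bar> - 1/2"] by (simp add: power2_eq_square algebra_simps)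
        moreover have "2 * \<bar>t\<bar> * (1 - 2 * \<bar>t\<bar>) \<ge> 0"
        proof -
          have "c \<ge> 1"
          proof (rule ccontr)
            assume "\<not> c \<ge> 1"
            then have "c\<^sup>2 < 1" using power_strict_mono[of c 1 2] c(2) by simp
            then show False using c2' by simp
          qed
          then have "c * X \<ge> 1" using X by (metis mult_mono' mult_1 zero_le_one)
          then have "\<bar>t\<bar> \<le> 1/2" using t by linarith
          then show ?thesis by simp
        qed
        ultimately show ?thesis by (intro mult_left_mono power_mono) auto
      qed
      finally have "s * \<iota>\<^sup>2 \<le> 1/8" by (simp add: power2_eq_square)
      then have "s = 0" using dominant_coords_two[OF c2' c(2) s0 _ z(1,3,4) k eq] by simp
      then have "t\<^sup>2 = 0" using s2 X2 zero_le_power2[of t] by linarith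
      then show False using tn by simp
    qed
    then have "B \<delta> b = - c * X / 2" using Db by simp
    then have "- c * B \<delta> b = c\<^sup>2 * X / 2" by (simp add: power2_eq_square)
    then show ?thesis using c2' by (simp add: X_def)
  qed
qed

text \<open>
  For \<open>c = 1\<close> and \<open>c\<^sup>2 = c + 1\<close> one reflection takes \<open>a\<close> to \<open>\<beta>\<close>.  In the other cases the exceptional
  roots \<open>\<delta>\<close> are replaced by \<open>s\<^sub>b s\<^sub>\<delta> b\<close> if \<open>c\<^sup>2 = 2\<close> and by \<open>s\<^sub>\<delta> b\<close> if \<open>c\<^sup>2 = 3\<close>, and do not exist otherwise.
\<close>
lemma dominance_depth_simple_reflect:
  assumes sp: "simple_pair a b" and neg: "B a b < 0"
  shows "dominance_depth a \<le> dominance_depth (reflect a b)"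
proof -
  note ab = simple_pairD[OF sp]
  define c where "c = - 2 * B a b"
  have c: "c > 0" using neg by (simp add: c_def)
  have c2: "c < 2" using simple_pair_values(1)[OF sp c_def c] .
  have Bc: "B a b = - c / 2" by (simp add: c_def)
  define \<beta> where "\<beta> = reflect a b"
  have be: "\<beta> = b + c *\<^sub>R a" by (simp add: \<beta>_def reflect_def c_def)
  have bp: "\<beta> \<in> pos_roots" unfolding \<beta>_def using reflect_pos ab by simp
  have br: "\<beta> \<in> roots" using bp by (simp add: pos_rootsD)
  have ba: "B \<beta> a < 1" using ab c2 by (simp add: be Bc)
  \<comment> \<open>The longest element makes \<open>a\<close>, \<open>b\<close> and
    \<open>\<beta>\<close> negative. It is the test element at which \<open>edomI\<close> is applied
    to the replaced roots.\<close>
  obtain w where w: "plane_elt a b w" "f0 (act w a) < 0" "f0 (act w b) < 0" using exists_longest[OF sp] by blast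
  have wW: "w \<in> carrier W" using w by (simp add: plane_elt_def)
  have wb: "f0 (act w \<beta>) < 0" using w c wW by (simp add: be act_linear_simps add_neg_neg mult_pos_neg)
  have D: "\<delta> \<in> pos_roots" "\<delta> \<in> roots" "edom \<delta> a" "\<delta> \<noteq> a" "B \<delta> a \<ge> 1" "f0 \<delta> > 0"
    "f0 (act w \<delta>) < B \<delta> a * f0 (act w a)" if "\<delta> \<in> dom_set a" for \<delta>
    using that edom_form_ge_1[of \<delta> a] ab edom_strict[of \<delta> a w] wW by (auto simp: dom_set_def pos_rootsD)
  consider "c = 1" | "c\<^sup>2 = 2" | "c\<^sup>2 = c + 1" | "c\<^sup>2 = 3" | "c\<^sup>2 \<ge> 81 / 25"
    using simple_pair_values(2)[OF sp c_def c] by blast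
  then show ?thesis
  proof cases
    case 1
    have "reflect b a = \<beta>" using ab 1 by (simp add: be reflect_def Bc)
    then show ?thesis using dominance_depth_le_reflect[OF ab(1,2) neg] by (simp add: \<beta>_def)
  next
    case 3
    define \<tau> where "\<tau> = reflect b a"
    have te: "\<tau> = a + c *\<^sub>R b" using ab by (simp add: \<tau>_def reflect_def Bc)
    have tp: "\<tau> \<in> pos_roots" unfolding \<tau>_def using reflect_pos ab by simp
    have c1: "c > 1"
    proof (rule ccontr)
      assume "\<not> c > 1"
      then have "c * c \<le> 1 * 1" using c by (intro mult_mono) auto
      then show False using 3 c by (simp add: power2_eq_square)
    qed
    have "B a \<tau> = 1 - c\<^sup>2 / 2" using ab by (simp add: te Bc power2_eq_square)
    then have "B a \<tau> = 1 - (c + 1) / 2" unfolding 3 .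
    then have B: "B a \<tau> = (1 - c) / 2" by (simp add: field_simps)
    have "B \<tau> a = (1 - c) / 2" using B form_sym by metis
    then have e: "2 * B \<tau> a = 1 - c" by simp
    have "reflect \<tau> a = a + (c - 1) *\<^sub>R \<tau>" unfolding reflect_def e by (simp add: scaleR_diff_left)
    also have "\<dots> = c *\<^sub>R a + (c\<^sup>2 - c) *\<^sub>R b" by (simp add: te algebra_simps power2_eq_square)
    also have "\<dots> = \<beta>" using 3 by (simp add: be)
    finally show ?thesis using dominance_depth_le_reflect[OF ab(1) tp] B c1 by (simp add: \<beta>_def)
  next
    case 5
    \<comment> \<open>There are no exceptional roots, so the conditions on \<open>g\<close> are
      vacuous.\<close>
    show ?thesis unfolding \<beta>_def[symmetric]
      by (rule dominance_depth_le_exchange[OF ab(1) bp ba, where g = id])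
        (use dom_set_shadow(1)[OF sp c_def c] 5 in \<open>force simp: \<beta>_def\<close>)+
  next
    case 4
    show ?thesis unfolding \<beta>_def[symmetric]
    proof (rule dominance_depth_le_exchange[OF ab(1) bp ba, where g = "\<lambda>\<delta>. reflect \<delta> b"])
      have form: "reflect \<delta> b = b + c *\<^sub>R \<delta>" "B \<delta> a = 1" "B \<delta> b = - c / 2"
        if "\<delta> \<in> dom_set a" "B \<delta> \<beta> < 1" for \<delta>
        using dom_set_shadow(2)[OF sp c_def c that(1) _ 4] that(2) by (auto simp: \<beta>_def reflect_def)
      fix \<delta> assume d: "\<delta> \<in> dom_set a" "B \<delta> \<beta> < 1"
      note dd = D[OF d(1)] and f = form[OF d]
      let ?d = "reflect \<delta> b"
      have r: "?d \<in> roots" using reflect_root dd ab by simp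
      then have p: "?d \<in> pos_roots" using dd ab c by (simp add: pos_roots_iff f add_pos_pos)
      have "B ?d \<beta> = 1 + c * (B \<delta> a * c + B \<delta> b - c / 2)"
        using ab by (simp add: f(1) be Bc algebra_simps)
      then have one: "B ?d \<beta> = 1" by (simp add: f)
      have "f0 (act w ?d) = f0 (act w b) + c * f0 (act w \<delta>)" using wW by (simp add: f(1) act_linear_simps)
      also have "\<dots> < f0 (act w b) + c * f0 (act w a)" using dd(7) f c by simp
      also have "\<dots> = f0 (act w \<beta>)" using wW by (simp add: be act_linear_simps)
      finally have less: "f0 (act w ?d) < f0 (act w \<beta>)" .
      then have "edom ?d \<beta>" using edomI[OF r br _ wW wb] one by simp
      moreover have "?d \<noteq> \<beta>" using less by auto
      moreover have "B ?d a < 1" using ab f(2) c2 by (simp add: f(1) Bc)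
      ultimately show "?d \<in> dom_set \<beta> \<and> B ?d a < 1" using p by (simp add: dom_set_def)
    next
      show "inj_on (\<lambda>\<delta>. reflect \<delta> b) {\<delta> \<in> dom_set a. B \<delta> \<beta> < 1}"
      proof (rule inj_onI)
        fix x y assume xy: "x \<in> {\<delta> \<in> dom_set a. B \<delta> \<beta> < 1}" "y \<in> {\<delta> \<in> dom_set a. B \<delta> \<beta> < 1}"
          "reflect x b = reflect y b"
        have "B x b = - c / 2" "B y b = - c / 2"
          using dom_set_shadow(2)[OF sp c_def c _ _ 4] xy by (auto simp: \<beta>_def)
        then show "x = y" using xy(3) c by (simp add: reflect_def)
      qed
    qed
  next
    case 2
    have form: "B \<delta> a = - c * B \<delta> b" "B \<delta> b < 0" "2 * (B \<delta> b)\<^sup>2 \<ge> 1"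
      if "\<delta> \<in> dom_set a" "B \<delta> \<beta> < 1" for \<delta>
    proof -
      show e: "B \<delta> a = - c * B \<delta> b" using dom_set_shadow(3)[OF sp c_def c that(1) _ 2] that(2) by (simp add: \<beta>_def)
      have X: "B \<delta> a \<ge> 1" using D that by simp
      then have "c * B \<delta> b < 0" using e by simp
      then show "B \<delta> b < 0" using c by (simp add: mult_less_0_iff)
      have "1 \<le> (B \<delta> a)\<^sup>2" using X by simp
      then show "2 * (B \<delta> b)\<^sup>2 \<ge> 1" unfolding e by (simp add: power_mult_distrib 2)
    qed
    show ?thesis unfolding \<beta>_def[symmetric]
    proof (rule dominance_depth_le_exchange[OF ab(1) bp ba, where g = "\<lambda>\<delta>. reflect b (reflect \<delta> b)"])
      fix \<delta> assume d: "\<delta> \<in> dom_set a" "B \<delta> \<beta> < 1"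
      note dd = D[OF d(1)] and f = form[OF d]
      define Z where "Z = - B \<delta> b"
      have Z: "Z > 0" "2 * Z\<^sup>2 \<ge> 1" "B \<delta> a = c * Z" "B \<delta> b = - Z" "B b \<delta> = - Z"
        using f form_sym[of b \<delta>] by (auto simp: Z_def)
      let ?d = "reflect b (reflect \<delta> b)"
      have de: "?d = (2 * Z) *\<^sub>R \<delta> + (4 * Z\<^sup>2 - 1) *\<^sub>R b"
      proof -
        have "reflect \<delta> b = (2 * Z) *\<^sub>R \<delta> + 1 *\<^sub>R b" by (simp add: reflect_def Z)
        then have "?d = (2 * Z) *\<^sub>R \<delta> + (- 1 - 2 * B b \<delta> * (2 * Z)) *\<^sub>R b"
          using reflect_coords(2)[OF ab(8), of "2 * Z" \<delta> 1] by simp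
        then show ?thesis by (simp add: Z power2_eq_square)
      qed
      have r: "?d \<in> roots" using reflect_root dd ab by simp
      have "4 * Z\<^sup>2 - 1 > 0" using Z by simp
      then have "f0 ?d > 0" unfolding de using Z dd ab by (simp add: add_pos_pos)
      then have p: "?d \<in> pos_roots" using r by (simp add: pos_roots_iff)
      have b\<beta>: "B b \<beta> = 1 - c\<^sup>2 / 2" using ab by (simp add: be Bc power2_eq_square)
      have "B \<delta> \<beta> = c\<^sup>2 * Z - Z" by (simp add: be Z power2_eq_square)
      then have d\<beta>: "B \<delta> \<beta> = Z" "B b \<beta> = 0" using b\<beta> 2 by simp_all
      have k: "B ?d \<beta> = 2 * Z\<^sup>2" unfolding de by (simp add: d\<beta> power2_eq_square)
      have "f0 (act w ?d) = 2 * Z * f0 (act w \<delta>) + (4 * Z\<^sup>2 - 1) * f0 (act w b)"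
        unfolding de using wW by (simp add: act_linear_simps)
      also have "\<dots> < 2 * Z * (c * Z * f0 (act w a)) + (4 * Z\<^sup>2 - 1) * f0 (act w b)"
        using dd(7) Z by simp
      also have "\<dots> = 2 * Z\<^sup>2 * f0 (act w \<beta>) + (2 * Z\<^sup>2 - 1) * f0 (act w b)"
        using wW by (simp add: be act_linear_simps algebra_simps power2_eq_square)
      also have "\<dots> \<le> 2 * Z\<^sup>2 * f0 (act w \<beta>)" using Z w by (simp add: mult_nonneg_nonpos)
      finally have less: "f0 (act w ?d) < B ?d \<beta> * f0 (act w \<beta>)" using k by simp
      then have "edom ?d \<beta>" using edomI[OF r br _ wW wb] k Z by simp
      moreover have "?d \<noteq> \<beta>" using less root_unit[OF br] by force
      moreover have "B ?d a < 1"
      proof -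
        have "B ?d a = 2 * Z * (c * Z) + (4 * Z\<^sup>2 - 1) * (- c / 2)" unfolding de using Z ab Bc by simp
        also have "\<dots> = c / 2" by (simp add: algebra_simps power2_eq_square)
        finally show ?thesis using c2 by simp
      qed
      ultimately show "?d \<in> dom_set \<beta> \<and> B ?d a < 1" using p by (simp add: dom_set_def)
    next
      show "inj_on (\<lambda>\<delta>. reflect b (reflect \<delta> b)) {\<delta> \<in> dom_set a. B \<delta> \<beta> < 1}"
      proof (rule inj_onI)
        fix x y assume xy: "x \<in> {\<delta> \<in> dom_set a. B \<delta> \<beta> < 1}" "y \<in> {\<delta> \<in> dom_set a. B \<delta> \<beta> < 1}"
          "reflect b (reflect x b) = reflect b (reflect y b)"
        have "reflect x b = reflect y b" using xy(3) reflect_reflect[OF ab(4)] by metis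
        then have e: "B x b *\<^sub>R x = B y b *\<^sub>R y" by (simp add: reflect_def flip: scaleR_scaleR)
        have n: "B x b < 0" "B y b < 0" using form xy by auto
        have u: "B x x = 1" "B y y = 1" using D root_unit xy by auto
        have "B (B x b *\<^sub>R x) (B x b *\<^sub>R x) = B (B y b *\<^sub>R y) (B y b *\<^sub>R y)" unfolding e ..
        then have "(B x b)\<^sup>2 = (B y b)\<^sup>2" using u by (simp add: power2_eq_square)
        then have "B x b = B y b" using n by (auto simp: power2_eq_iff)
        then show "x = y" using e n by simp
      qed
    qed
  qed
qed

text \<open>Descend from \<open>\<rho>\<close>: having norm one, it pairs positively with
  \<open>a\<close> or \<open>b\<close>, and the reflection in that root lowers it without raising
  its depth. The descent ends at \<open>a\<close>; it could reach \<open>b\<close> only from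
  \<open>reflect a b\<close>, where \<open>dominance_depth_simple_reflect\<close> applies
  instead.\<close>

lemma dominance_depth_simple_le:
  assumes sp: "simple_pair a b" and r: "\<rho> \<in> pos_roots" "\<rho> \<in> plane a b" "\<rho> \<noteq> b"
  shows "dominance_depth a \<le> dominance_depth \<rho>"
proof -
  note ab = simple_pairD[OF sp]
  define N where "N \<rho> = {\<eta> \<in> roots \<inter> plane a b. f0 \<eta> < f0 \<rho> \<and> f0 \<eta> > 0}" for \<rho>
  have fin: "finite (N \<rho>)" for \<rho> unfolding N_def by (rule finite_subset[OF _ finite_simple_pair[OF sp]]) auto
  show ?thesis using r
  proof (induction "card (N \<rho>)" arbitrary: \<rho> rule: less_induct)
    case less
    have rr: "\<rho> \<in> roots" "f0 \<rho> > 0" using less.prems by (auto simp: pos_rootsD)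
    show ?case
    proof (cases "\<rho> = a")
      case False
      obtain x y where xy: "x \<ge> 0" "y \<ge> 0" "\<rho> = x *\<^sub>R a + y *\<^sub>R b"
        using simple_pair_coords[OF sp less.prems(1,2)] .
      have "1 = B \<rho> (x *\<^sub>R a + y *\<^sub>R b)" using root_unit[OF rr(1)] xy(3) by simp
      then have one: "x * B \<rho> a + y * B \<rho> b = 1" by simp
      have step: "dominance_depth (reflect s \<rho>) \<le> dominance_depth \<rho>" "reflect s \<rho> \<in> plane a b"
         "reflect s \<rho> \<in> pos_roots" "card (N (reflect s \<rho>)) < card (N \<rho>)"
        if s: "simple_pair s s'" "plane s s' = plane a b" "\<rho> \<noteq> s" "B \<rho> s > 0" for s s'
      proof -
        note sd = simple_pairD[OF s(1)]
        have sB: "B s \<rho> > 0" using s form_sym[of s \<rho>] by simp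
        show p: "reflect s \<rho> \<in> pos_roots" using simple_pair_reflect[OF s(1)] s less.prems by simp
        have "s \<in> plane a b" using plane_self(1)[of s s'] s by simp
        then show pl: "reflect s \<rho> \<in> plane a b" using plane_reflect less.prems by simp
        have "B (reflect s \<rho>) s < 0" using s(4) sB sd(7) form_sym[of s \<rho>] by (simp add: reflect_def)
        from dominance_depth_le_reflect[OF p sd(1) this] show "dominance_depth (reflect s \<rho>) \<le> dominance_depth \<rho>"
          using reflect_reflect[OF sd(3)] by simp
        have "f0 (reflect s \<rho>) < f0 \<rho>" using sB sd(5) by (simp add: reflect_def)
        then have "N (reflect s \<rho>) \<subset> N \<rho>" using p pl by (auto simp: N_def pos_roots_iff)
        then show "card (N (reflect s \<rho>)) < card (N \<rho>)" using fin by (intro psubset_card_mono)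
      qed
      consider "B \<rho> a > 0" | "B \<rho> b > 0"
      proof -
        have "B \<rho> a > 0 \<or> B \<rho> b > 0"
        proof (rule ccontr)
          assume "\<not> ?thesis"
          then have "x * B \<rho> a \<le> 0" "y * B \<rho> b \<le> 0" using xy by (auto simp: mult_nonneg_nonpos not_less)
          then show False using one by linarith
        qed
        then show ?thesis using that by blast
      qed
      then show ?thesis
      proof cases
        case 1
        note st = step[OF sp refl False 1]
        show ?thesis
        proof (cases "reflect a \<rho> = b")
          case True
          then have re: "\<rho> = reflect a b" using reflect_reflect[OF ab(3), of \<rho>] by simp
          have "B a b < 0"
          proof (rule ccontr)
            assume "\<not> B a b < 0"
            then have "B a b = 0" using ab by simp
            then show False using re less.prems by (simp add: reflect_def)
          qed
          then show ?thesis using dominance_depth_simple_reflect[OF sp] re by simp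
        next
          case nb: False
          show ?thesis using less.hyps[OF st(4,3,2) nb] st(1) by (rule order_trans)
        qed
      next
        case 2
        note st = step[OF simple_pair_sym[OF sp] plane_commute less.prems(3) 2]
        have "reflect b \<rho> \<noteq> b"
        proof
          assume "reflect b \<rho> = b"
          then have "\<rho> = - b" using reflect_reflect[OF ab(4), of \<rho>] reflect_self[OF ab(4)] by simp
          then show False using rr ab by simp
        qed
        then show ?thesis using less.hyps[OF st(4,3,2)] st(1) by (meson order_trans)
      qed
    qed simp
  qed
qed

text \<open>The functionals \<open>f0\<close> and \<open>h\<close> are coordinates on the plane. Of
  the finitely many positive roots in it, take those with the largest and the smallest slope
  \<open>h / f0\<close>; all others lie in the cone between them.\<close>

lemma exists_simple_pair:
  assumes a: "a \<in> pos_roots" and b: "b \<in> pos_roots" and k: "\<bar>B a b\<bar> < 1"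
  obtains p q where "simple_pair p q" "plane p q = plane a b"
proof -
  have ab: "a \<in> roots" "b \<in> roots" "f0 a > 0" "f0 b > 0" using a b by (auto simp: pos_rootsD)
  have u: "B a a = 1" "B b b = 1" "B b a = B a b" using ab root_unit form_sym by auto
  have k2: "1 - (B a b)\<^sup>2 > 0" using k by (simp add: abs_square_less_1)
  define n where "n = b - B a b *\<^sub>R a"
  define h where "h v = B v n" for v
  have h_lin: "h (x + y) = h x + h y" "h (c *\<^sub>R x) = c * h x" "h (x - y) = h x - h y" for x y c by (auto simp: h_def)
  have hab: "h a = 0" "h b = 1 - (B a b)\<^sup>2" using u by (auto simp: h_def n_def power2_eq_square)
  define R where "R = {\<rho> \<in> roots \<inter> plane a b. f0 \<rho> > 0}"
  have fin: "finite R" unfolding R_def by (rule finite_subset[OF _ finite_plane_roots[OF ab(1,2) k]]) auto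
  have aR: "a \<in> R" "b \<in> R" using ab by (auto simp: R_def)
  have zero: "v = 0" if v: "v \<in> plane a b" "f0 v = 0" "h v = 0" for v
  proof -
    obtain x y where xy: "v = x *\<^sub>R a + y *\<^sub>R b" using v by (auto simp: plane_def)
    then have "y * (1 - (B a b)\<^sup>2) = 0" using v by (simp add: h_lin hab)
    then have "y = 0" using k2 by simp
    then show ?thesis using v xy ab by simp
  qed
  define ratio where "ratio \<rho> = h \<rho> / f0 \<rho>" for \<rho>
  have finr: "finite (ratio ` R)" "ratio ` R \<noteq> {}" using fin aR by auto
  obtain p where p: "p \<in> R" "ratio p = Max (ratio ` R)" using Max_in[OF finr] by (metis imageE)
  obtain q where q: "q \<in> R" "ratio q = Min (ratio ` R)" using Min_in[OF finr] by (metis imageE)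
  have le: "ratio q \<le> ratio \<rho>" "ratio \<rho> \<le> ratio p" if "\<rho> \<in> R" for \<rho>
    using that finr p q by auto
  have pd: "p \<in> roots" "p \<in> plane a b" "f0 p > 0" and qd: "q \<in> roots" "q \<in> plane a b" "f0 q > 0"
    using p q by (auto simp: R_def)
  have "ratio a = 0" "ratio b > 0" using hab k2 ab by (auto simp: ratio_def)
  then have lt: "ratio q < ratio p" using le[OF aR(1)] le[OF aR(2)] by linarith
  define D where "D = h p * f0 q - h q * f0 p"
  have D: "D > 0" using lt pd qd by (simp add: ratio_def D_def field_simps)
  have coord: "v = ((h v * f0 q - f0 v * h q) / D) *\<^sub>R p + ((h p * f0 v - f0 p * h v) / D) *\<^sub>R q"
    if v: "v \<in> plane a b" for v
  proof -
    let ?x = "(h v * f0 q - f0 v * h q) / D" and ?y = "(h p * f0 v - f0 p * h v) / D"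
    have n: "(h v * f0 q - f0 v * h q) * f0 p + (h p * f0 v - f0 p * h v) * f0 q = f0 v * D"
      "(h v * f0 q - f0 v * h q) * h p + (h p * f0 v - f0 p * h v) * h q = h v * D"
      by (simp_all add: D_def algebra_simps)
    have "?x * f0 p + ?y * f0 q = f0 v" "?x * h p + ?y * h q = h v"
      using D by (simp_all add: n flip: add_divide_distrib)
    then have "f0 (v - (?x *\<^sub>R p + ?y *\<^sub>R q)) = 0" "h (v - (?x *\<^sub>R p + ?y *\<^sub>R q)) = 0"
      by (simp_all only: h_lin f0_simps diff_self)
    moreover have "v - (?x *\<^sub>R p + ?y *\<^sub>R q) \<in> plane a b"
      using v pd qd by (intro plane_diff plane_add plane_scale)
    ultimately have "v - (?x *\<^sub>R p + ?y *\<^sub>R q) = 0" using zero by blast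
    then show ?thesis by simp
  qed
  have sub: "plane p q \<subseteq> plane a b"
    using pd qd by (auto simp: plane_def[of p q] intro!: plane_add plane_scale)
  have plane_eq: "plane p q = plane a b"
  proof
    show "plane a b \<subseteq> plane p q" using coord unfolding plane_def[of p q] by blast
  qed (rule sub)
  have coh: "0 \<le> x \<and> 0 \<le> y" if r: "x *\<^sub>R p + y *\<^sub>R q \<in> roots" "f0 (x *\<^sub>R p + y *\<^sub>R q) > 0" for x y
  proof -
    let ?r = "x *\<^sub>R p + y *\<^sub>R q"
    have "?r \<in> plane a b" using sub planeI by blast
    then have rR: "?r \<in> R" using r by (simp add: R_def)
    have "h ?r * f0 q - f0 ?r * h q = x * D" "h p * f0 ?r - f0 p * h ?r = y * D"
      by (simp_all add: h_lin D_def algebra_simps)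
    moreover have "h ?r * f0 q - f0 ?r * h q \<ge> 0" "h p * f0 ?r - f0 p * h ?r \<ge> 0"
      using le[OF rR] r(2) pd qd unfolding ratio_def
      by (simp_all add: pos_le_divide_eq pos_divide_le_eq field_simps)
    ultimately show ?thesis using D by (simp add: zero_le_mult_iff)
  qed
  have "simple_pair p q"
    unfolding simple_pair_def
  proof (intro conjI allI impI)
    show "p \<in> pos_roots" "q \<in> pos_roots" using pd qd by (auto simp: pos_roots_iff)
    show "p \<noteq> q" using lt by auto
    show "- 1 < B p q"
    proof -
      have "f0 (p + q) > 0" using pd qd by simp
      then have s: "p + q \<in> plane a b" "p + q \<noteq> 0" using plane_add[OF pd(2) qd(2)] by (blast, metis f0_simps(5) less_irrefl)
      then obtain x y where xy: "p + q = x *\<^sub>R a + y *\<^sub>R b" by (auto simp: plane_def)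
      have "B (p + q) (p + q) = (x + B a b * y)\<^sup>2 + (1 - (B a b)\<^sup>2) * y\<^sup>2"
        unfolding xy using u by (simp add: power2_eq_square algebra_simps)
      also have "\<dots> > 0"
      proof (cases "y = 0")
        case True then show ?thesis using s xy by auto
      next
        case False then show ?thesis using k2 by (intro add_nonneg_pos) auto
      qed
      finally show ?thesis using root_unit[OF pd(1)] root_unit[OF qd(1)] form_sym[of q p] by simp
    qed
    fix x y assume r: "x *\<^sub>R p + y *\<^sub>R q \<in> roots"
    show "0 \<le> x \<and> 0 \<le> y \<or> x \<le> 0 \<and> y \<le> 0"
    proof (cases "f0 (x *\<^sub>R p + y *\<^sub>R q) > 0")
      case True then show ?thesis using coh r by blast
    next
      case False
      then have n: "f0 (x *\<^sub>R p + y *\<^sub>R q) < 0" using f0_root_nonzero[OF r] by linarith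
      have e: "- (x *\<^sub>R p + y *\<^sub>R q) = (- x) *\<^sub>R p + (- y) *\<^sub>R q" by simp
      have "(- x) *\<^sub>R p + (- y) *\<^sub>R q \<in> roots" using roots_uminus[OF r] unfolding e .
      moreover have "f0 ((- x) *\<^sub>R p + (- y) *\<^sub>R q) > 0" using n by simp
      ultimately show ?thesis using coh[of "- x" "- y"] by auto
    qed
  qed
  then show ?thesis using that plane_eq by blast
qed

subsection \<open>Walls and short inversions\<close>
lemma unit_multiple_pos:
  assumes "a \<in> pos_roots" "b \<in> pos_roots" "a = x *\<^sub>R b"
  shows "a = b"
proof -
  have "f0 a = x * f0 b" using assms by simp
  then have "x > 0" using assms pos_rootsD by (metis zero_less_mult_pos2)
  moreover have "x * x = 1" using root_unit[of a] root_unit[of b] assms by (simp add: pos_rootsD)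
  ultimately have "x = 1" by (simp add: square_eq_1_iff)
  then show ?thesis using assms by simp
qed

lemma inversions_combination:
  assumes u: "u \<in> carrier W" and v: "v = x *\<^sub>R p + y *\<^sub>R q" "v \<in> pos_roots" "x \<ge> 0" "y \<ge> 0"
    and p: "p \<in> pos_roots" and q: "q \<in> pos_roots"
  shows "p \<in> inversions u \<Longrightarrow> q \<in> inversions u \<Longrightarrow> v \<in> inversions u"
    and "v \<in> inversions u \<Longrightarrow> p \<notin> inversions u \<Longrightarrow> q \<in> inversions u"
proof -
  have iu: "inv u \<in> carrier W" using u by simp
  have e: "f0 (act (inv u) v) = x * f0 (act (inv u) p) + y * f0 (act (inv u) q)"
    unfolding v(1) by (simp add: act_linear_simps[OF iu])
  have nz: "f0 (act (inv u) v) \<noteq> 0" using f0_root_nonzero[OF roots_act[OF iu pos_rootsD(1)[OF v(2)]]] .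
  show "v \<in> inversions u" if "p \<in> inversions u" "q \<in> inversions u"
  proof -
    have "f0 (act (inv u) v) \<le> 0" unfolding e
      using that u v by (intro add_nonpos_nonpos mult_nonneg_nonpos) (auto simp: inversions_iff)
    then show ?thesis using nz u v by (simp add: inversions_iff)
  qed
  show "q \<in> inversions u" if "v \<in> inversions u" "p \<notin> inversions u"
  proof (rule ccontr)
    assume "q \<notin> inversions u"
    then have "f0 (act (inv u) v) \<ge> 0" unfolding e
      using that u v p q by (intro add_nonneg_nonneg mult_nonneg_nonneg) (auto simp: inversions_iff)
    then show False using that u by (simp add: inversions_iff)
  qed
qed

text \<open>If the form value is at least 1, one root dominates the other, and since
  \<open>w \<otimes> t\<close> inverts only \<open>\<beta>\<close>, the dominated one is
  \<open>\<beta>\<close>. Otherwise the plane is finite and \<open>\<beta>\<close> is one of its two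
  simple roots, so its depth is at most that of \<open>\<gamma>\<close>, which is not the other
  one.\<close>

lemma short_before_wall:
  assumes w: "w \<in> carrier W" and t: "t \<in> S" "f0 (act w (\<alpha> t)) < 0" and \<gamma>: "\<gamma> = - act w (\<alpha> t)"
    and \<beta>: "\<beta> \<in> short_inversions w" "\<beta> \<noteq> \<gamma>" and pos: "B \<beta> \<gamma> > 0"
  shows "dominance_depth \<beta> \<le> dominance_depth \<gamma>"
    and "\<And>y. y \<in> carrier W \<Longrightarrow> inversions y \<subseteq> inversions w \<Longrightarrow> \<gamma> \<in> inversions y \<Longrightarrow> \<beta> \<in> inversions y"
proof -
  let ?u = "w \<otimes> t"
  have u: "?u \<in> carrier W" using w t by simp
  have wi: "inversions w = insert \<gamma> (inversions ?u)" "\<gamma> \<notin> inversions ?u"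
    using snoc_down(1,2)[OF w t] \<gamma> by auto
  have bw: "\<beta> \<in> inversions w" using short_inversions_subset[OF w] \<beta> by blast
  then have bu: "\<beta> \<in> inversions ?u" using wi \<beta> by auto
  have gw: "\<gamma> \<in> inversions w" using wi by simp
  have bp: "\<beta> \<in> pos_roots" and gp: "\<gamma> \<in> pos_roots" using inversionsD[OF w bw] inversionsD[OF w gw] by auto
  have br: "\<beta> \<in> roots" "\<gamma> \<in> roots" using bp gp by (auto simp: pos_rootsD)
  have main: "dominance_depth \<beta> \<le> dominance_depth \<gamma> \<and>
     (\<forall>y. y \<in> carrier W \<longrightarrow> inversions y \<subseteq> inversions w \<longrightarrow> \<gamma> \<in> inversions y \<longrightarrow> \<beta> \<in> inversions y)"
  proof (cases "B \<beta> \<gamma> \<ge> 1")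
    case True
    have "\<not> edom \<gamma> \<beta>"
    proof
      assume "edom \<gamma> \<beta>"
      then have "dominated_by \<gamma> \<beta>" using dominated_by_iff bp gp by simp
      then show False using bu wi u unfolding dominated_by_def by blast
    qed
    then have d: "edom \<beta> \<gamma>" using edom_total[OF br True] by auto
    then have "dominated_by \<beta> \<gamma>" using dominated_by_iff bp gp by simp
    then show ?thesis using dominance_depth_edom[OF bp gp d] unfolding dominated_by_def by blast
  next
    case False
    then have "\<bar>B \<beta> \<gamma>\<bar> < 1" using pos by simp
    then obtain p q where sp0: "simple_pair p q" "plane p q = plane \<beta> \<gamma>" using exists_simple_pair bp gp by blast
    \<comment> \<open>As \<open>w \<otimes> t\<close> inverts \<open>p\<close> and
      \<open>\<beta>\<close> but not \<open>\<gamma>\<close>, the root \<open>\<beta>\<close> lies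
      strictly between \<open>p\<close> and \<open>\<gamma>\<close>, which
      \<open>short_extremal\<close> excludes.\<close>
    have no: False if sp: "simple_pair p q" "plane p q = plane \<beta> \<gamma>" "p \<in> inversions ?u" "\<beta> \<noteq> p" "\<beta> \<noteq> q" for p q
    proof -
      note pq = simple_pairD[OF sp(1)]
      obtain x y where xy: "x \<ge> 0" "y \<ge> 0" "\<beta> = x *\<^sub>R p + y *\<^sub>R q"
        using simple_pair_coords[OF sp(1) bp] sp(2) by auto
      obtain x' y' where xy': "x' \<ge> 0" "y' \<ge> 0" "\<gamma> = x' *\<^sub>R p + y' *\<^sub>R q"
        using simple_pair_coords[OF sp(1) gp] sp(2) by auto
      have x: "x > 0" "y > 0" using unit_multiple_pos[OF bp pq(2), of y] unit_multiple_pos[OF bp pq(1), of x] xy sp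
        by (auto simp: less_le)
      have pg: "p \<noteq> \<gamma>" using sp(3) wi by auto
      have y': "y' > 0" using unit_multiple_pos[OF gp pq(1), of x'] xy' pg by (auto simp: less_le)
      define \<phi> where "\<phi> v = f0 (act (inv ?u) v)" for v
      have iu: "inv ?u \<in> carrier W" using u by simp
      have lin: "\<phi> (c *\<^sub>R v + d *\<^sub>R v') = c * \<phi> v + d * \<phi> v'" for c d v v'
        by (simp add: \<phi>_def act_linear_simps[OF iu])
      have P: "\<phi> p < 0" using sp(3) u by (simp add: \<phi>_def inversions_iff)
      have b: "x * \<phi> p + y * \<phi> q < 0" using bu u unfolding lin[symmetric] xy(3)[symmetric] by (simp add: \<phi>_def inversions_iff)
      have g: "x' * \<phi> p + y' * \<phi> q \<ge> 0" using wi(2) u gp unfolding lin[symmetric] xy'(3)[symmetric] by (simp add: \<phi>_def inversions_iff)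
      have "y' * (x * \<phi> p + y * \<phi> q) - y * (x' * \<phi> p + y' * \<phi> q) < 0"
        using mult_pos_neg[OF y' b] mult_nonneg_nonneg[OF xy(2) g] by linarith
      then have "(x * y' - y * x') * \<phi> p < 0" by (simp add: algebra_simps)
      then have pos: "x * y' - y * x' > 0" using P by (simp add: mult_less_0_iff)
      have "\<beta> = ((x * y' - y * x') / y') *\<^sub>R p + (y / y') *\<^sub>R \<gamma>"
        unfolding xy(3) xy'(3) using y' by (simp add: scaleR_add_right diff_divide_distrib scaleR_diff_left)
      moreover have "p \<in> inversions w" using sp(3) wi by simp
      ultimately show False
        using short_extremal[OF \<beta>(1) w _ gw, of p "(x * y' - y * x') / y'" "y / y'"] sp(4) \<beta>(2) pos y' x by auto
    qed
    have "\<beta> = p \<or> \<beta> = q"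
    proof (rule ccontr)
      assume n: "\<not> (\<beta> = p \<or> \<beta> = q)"
      note pq = simple_pairD[OF sp0(1)]
      obtain x y where xy: "x \<ge> 0" "y \<ge> 0" "\<beta> = x *\<^sub>R p + y *\<^sub>R q"
        using simple_pair_coords[OF sp0(1) bp] sp0(2) by auto
      have "p \<in> inversions ?u \<or> q \<in> inversions ?u"
        using inversions_combination(2)[OF u xy(3) bp xy(1,2) pq(1,2) bu] by blast
      moreover have "plane q p = plane \<beta> \<gamma>" using sp0(2) plane_commute by blast
      ultimately show False using no[OF sp0] no[OF simple_pair_sym[OF sp0(1)]] n by blast
    qed
    then obtain q where sp: "simple_pair \<beta> q" "plane \<beta> q = plane \<beta> \<gamma>"
    proof
      assume "\<beta> = p" then show ?thesis using that sp0 by blast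
    next
      assume "\<beta> = q"
      moreover have "plane q p = plane \<beta> \<gamma>" using sp0(2) plane_commute by blast
      ultimately show ?thesis using that[of p] simple_pair_sym[OF sp0(1)] by simp
    qed
    note bq = simple_pairD[OF sp(1)]
    \<comment> \<open>The form value of a simple pair is nonpositive, but
      \<open>B \<beta> \<gamma>\<close> is positive.\<close>
    have gq: "\<gamma> \<noteq> q" using pos bq by auto
    have gpl: "\<gamma> \<in> plane \<beta> q" using sp(2) by simp
    obtain x y where xy: "x \<ge> 0" "y \<ge> 0" "\<gamma> = x *\<^sub>R \<beta> + y *\<^sub>R q" using simple_pair_coords[OF sp(1) gp gpl] .
    have "\<beta> \<in> inversions z" if z: "z \<in> carrier W" "inversions z \<subseteq> inversions w" "\<gamma> \<in> inversions z" for z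
    proof (rule ccontr)
      assume "\<beta> \<notin> inversions z"
      then have "q \<in> inversions z" using inversions_combination(2)[OF z(1) xy(3) gp xy(1,2) bq(1,2) z(3)] by blast
      then have "q \<in> inversions ?u" using z(2) wi gq by auto
      then have "\<gamma> \<in> inversions ?u" using inversions_combination(1)[OF u xy(3) gp xy(1,2) bq(1,2) bu] by blast
      then show False using wi by simp
    qed
    then show ?thesis using dominance_depth_simple_le[OF sp(1) gp gpl gq] by blast
  qed
  show "dominance_depth \<beta> \<le> dominance_depth \<gamma>" using main by blast
  show "\<And>y. y \<in> carrier W \<Longrightarrow> inversions y \<subseteq> inversions w \<Longrightarrow> \<gamma> \<in> inversions y \<Longrightarrow> \<beta> \<in> inversions y"
    using main by blast
qed

section \<open>The depth of a root\<close>

lemma len_inv: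
  assumes "g \<in> carrier W"
  shows "len (inv g) = len g"
proof -
  have le: "len (inv g) \<le> len g" if g: "g \<in> carrier W" for g
  proof -
    obtain ws where ws: "ws \<in> lists S" "length ws = len g" "word_prod W ws = g" using len_word[OF g] by blast
    have "word_prod W (rev us) = inv (word_prod W us)" if "us \<in> lists S" for us
      using that
    proof (induction us)
      case (Cons a us)
      then have "rev us \<in> lists S" "[a] \<in> lists S" by auto
      then show ?case using Cons by (simp add: word_prod_append inv_mult_group del: append_in_lists_conv)
    qed simp
    then have "word_prod W (rev ws) = inv g" using ws by blast
    moreover have "rev ws \<in> lists S" using ws(1) by (simp only: in_lists_conv_set set_rev)
    ultimately show ?thesis using len_le[of "rev ws"] ws(2) by simp
  qed
  from le[OF assms] le[of "inv g"] show ?thesis using assms by simp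
qed

definition root_depth :: "'v \<Rightarrow> nat" where
  "root_depth \<beta> = (LEAST n. \<exists>z \<in> carrier W. len z = n \<and> f0 (act z \<beta>) < 0)"

lemma root_depth_le: "z \<in> carrier W \<Longrightarrow> f0 (act z \<beta>) < 0 \<Longrightarrow> root_depth \<beta> \<le> len z"
  unfolding root_depth_def by (rule Least_le) auto

lemma root_depth_witness:
  assumes "\<beta> \<in> pos_roots"
  obtains z where "z \<in> carrier W" "len z = root_depth \<beta>" "f0 (act z \<beta>) < 0"
proof -
  have "\<exists>n. \<exists>z \<in> carrier W. len z = n \<and> f0 (act z \<beta>) < 0"
    using assms pos_rootsD[OF assms] by (auto intro!: bexI[of _ "reflection \<beta>"] simp: act_reflection reflect_self)
  from LeastI_ex[OF this] show ?thesis using that unfolding root_depth_def by blast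
qed

text \<open>Let \<open>z\<close> be a shortest element making \<open>\<beta>\<close> negative. If it
  also makes \<open>\<alpha> t\<close> negative, \<open>z \<otimes> t\<close> is shorter and serves
  for the reflected root. Otherwise cut \<open>inv z\<close> at \<open>\<beta>\<close>: a shorter
  \<open>x\<close> sends \<open>\<beta>\<close> to a simple root and keeps \<open>\<alpha> t\<close>
  positive, and a simple root minus a positive multiple of another positive root is no positive
  root.\<close>

lemma root_depth_gen:
  assumes \<beta>: "\<beta> \<in> pos_roots" "\<beta> \<noteq> \<alpha> t" and t: "t \<in> S" "B \<beta> (\<alpha> t) > 0"
  shows "root_depth (act t \<beta>) < root_depth \<beta>"
proof -
  have br: "\<beta> \<in> roots" using \<beta> by (simp add: pos_rootsD)
  obtain z where z: "z \<in> carrier W" "len z = root_depth \<beta>" "f0 (act z \<beta>) < 0" using root_depth_witness[OF \<beta>(1)] .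
  have tb: "act t \<beta> = \<beta> - (2 * B \<beta> (\<alpha> t)) *\<^sub>R \<alpha> t" using t form_sym[of "\<alpha> t" \<beta>] by (simp add: act_gen)
  show ?thesis
  proof (cases "f0 (act z (\<alpha> t)) < 0")
    case True
    have "act (z \<otimes> t) (act t \<beta>) = act z \<beta>" using z t by (simp add: act_mult act_gen_gen)
    then have "root_depth (act t \<beta>) \<le> len (z \<otimes> t)" using root_depth_le[of "z \<otimes> t"] z t by simp
    then show ?thesis using snoc_down(3)[OF z(1) t(1) True] z by simp
  next
    case False
    then have zt: "f0 (act z (\<alpha> t)) > 0" using f0_root_nonzero[of "act z (\<alpha> t)"] z t by (auto simp: roots_act)
    have "\<beta> \<in> inversions (inv z)" using z br pos_rootsD(2)[OF \<beta>(1)] by (intro inversionsI) auto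
    then obtain y q v where sp: "splits (inv z) \<beta> y q v" using split_exists z by (meson inv_closed)
    note s = splitsD[OF sp]
    define x where "x = inv y"
    have x: "x \<in> carrier W" "act x \<beta> = \<alpha> q" using s by (auto simp: x_def)
    have "len (inv z) = Suc (len y + len v)" using sp by (auto simp: splits_def)
    then have less: "len x < len z" using len_inv[of z] len_inv[of y] z s by (simp add: x_def)
    have xt: "f0 (act x (\<alpha> t)) > 0 \<or> f0 (act x (act t \<beta>)) < 0"
    proof (rule ccontr)
      assume n: "\<not> ?thesis"
      have "f0 (act x (\<alpha> t)) < 0" using n f0_root_nonzero[of "act x (\<alpha> t)"] x t by (auto simp: roots_act)
      then have "\<alpha> t \<in> inversions (inv x)" using x t f0_simple by (intro inversionsI) auto
      then have "\<alpha> t \<in> inversions (inv z)" using s by (auto simp: x_def)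
      then show False using zt z by (simp add: inversions_iff)
    qed
    have neg: "f0 (act x (act t \<beta>)) < 0 \<or> act x (act t \<beta>) \<in> pos_roots"
      using f0_root_nonzero[of "act x (act t \<beta>)"] x t br by (auto simp: roots_act pos_roots_iff)
    have "f0 (act x (act t \<beta>)) < 0"
    proof (rule ccontr)
      assume n: "\<not> ?thesis"
      then have p1: "act x (act t \<beta>) \<in> pos_roots" using neg by auto
      have p2: "act x (\<alpha> t) \<in> pos_roots" using xt n x t by (auto simp: pos_roots_iff roots_act)
      have "act x (act t \<beta>) = \<alpha> q - (2 * B \<beta> (\<alpha> t)) *\<^sub>R act x (\<alpha> t)"
        unfolding tb using x by (simp add: act_linear_simps)
      then have e: "(2 * B \<beta> (\<alpha> t)) *\<^sub>R act x (\<alpha> t) + 1 *\<^sub>R act x (act t \<beta>) = 1 *\<^sub>R \<alpha> q" by simp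
      have "act x (\<alpha> t) = \<alpha> q" using pos_roots_simple_extremal[OF p2 p1 _ _ e s(2)] t by simp
      then have "act x (\<alpha> t) = act x \<beta>" using x by simp
      then have "\<alpha> t = \<beta>" using x by (metis act_inv(1))
      then show False using \<beta> by simp
    qed
    then show ?thesis using root_depth_le[OF x(1)] less z by fastforce
  qed
qed

lemma wall_short:
  assumes "w \<in> carrier W" "t \<in> S" "f0 (act w (\<alpha> t)) < 0"
  shows "- act w (\<alpha> t) \<in> short_inversions w"
proof -
  have e: "act (w \<otimes> t) (\<alpha> t) = - act w (\<alpha> t)" using snoc_down(5)[OF assms] .
  have "reflection (- act w (\<alpha> t)) = w \<otimes> t \<otimes> t \<otimes> inv (w \<otimes> t)"
    unfolding e[symmetric] using reflection_eq assms by simp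
  also have "\<dots> = w \<otimes> inv (w \<otimes> t)" using assms by simp
  finally have "reflection (- act w (\<alpha> t)) \<otimes> w = w \<otimes> t"
    using assms by (simp add: inv_mult_group m_assoc)
  then show ?thesis using snoc_down(1,3)[OF assms] inversionsD[OF assms(1), of "- act w (\<alpha> t)"]
    by (simp add: short_inversions_def)
qed

lemma simple_pair_gens:
  assumes "q \<in> S" "t \<in> S" "\<alpha> q \<noteq> \<alpha> t" "- 1 < B (\<alpha> q) (\<alpha> t)"
  shows "simple_pair (\<alpha> q) (\<alpha> t)"
proof -
  have coh: "(0 \<le> x \<and> 0 \<le> y)" if r: "x *\<^sub>R \<alpha> q + y *\<^sub>R \<alpha> t \<in> pos_roots" for x y
  proof -
    have *: "0 \<le> y" if r: "x *\<^sub>R \<alpha> q + y *\<^sub>R \<alpha> t \<in> pos_roots" and qt: "q \<in> S" "t \<in> S" "\<alpha> q \<noteq> \<alpha> t" for x y q t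
    proof (rule ccontr)
      assume "\<not> 0 \<le> y"
      then have "(- y) *\<^sub>R \<alpha> t + 1 *\<^sub>R (x *\<^sub>R \<alpha> q + y *\<^sub>R \<alpha> t) = x *\<^sub>R \<alpha> q" "- y > 0" by auto
      from pos_roots_simple_extremal[OF simple_pos[OF qt(2)] r this(2) _ this(1) qt(1)] qt(3) show False by simp
    qed
    show ?thesis using *[OF r] *[of y t x q] assms r by (auto simp: add.commute)
  qed
  show ?thesis unfolding simple_pair_def
  proof (intro conjI allI impI)
    fix x y assume r: "x *\<^sub>R \<alpha> q + y *\<^sub>R \<alpha> t \<in> roots"
    have e: "- (x *\<^sub>R \<alpha> q + y *\<^sub>R \<alpha> t) = (- x) *\<^sub>R \<alpha> q + (- y) *\<^sub>R \<alpha> t" by simp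
    show "0 \<le> x \<and> 0 \<le> y \<or> x \<le> 0 \<and> y \<le> 0"
      using root_cases[OF r] coh[of x y] coh[of "- x" "- y"] unfolding e by auto
  qed (use assms in auto)
qed

text \<open>Subtract from \<open>f0\<close> its part carried by the plane. The coefficients
  \<open>x\<close> and \<open>y\<close> are nonnegative by the inverse Gram matrix, and the
  remaining simple roots have nonpositive form values with both generators, so on them the value
  does not fall below that of \<open>f0\<close>.\<close>

lemma residue_functional:
  assumes "q \<in> S" "t \<in> S" and sp: "simple_pair (\<alpha> q) (\<alpha> t)"
  obtains h :: "'v \<Rightarrow> real" where "linear h" "\<And>v. v \<in> plane (\<alpha> q) (\<alpha> t) \<Longrightarrow> h v = 0"
    "\<And>\<rho>. \<rho> \<in> pos_roots \<Longrightarrow> h \<rho> > 0 \<or> \<rho> \<in> plane (\<alpha> q) (\<alpha> t)"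
proof -
  note qt = simple_pairD[OF sp]
  define k where "k = - B (\<alpha> q) (\<alpha> t)"
  have k: "0 \<le> k" "k < 1" using qt by (auto simp: k_def)
  have k2: "1 - k\<^sup>2 > 0" using k by (simp add: abs_square_less_1)
  define x y where "x = (f0 (\<alpha> q) + k * f0 (\<alpha> t)) / (1 - k\<^sup>2)" and "y = (f0 (\<alpha> t) + k * f0 (\<alpha> q)) / (1 - k\<^sup>2)"
  have xy: "x \<ge> 0" "y \<ge> 0" using k k2 qt by (auto simp: x_def y_def)
  define h where "h v = f0 v - x * B (\<alpha> q) v - y * B (\<alpha> t) v" for v
  have lin: "linear h" by (rule linearI) (auto simp: h_def algebra_simps)
  have X: "x * (1 - k\<^sup>2) = f0 (\<alpha> q) + k * f0 (\<alpha> t)" "y * (1 - k\<^sup>2) = f0 (\<alpha> t) + k * f0 (\<alpha> q)"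
    using k2 by (auto simp: x_def y_def)
  have 1: "(x - k * y) * (1 - k\<^sup>2) = f0 (\<alpha> q) * (1 - k\<^sup>2)"
  proof -
    have "(x - k * y) * (1 - k\<^sup>2) = x * (1 - k\<^sup>2) - k * (y * (1 - k\<^sup>2))" by (simp add: algebra_simps)
    then show ?thesis unfolding X by (simp add: algebra_simps power2_eq_square)
  qed
  have 2: "(y - k * x) * (1 - k\<^sup>2) = f0 (\<alpha> t) * (1 - k\<^sup>2)"
  proof -
    have "(y - k * x) * (1 - k\<^sup>2) = y * (1 - k\<^sup>2) - k * (x * (1 - k\<^sup>2))" by (simp add: algebra_simps)
    then show ?thesis unfolding X by (simp add: algebra_simps power2_eq_square)
  qed
  have e: "x - k * y = f0 (\<alpha> q)" "y - k * x = f0 (\<alpha> t)" using 1 2 k2 by auto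
  have h0: "h (\<alpha> q) = 0" "h (\<alpha> t) = 0" using e qt by (auto simp: h_def k_def algebra_simps)
  have hp: "h v = 0" if "v \<in> plane (\<alpha> q) (\<alpha> t)" for v
    using that h0 lin by (auto simp: plane_def linear_add linear_scale)
  have 0: "0 \<in> plane (\<alpha> q) (\<alpha> t)" using planeI[of 0 "\<alpha> q" 0 "\<alpha> t"] by simp
  have hs: "h (\<alpha> s) > 0 \<or> \<alpha> s \<in> plane (\<alpha> q) (\<alpha> t)" if s: "s \<in> S" for s
  proof (cases "s = q \<or> s = t")
    case True then show ?thesis by auto
  next
    case False
    then have "x * B (\<alpha> q) (\<alpha> s) \<le> 0" "y * B (\<alpha> t) (\<alpha> s) \<le> 0"
      using xy form_neq_le0[of q s] form_neq_le0[of t s] assms s by (auto simp: mult_nonneg_nonpos)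
    then show ?thesis using f0_simple[OF s] by (simp add: h_def)
  qed
  let ?K = "{v. h v > 0 \<or> v \<in> plane (\<alpha> q) (\<alpha> t)}"
  have "convex_cone ?K"
  proof (subst convex_cone_iff, intro conjI ballI allI impI)
    show "0 \<in> ?K" using 0 by simp
    fix u v assume "u \<in> ?K" "v \<in> ?K"
    then show "u + v \<in> ?K" using hp[of u] hp[of v] plane_add[of u "\<alpha> q" "\<alpha> t" v] lin
      by (auto simp: linear_add)
  next
    fix v and c :: real assume "v \<in> ?K" "0 \<le> c"
    then show "c *\<^sub>R v \<in> ?K" using plane_scale[of v "\<alpha> q" "\<alpha> t" c] 0 lin
      by (cases "c = 0") (auto simp: linear_scale)
  qed
  then have "convex_cone hull simple_roots \<subseteq> ?K" using hs
    by (intro hull_minimal) (auto simp: simple_roots_def)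
  then have "h \<rho> > 0 \<or> \<rho> \<in> plane (\<alpha> q) (\<alpha> t)" if "\<rho> \<in> pos_roots" for \<rho> using pos_cone[OF that] by auto
  then show ?thesis using that lin hp by blast
qed

text \<open>\<open>\<beta>\<close> and \<open>\<gamma> = - act v (\<alpha> t)\<close> are the simple
  roots of a finite plane. Let \<open>\<rho>\<close> be the last inversion of \<open>w\<close> in
  this plane along a reduced word. It is short, since a decomposition would need a later inversion
  in the plane. It is not \<open>\<gamma>\<close>, which \<open>w\<close> does not invert, so it is
  at least as deep as \<open>\<beta>\<close>.\<close>

lemma short_wall_of_residue:
  assumes w: "w \<in> carrier W" and \<beta>: "\<beta> \<in> short_inversions w"
    and v: "v \<in> carrier W" "inversions w \<subseteq> inversions v"
    and qt: "q \<in> S" "t \<in> S" "act v (\<alpha> q) = - \<beta>" "f0 (act v (\<alpha> t)) < 0" "- act v (\<alpha> t) \<notin> inversions w"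
    and neg: "\<And>\<gamma>. \<gamma> \<in> inversions v \<Longrightarrow> \<gamma> \<notin> inversions w \<Longrightarrow> B \<beta> \<gamma> < 0"
  shows "\<exists>\<rho> \<in> short_inversions w. \<rho> \<noteq> \<beta> \<and> dominance_depth \<beta> \<le> dominance_depth \<rho> \<and>
    (\<forall>y \<in> carrier W. inversions y \<subseteq> inversions w \<longrightarrow> \<rho> \<in> inversions y \<longrightarrow> \<beta> \<in> inversions y)"
proof -
  have bw: "\<beta> \<in> inversions w" using short_inversions_subset[OF w] \<beta> by blast
  note bd = inversionsD[OF w bw]
  define \<gamma> where "\<gamma> = - act v (\<alpha> t)"
  have gv: "\<gamma> \<in> inversions v" using snoc_down(1)[OF v(1) qt(2,4)] by (simp add: \<gamma>_def)
  note gd = inversionsD[OF v(1) gv]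
  have gw: "\<gamma> \<notin> inversions w" using qt(5) by (simp add: \<gamma>_def)
  have iv: "inv v \<in> carrier W" using v by simp
  have ivb: "act (inv v) \<beta> = - \<alpha> q"
  proof -
    have "act (inv v) (- \<beta>) = \<alpha> q" unfolding qt(3)[symmetric] using v by simp
    then show ?thesis using act_linear_simps(3)[OF iv, of \<beta>] by (metis minus_minus)
  qed
  have ivg: "act (inv v) \<gamma> = - \<alpha> t" using v by (simp add: \<gamma>_def act_linear_simps(3)[OF iv])
  have Bbg: "B \<beta> \<gamma> = B (\<alpha> q) (\<alpha> t)"
    using form_invariant[OF iv, of \<beta> \<gamma>] unfolding ivb ivg by simp
  have ne: "\<alpha> q \<noteq> \<alpha> t" using qt gw bw by (auto simp: \<gamma>_def)
  have vq: "f0 (act v (\<alpha> q)) < 0" using bd by (simp add: qt(3))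
  have "- 1 < B (\<alpha> q) (\<alpha> t)"
  proof (rule ccontr)
    assume "\<not> - 1 < B (\<alpha> q) (\<alpha> t)"
    then have k: "- B (\<alpha> q) (\<alpha> t) \<ge> 1" by simp
    have "- B (\<alpha> q) (\<alpha> t) * f0 (act v (\<alpha> q)) < 0" using k vq by (intro mult_pos_neg) auto
    then have le: "f0 (act v (\<alpha> t)) + - B (\<alpha> q) (\<alpha> t) * f0 (act v (\<alpha> q)) \<le> 0" using qt(4) by linarith
    show False
      by (rule no_common_negative[OF _ _ _ _ k _ v(1) vq le]) (use qt f0_simple in auto)
  qed
  then have sp0: "simple_pair (\<alpha> q) (\<alpha> t)" using simple_pair_gens qt ne by simp
  let ?P = "plane (\<alpha> q) (\<alpha> t)"
  have sp: "simple_pair \<beta> \<gamma>"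
    unfolding simple_pair_def
  proof (intro conjI allI impI)
    show "\<beta> \<noteq> \<gamma>" using bw gw by auto
    fix x y assume "x *\<^sub>R \<beta> + y *\<^sub>R \<gamma> \<in> roots"
    then have "- act (inv v) (x *\<^sub>R \<beta> + y *\<^sub>R \<gamma>) \<in> roots" using iv by (intro roots_uminus roots_act)
    then have "x *\<^sub>R \<alpha> q + y *\<^sub>R \<alpha> t \<in> roots" by (simp add: act_linear_simps[OF iv] ivb ivg add.commute)
    then show "0 \<le> x \<and> 0 \<le> y \<or> x \<le> 0 \<and> y \<le> 0" by (rule simple_pairD(12)[OF sp0])
  qed (use bd gd Bbg simple_pairD[OF sp0] in auto)
  obtain h :: "'v \<Rightarrow> real" where h: "linear h" "\<And>v. v \<in> ?P \<Longrightarrow> h v = 0" "\<And>\<rho>. \<rho> \<in> pos_roots \<Longrightarrow> h \<rho> > 0 \<or> \<rho> \<in> ?P"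
    using residue_functional[OF qt(1,2) sp0] by metis
  \<comment> \<open>\<open>g\<close> is nonnegative on the inversions of \<open>w\<close> and
    vanishes there only in the plane. So if a positive combination of two inversions lies in the
    plane, both of them do.\<close>
  define g where "g x = h (- act (inv v) x)" for x
  have g_lin: "g (x *\<^sub>R a + z *\<^sub>R b) = x * g a + z * g b" for x z a b
    unfolding g_def by (simp add: act_linear_simps[OF iv] linear_add[OF h(1)] linear_diff[OF h(1)]
      linear_neg[OF h(1)] linear_scale[OF h(1)])
  have P_iff: "- act (inv v) x \<in> ?P \<longleftrightarrow> x \<in> plane \<beta> \<gamma>" for x
  proof
    assume "- act (inv v) x \<in> ?P"
    then obtain c d where cd: "- act (inv v) x = c *\<^sub>R \<alpha> q + d *\<^sub>R \<alpha> t" by (auto simp: plane_def)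
    have "x = act v (act (inv v) x)" using v by simp
    also have "act (inv v) x = - (c *\<^sub>R \<alpha> q + d *\<^sub>R \<alpha> t)" using cd by (metis minus_minus)
    also have "act v \<dots> = c *\<^sub>R \<beta> + d *\<^sub>R \<gamma>" using v by (simp add: act_linear_simps qt(3) \<gamma>_def)
    finally show "x \<in> plane \<beta> \<gamma>" using planeI by metis
  next
    assume "x \<in> plane \<beta> \<gamma>"
    then obtain c d where "x = c *\<^sub>R \<beta> + d *\<^sub>R \<gamma>" by (auto simp: plane_def)
    then have "- act (inv v) x = c *\<^sub>R \<alpha> q + d *\<^sub>R \<alpha> t" by (simp add: act_linear_simps[OF iv] ivb ivg)
    then show "- act (inv v) x \<in> ?P" using planeI by metis
  qed
  have g_pos: "g \<rho> \<ge> 0 \<and> (g \<rho> = 0 \<longrightarrow> \<rho> \<in> plane \<beta> \<gamma>)" if "\<rho> \<in> inversions w" for \<rho>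
  proof -
    have "\<rho> \<in> inversions v" using that v by blast
    then have "- act (inv v) \<rho> \<in> pos_roots" using inversionsD[OF v(1)] iv
      by (simp add: pos_roots_iff roots_uminus roots_act)
    then show ?thesis using h(3)[of "- act (inv v) \<rho>"] h(2)[of "- act (inv v) \<rho>"] P_iff[of \<rho>]
      by (auto simp: g_def)
  qed
  have g0: "g \<rho> = 0" if "\<rho> \<in> plane \<beta> \<gamma>" for \<rho> using h(2) P_iff that by (simp add: g_def)
  obtain pos :: "'v \<Rightarrow> nat" where pos: "inj_on pos (inversions w)"
    "\<forall>\<beta> \<in> inversions w. \<exists>y q v. splits w \<beta> y q v \<and> inversions y = {\<gamma> \<in> inversions w. pos \<gamma> < pos \<beta>}"
    using inversion_enumeration[OF w] by (elim exE conjE)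
  define R where "R = inversions w \<inter> plane \<beta> \<gamma>"
  have finR: "finite R" using w by (simp add: R_def)
  have bR: "\<beta> \<in> R" using bw by (simp add: R_def)
  have "Max (pos ` R) \<in> pos ` R" using finR bR by (intro Max_in) auto
  then obtain \<rho> where \<rho>: "\<rho> \<in> R" "pos \<rho> = Max (pos ` R)" by auto
  have max: "pos x \<le> pos \<rho>" if "x \<in> R" for x using \<rho>(2) finR that by simp
  have rw: "\<rho> \<in> inversions w" and rp: "\<rho> \<in> plane \<beta> \<gamma>" using \<rho> by (auto simp: R_def)
  have rpos: "\<rho> \<in> pos_roots" using inversionsD[OF w rw] by simp
  have short: "\<rho> \<in> short_inversions w"
  proof (rule ccontr)
    assume ns: "\<rho> \<notin> short_inversions w"
    obtain y s u where y: "splits w \<rho> y s u" "inversions y = {\<gamma> \<in> inversions w. pos \<gamma> < pos \<rho>}"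
      using bspec[OF pos(2) rw] by (elim exE conjE)
    obtain a b x z where ab: "a \<in> inversions y" "b \<in> inversions w" "x > 0" "z > 0" "\<rho> = x *\<^sub>R a + z *\<^sub>R b"
      "b \<notin> insert \<rho> (inversions y)" using nonshort_decomp[OF y(1) ns] .
    have aw: "a \<in> inversions w" using ab(1) y(2) by blast
    have "x * g a + z * g b = 0" using g0[OF rp] g_lin[of x a z b] ab(5) by simp
    moreover have "x * g a \<ge> 0" "z * g b \<ge> 0" using g_pos[OF aw] g_pos[OF ab(2)] ab by auto
    ultimately have "z * g b = 0" by linarith
    then have "b \<in> R" using g_pos[OF ab(2)] ab by (auto simp: R_def)
    then have "pos b \<le> pos \<rho>" by (rule max)
    then have "pos b < pos \<rho>" using ab(2,6) rw inj_onD[OF pos(1), of b \<rho>] by (auto simp: less_le)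
    then show False using ab(2,6) y(2) by blast
  qed
  have g_not: "f0 (act (inv y) \<gamma>) > 0" if "y \<in> carrier W" "inversions y \<subseteq> inversions w" for y
  proof -
    have "\<gamma> \<notin> inversions y" using gw that by blast
    then show ?thesis using that gd f0_root_nonzero[of "act (inv y) \<gamma>"]
      by (auto simp: inversions_iff roots_act)
  qed
  have before: "\<beta> \<in> inversions y"
    if y: "y \<in> carrier W" "inversions y \<subseteq> inversions w" "x \<in> inversions y" "x \<in> plane \<beta> \<gamma>" for x y
  proof (rule ccontr)
    assume n: "\<beta> \<notin> inversions y"
    have xp: "x \<in> pos_roots" using inversionsD[OF y(1,3)] by simp
    obtain c d where cd: "c \<ge> 0" "d \<ge> 0" "x = c *\<^sub>R \<beta> + d *\<^sub>R \<gamma>" using simple_pair_coords[OF sp xp y(4)] .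
    have "\<gamma> \<in> inversions y"
      using inversions_combination(2)[OF y(1) cd(3) xp cd(1,2) bd(3) gd(3) y(3) n] .
    then show False using g_not[OF y(1,2)] y(1) by (simp add: inversions_iff)
  qed
  \<comment> \<open>If \<open>\<beta>\<close> came last, the root
    \<open>reflect \<beta> \<gamma>\<close>, which pairs positively with \<open>\<beta>\<close> and
    hence is inverted by \<open>w\<close>, would come earlier. But a prefix inverting it and not
    \<open>\<gamma>\<close> inverts \<open>\<beta>\<close>.\<close>
  have rb: "\<rho> \<noteq> \<beta>"
  proof
    assume e: "\<rho> = \<beta>"
    define \<eta> where "\<eta> = reflect \<beta> \<gamma>"
    have ep: "\<eta> \<in> plane \<beta> \<gamma>" unfolding \<eta>_def by (intro plane_reflect) auto
    have Bneg: "B \<beta> \<gamma> < 0" using neg[OF gv gw] .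
    have eta: "\<eta> = (- 2 * B \<beta> \<gamma>) *\<^sub>R \<beta> + 1 *\<^sub>R \<gamma>" by (simp add: \<eta>_def reflect_def)
    have epos: "\<eta> \<in> pos_roots" unfolding \<eta>_def using reflect_pos[OF gd(3) bd(3)] Bneg by simp
    have bv: "\<beta> \<in> inversions v" using bw v by blast
    have ev: "\<eta> \<in> inversions v"
      by (rule inversions_combination(1)[OF v(1) eta epos _ _ bd(3) gd(3) bv gv]) (use Bneg in auto)
    have Be: "B \<beta> \<eta> = - B \<beta> \<gamma>" unfolding eta using root_unit[OF bd(1)] by simp
    then have ew: "\<eta> \<in> inversions w" using neg[OF ev] Bneg by fastforce
    then have eR: "\<eta> \<in> R" using ep by (simp add: R_def)
    have "\<eta> \<noteq> \<beta>" using Be root_unit[OF bd(1)] simple_pairD(10)[OF sp] by auto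
    then have lt: "pos \<eta> < pos \<beta>" using max[OF eR] e ew bw inj_onD[OF pos(1), of \<eta> \<beta>] by (auto simp: less_le)
    obtain y s u where y: "splits w \<beta> y s u" "inversions y = {\<gamma> \<in> inversions w. pos \<gamma> < pos \<beta>}"
      using bspec[OF pos(2) bw] by (elim exE conjE)
    have "\<beta> \<in> inversions y"
      by (rule before[OF splitsD(1)[OF y(1)] _ _ ep]) (use y(2) ew lt in auto)
    then show False using splitsD(11)[OF y(1)] by simp
  qed
  have "\<rho> \<noteq> \<gamma>" using rw gw by auto
  then have "dominance_depth \<beta> \<le> dominance_depth \<rho>" using dominance_depth_simple_le[OF sp rpos rp] by simp
  then show ?thesis using short rb before[OF _ _ _ rp] by blast
qed

text \<open>
  Lengthen \<open>w\<close> to \<open>v\<close> by walls whose form value with \<open>\<beta>\<close> is negative; then \<open>\<beta>\<close> remains short, and the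
  depth of \<open>- v\<^sup>-\<^sup>1 \<beta>\<close> drops.  This stops when \<open>\<beta>\<close> becomes a wall of \<open>v\<close>, or when some wall of \<open>v\<close> whose
  form value with \<open>\<beta>\<close> is positive is already an inversion of \<open>w\<close>.
\<close>
lemma short_inversion_successor:
  assumes w: "w \<in> carrier W" and \<beta>: "\<beta> \<in> short_inversions w"
    and nw: "\<And>t. t \<in> S \<Longrightarrow> f0 (act w (\<alpha> t)) < 0 \<Longrightarrow> \<beta> \<noteq> - act w (\<alpha> t)"
  shows "\<exists>\<rho> \<in> short_inversions w. \<rho> \<noteq> \<beta> \<and> dominance_depth \<beta> \<le> dominance_depth \<rho> \<and>
    (\<forall>y \<in> carrier W. inversions y \<subseteq> inversions w \<longrightarrow> \<rho> \<in> inversions y \<longrightarrow> \<beta> \<in> inversions y)"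
proof -
  have bw: "\<beta> \<in> inversions w" using short_inversions_subset[OF w] \<beta> by blast
  note bd = inversionsD[OF w bw]
  have main: ?thesis
    if "v \<in> carrier W" "inversions w \<subseteq> inversions v" "\<beta> \<in> short_inversions v"
      "\<And>\<gamma>. \<gamma> \<in> inversions v \<Longrightarrow> \<gamma> \<notin> inversions w \<Longrightarrow> B \<beta> \<gamma> < 0"
      "short_inversions v \<inter> inversions w \<subseteq> short_inversions w"
      "\<And>t. t \<in> S \<Longrightarrow> - act (inv v) \<beta> \<noteq> \<alpha> t" for v
    using that
  proof (induction "root_depth (- act (inv v) \<beta>)" arbitrary: v rule: less_induct)
    case less
    note v = less.prems
    have iv: "inv v \<in> carrier W" using v by simp
    let ?b = "- act (inv v) \<beta>"
    have bv: "\<beta> \<in> inversions v" using bw v(2) by blast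
    have bp: "?b \<in> pos_roots" using inversionsD[OF v(1) bv] iv
      by (simp add: pos_roots_iff roots_uminus roots_act)
    have vb: "act v ?b = - \<beta>" using v(1) by (simp add: act_linear_simps)
    \<comment> \<open>A positive root has norm one, so it pairs positively with some simple
      root.\<close>
    have "\<exists>t \<in> S. B ?b (\<alpha> t) > 0"
    proof (rule ccontr)
      assume n: "\<not> ?thesis"
      have "- B ?b ?b \<ge> 0"
      proof (rule pos_root_nonneg[OF _ _ bp, where \<phi> = "\<lambda>x. - B ?b x"])
        show "linear (\<lambda>x. - B ?b x)" by (rule linearI) auto
        show "0 \<le> - B ?b (\<alpha> s)" if "s \<in> S" for s using n that by (meson neg_0_le_iff_le not_le)
      qed
      then show False using root_unit[OF pos_rootsD(1)[OF bp]] by simp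
    qed
    then obtain t where t: "t \<in> S" "B ?b (\<alpha> t) > 0" by blast
    have Bt: "B \<beta> (act v (\<alpha> t)) = - B ?b (\<alpha> t)"
      using form_invariant[OF v(1), of ?b "\<alpha> t"] unfolding vb by simp
    show ?case
    proof (cases "f0 (act v (\<alpha> t)) < 0")
      case True
      define \<gamma> where "\<gamma> = - act v (\<alpha> t)"
      have Bg: "B \<beta> \<gamma> > 0" using Bt t by (simp add: \<gamma>_def)
      have gs: "\<gamma> \<in> short_inversions v" using wall_short[OF v(1) t(1) True] by (simp add: \<gamma>_def)
      then have gv: "\<gamma> \<in> inversions v" using short_inversions_subset[OF v(1)] by blast
      then have gw: "\<gamma> \<in> inversions w" using v(4)[of \<gamma>] Bg by force
      have ne: "\<beta> \<noteq> \<gamma>"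
      proof
        assume "\<beta> = \<gamma>"
        then have "?b = \<alpha> t" using v(1) by (simp add: \<gamma>_def act_linear_simps(3)[OF iv])
        then show False using v(6)[OF t(1)] by simp
      qed
      note sb = short_before_wall[OF v(1) t(1) True \<gamma>_def v(3) ne Bg]
      have "\<forall>y \<in> carrier W. inversions y \<subseteq> inversions w \<longrightarrow> \<gamma> \<in> inversions y \<longrightarrow> \<beta> \<in> inversions y"
        using sb(2) v(2) by (meson order_trans)
      moreover have "\<gamma> \<in> short_inversions w" using gs gw v(5) by blast
      ultimately show ?thesis using sb(1) ne by metis
    next
      case False
      then have up: "f0 (act v (\<alpha> t)) > 0" using f0_root_nonzero[of "act v (\<alpha> t)"] v t by (auto simp: roots_act)
      let ?v = "v \<otimes> t"
      define \<gamma> where "\<gamma> = act v (\<alpha> t)"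
      have Bg: "B \<beta> \<gamma> < 0" using Bt t by (simp add: \<gamma>_def)
      have vt: "?v \<in> carrier W" using v t by simp
      have iv1: "inversions ?v = insert \<gamma> (inversions v)" "\<gamma> \<notin> inversions v"
        using inversions_snoc[OF v(1) t(1) up] by (auto simp: \<gamma>_def)
      have gw: "\<gamma> \<notin> inversions w" using iv1 v(2) by blast
      have s1: "\<beta> \<in> short_inversions ?v"
        using short_snoc_up[OF v(1) t(1) up v(3)] Bg by (simp add: \<gamma>_def)
      have n1: "B \<beta> \<delta> < 0" if "\<delta> \<in> inversions ?v" "\<delta> \<notin> inversions w" for \<delta>
        using that iv1 v(4) Bg by auto
      have vtg: "act ?v (\<alpha> t) = - \<gamma>" using v t by (simp add: act_mult act_gen_self act_linear_simps \<gamma>_def)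
      have dn: "f0 (act ?v (\<alpha> t)) < 0" unfolding vtg using up by (simp add: \<gamma>_def)
      have r1: "short_inversions ?v \<inter> inversions w \<subseteq> short_inversions w"
      proof
        fix \<delta> assume d: "\<delta> \<in> short_inversions ?v \<inter> inversions w"
        then have "\<delta> \<noteq> - act ?v (\<alpha> t)" using gw vtg by auto
        then have "\<delta> \<in> short_inversions (?v \<otimes> t)" using short_snoc_down[OF vt t(1) dn] d by blast
        then show "\<delta> \<in> short_inversions w" using d v t by auto
      qed
      have b1: "- act (inv ?v) \<beta> = act t ?b"
        using v t by (simp add: act_inv_mult act_linear_simps)
      have sub1: "inversions w \<subseteq> inversions ?v" using v(2) iv1 by blast
      show ?thesis
      proof (cases "\<exists>q \<in> S. act t ?b = \<alpha> q")
        case True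
        then obtain q where q: "q \<in> S" "act t ?b = \<alpha> q" by blast
        have "act ?v (\<alpha> q) = act v (act t (act t ?b))" using v t q by (simp add: act_mult)
        also have "\<dots> = - \<beta>" using t vb by (simp add: act_gen_gen)
        finally show ?thesis
          using short_wall_of_residue[OF w \<beta> vt sub1 q(1) t(1) _ dn _ n1] vtg gw by simp
      next
        case nq: False
        have "root_depth (act t ?b) < root_depth ?b"
          using root_depth_gen[OF bp v(6)[OF t(1)] t] .
        then show ?thesis
          using less.hyps[of ?v] vt sub1 s1 n1 r1 nq unfolding b1 by metis
      qed
    qed
  qed
  show ?thesis
  proof (rule main[OF w order_refl \<beta>])
    fix t assume t: "t \<in> S"
    show "- act (inv w) \<beta> \<noteq> \<alpha> t"
    proof
      assume e: "- act (inv w) \<beta> = \<alpha> t"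
      then have "act w (\<alpha> t) = - \<beta>" unfolding e[symmetric] using w by (simp add: act_linear_simps)
      then show False using nw[OF t] bd by simp
    qed
  qed auto
qed

section \<open>Low elements and elements of minimal length\<close>

lemma small_roots_pos: "\<beta> \<in> small_roots m \<Longrightarrow> \<beta> \<in> pos_roots"
  by (simp add: small_roots_def)

text \<open>Take the last non-small short inversion along a reduced word. It is no wall, so it has a
  successor at least as deep, hence also non-small, and produced later: a contradiction.\<close>

lemma low_if_walls_small:
  assumes w: "w \<in> carrier W"
    and walls: "\<And>t. t \<in> S \<Longrightarrow> f0 (act w (\<alpha> t)) < 0 \<Longrightarrow> - act w (\<alpha> t) \<in> small_roots m"
  shows "w \<in> low_elements m"
proof (rule ccontr)
  assume "w \<notin> low_elements m"
  then have ne: "short_inversions w - small_roots m \<noteq> {}" using w by (auto simp: low_elements_def)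
  let ?D = "short_inversions w - small_roots m"
  have sub: "short_inversions w \<subseteq> inversions w" by (rule short_inversions_subset[OF w])
  then have fin: "finite ?D" using w by (meson finite_Diff finite_inversions finite_subset)
  obtain pos :: "'v \<Rightarrow> nat" where pos: "inj_on pos (inversions w)"
    "\<forall>\<beta> \<in> inversions w. \<exists>y q v. splits w \<beta> y q v \<and> inversions y = {\<gamma> \<in> inversions w. pos \<gamma> < pos \<beta>}"
    using inversion_enumeration[OF w] by (elim exE conjE)
  have "Max (pos ` ?D) \<in> pos ` ?D" using fin ne by (intro Max_in) auto
  then obtain \<beta> where \<beta>: "\<beta> \<in> ?D" "pos \<beta> = Max (pos ` ?D)" by force
  have "\<beta> \<noteq> - act w (\<alpha> t)" if "t \<in> S" "f0 (act w (\<alpha> t)) < 0" for t using walls[OF that] \<beta>(1) by auto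
  then obtain \<rho> where \<rho>: "\<rho> \<in> short_inversions w" "\<rho> \<noteq> \<beta>" "dominance_depth \<beta> \<le> dominance_depth \<rho>"
    "\<forall>y \<in> carrier W. inversions y \<subseteq> inversions w \<longrightarrow> \<rho> \<in> inversions y \<longrightarrow> \<beta> \<in> inversions y"
    using short_inversion_successor[OF w] \<beta>(1) by blast
  have rw: "\<rho> \<in> inversions w" using \<rho>(1) sub by blast
  have bp: "\<beta> \<in> pos_roots" using \<beta>(1) by (auto simp: short_inversions_def)
  have "\<rho> \<notin> small_roots m"
  proof
    assume "\<rho> \<in> small_roots m"
    then have "dominance_depth \<rho> \<le> enat m" by (simp add: small_roots_def)
    then have "\<beta> \<in> small_roots m" using \<rho>(3) bp by (simp add: small_roots_def)
    then show False using \<beta>(1) by simp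
  qed
  then have rD: "\<rho> \<in> ?D" using \<rho>(1) by simp
  obtain y q v where y: "splits w \<rho> y q v" "inversions y = {\<gamma> \<in> inversions w. pos \<gamma> < pos \<rho>}"
    using bspec[OF pos(2) rw] by (elim exE conjE)
  note s = splitsD[OF y(1)]
  have "inversions (y \<otimes> q) \<subseteq> inversions w" unfolding s(10) s(12) by blast
  then have "\<beta> \<in> inversions (y \<otimes> q)" using bspec[OF \<rho>(4), of "y \<otimes> q"] s(1,2,10) by simp
  then have "pos \<beta> < pos \<rho>" using s(10) y(2) \<rho>(2) by auto
  then show False using \<beta>(2) fin rD by (simp add: not_le[symmetric])
qed

text \<open>Crossing a wall that is not small shortens the element without changing its small
  inversions.\<close>

lemma min_class_low:
  assumes w: "w \<in> carrier W"
    and min: "\<And>u. u \<in> carrier W \<Longrightarrow> small_roots m \<inter> inversions u = small_roots m \<inter> inversions w \<Longrightarrow> len w \<le> len u"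
  shows "w \<in> low_elements m"
proof (rule low_if_walls_small[OF w])
  fix t assume t: "t \<in> S" "f0 (act w (\<alpha> t)) < 0"
  note d = snoc_down[OF w t]
  show "- act w (\<alpha> t) \<in> small_roots m"
  proof (rule ccontr)
    assume "- act w (\<alpha> t) \<notin> small_roots m"
    then have "small_roots m \<inter> inversions (w \<otimes> t) = small_roots m \<inter> inversions w" using d(1) by auto
    then have "len w \<le> len (w \<otimes> t)" using min w t by simp
    then show False using d(3) by simp
  qed
qed

lemma low_class_min:
  assumes w: "w \<in> low_elements m" and u: "u \<in> carrier W"
    and eq: "small_roots m \<inter> inversions u = small_roots m \<inter> inversions w"
  shows "inversions w \<subseteq> inversions u"
proof (rule inversions_subset_if_short_subset)
  show wW: "w \<in> carrier W" using w by (simp add: low_elements_def)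
  have "short_inversions w \<subseteq> small_roots m \<inter> inversions w"
    using w short_inversions_subset[OF wW] by (auto simp: low_elements_def)
  then show "short_inversions w \<subseteq> inversions u" using eq by blast
qed (rule u)

subsection \<open>Regions of the Tits cone\<close>
lemma fund_chamber_pos:
  assumes f: "f \<in> fund_chamber" and \<beta>: "\<beta> \<in> pos_roots"
  shows "f \<beta> > 0"
proof (rule cone_hull_pos[OF _ _ pos_cone[OF \<beta>]])
  show "\<beta> \<noteq> 0" using root_nonzero pos_rootsD(1)[OF \<beta>] by blast
qed (use f in \<open>auto simp: fund_chamber_def\<close>)

lemma closed_fund_chamber_nonneg:
  assumes f: "f \<in> closed_fund_chamber" and \<beta>: "\<beta> \<in> pos_roots"
  shows "f \<beta> \<ge> 0"
  by (rule cone_hull_nonneg[OF _ _ pos_cone[OF \<beta>]]) (use f in \<open>auto simp: closed_fund_chamber_def\<close>)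

lemma linear_dual_act: "w \<in> carrier W \<Longrightarrow> linear f \<Longrightarrow> linear (dual_act w f)"
  unfolding dual_act_def using linear_compose[of "act (inv w)" f] act_linear[of "inv w"] by (simp add: o_def)

lemma dual_act_mult:
  "u \<in> carrier W \<Longrightarrow> w \<in> carrier W \<Longrightarrow> dual_act (u \<otimes> w) f = dual_act u (dual_act w f)"
  by (simp add: dual_act_def act_inv_mult)

lemma dual_act_inv: "w \<in> carrier W \<Longrightarrow> dual_act w (dual_act (inv w) f) = f"
  by (simp add: dual_act_def)

lemma dual_act_negative:
  assumes w: "w \<in> carrier W" and f: "linear f" "\<And>\<beta>. \<beta> \<in> pos_roots \<Longrightarrow> f \<beta> \<ge> 0"
    and \<beta>: "\<beta> \<in> pos_roots" "dual_act w f \<beta> < 0"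
  shows "\<beta> \<in> inversions w"
proof -
  have iv: "inv w \<in> carrier W" using w by simp
  have r: "act (inv w) \<beta> \<in> roots" using roots_act[OF iv] pos_rootsD[OF \<beta>(1)] by simp
  have "act (inv w) \<beta> \<notin> pos_roots" using f(2) \<beta>(2) by (force simp: dual_act_def)
  then have "f0 (act (inv w) \<beta>) < 0" using r f0_root_nonzero[OF r] by (auto simp: pos_roots_iff)
  then show ?thesis using w \<beta>(1) by (simp add: inversions_iff)
qed

lemma linear_tits_cone: "f \<in> tits_cone \<Longrightarrow> linear f"
  unfolding tits_cone_def closed_fund_chamber_def by (auto intro: linear_dual_act)

text \<open>A point on walls lies in several closed chambers. Roots vanishing there may or may not
  be inversions of the chosen element, hence one strict and one weak inequality.\<close>

lemma tits_cone_negative_inversions: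
  assumes "f \<in> tits_cone"
  obtains w where "w \<in> carrier W" "\<And>\<beta>. \<beta> \<in> pos_roots \<Longrightarrow> f \<beta> < 0 \<Longrightarrow> \<beta> \<in> inversions w"
    "\<And>\<beta>. \<beta> \<in> pos_roots \<Longrightarrow> \<beta> \<in> inversions w \<Longrightarrow> f \<beta> \<le> 0"
proof -
  obtain w g where w: "w \<in> carrier W" "g \<in> closed_fund_chamber" "f = dual_act w g"
    using assms by (auto simp: tits_cone_def)
  have g: "linear g" "\<And>\<beta>. \<beta> \<in> pos_roots \<Longrightarrow> g \<beta> \<ge> 0"
    using closed_fund_chamber_nonneg[OF w(2)] w(2) by (simp_all add: closed_fund_chamber_def)
  show ?thesis
  proof (rule that[OF w(1)])
    fix \<beta> assume b: "\<beta> \<in> pos_roots"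
    show "\<beta> \<in> inversions w" if "f \<beta> < 0"
      using dual_act_negative[OF w(1) g b] that w(3) by simp
    show "f \<beta> \<le> 0" if n: "\<beta> \<in> inversions w"
    proof -
      have iv: "inv w \<in> carrier W" using w by simp
      have "- act (inv w) \<beta> \<in> pos_roots"
        using inversionsD(4)[OF w(1) n] roots_uminus roots_act[OF iv] pos_rootsD(1)[OF b] by (simp add: pos_roots_iff)
      then have "g (- act (inv w) \<beta>) \<ge> 0" by (rule g(2))
      then show ?thesis unfolding w(3) dual_act_def using linear_neg[OF g(1)] by simp
    qed
  qed
qed

text \<open>A simple reflection \<open>s\<close> with \<open>f (\<alpha> s) < 0\<close> permutes the
  positive roots other than \<open>\<alpha> s\<close> and makes the value at
  \<open>\<alpha> s\<close> positive, so fewer positive roots have negative value.\<close>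

lemma tits_cone_if_finite_negative:
  assumes "linear f" "finite {\<beta> \<in> pos_roots. f \<beta> < 0}"
  shows "f \<in> tits_cone"
  using assms
proof (induction "card {\<beta> \<in> pos_roots. f \<beta> < 0}" arbitrary: f rule: less_induct)
  case less
  show ?case
  proof (cases "\<exists>s \<in> S. f (\<alpha> s) < 0")
    case False
    then have "f \<in> closed_fund_chamber"
      using less.prems by (auto simp: closed_fund_chamber_def simple_roots_def not_less)
    then show ?thesis unfolding tits_cone_def
      by (auto intro!: bexI[of _ \<one>] image_eqI[of _ _ f] simp: dual_act_def act_one)
  next
    case True
    then obtain s where s: "s \<in> S" "f (\<alpha> s) < 0" by blast
    let ?g = "dual_act s f"
    let ?N = "{\<beta> \<in> pos_roots. f \<beta> < 0}"
    have g: "?g \<beta> = f (act s \<beta>)" for \<beta> using s by (simp add: dual_act_def)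
    have sub: "{\<beta> \<in> pos_roots. ?g \<beta> < 0} \<subseteq> act s ` (?N - {\<alpha> s})"
    proof
      fix \<beta> assume b: "\<beta> \<in> {\<beta> \<in> pos_roots. ?g \<beta> < 0}"
      have ne: "\<beta> \<noteq> \<alpha> s"
      proof
        assume "\<beta> = \<alpha> s"
        then have "?g \<beta> = - f (\<alpha> s)" using s linear_neg[OF less.prems(1)] by (simp add: g act_gen_self)
        then show False using b s by simp
      qed
      have "act s \<beta> \<in> pos_roots" using gen_pos[OF s(1) _ ne] b by simp
      moreover have "act s \<beta> \<noteq> \<alpha> s"
        using gen_pos_iff[OF s(1) calculation] b s by (auto simp: act_gen_gen)
      ultimately have "act s \<beta> \<in> ?N - {\<alpha> s}" using b by (simp add: g)
      then show "\<beta> \<in> act s ` (?N - {\<alpha> s})" using act_gen_gen[OF s(1), of \<beta>] by (metis imageI)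
    qed
    have fin: "finite (?N - {\<alpha> s})" using less.prems by simp
    have "card {\<beta> \<in> pos_roots. ?g \<beta> < 0} \<le> card (?N - {\<alpha> s})"
      using sub fin by (meson surj_card_le)
    also have "\<dots> < card ?N" using less.prems s by (intro card_Diff1_less) auto
    finally have "?g \<in> tits_cone"
      using less.hyps[of ?g] linear_dual_act[of s f] less.prems s finite_subset[OF sub] fin by simp
    then obtain w h where w: "w \<in> carrier W" "h \<in> closed_fund_chamber" "?g = dual_act w h"
      by (auto simp: tits_cone_def)
    have "f = dual_act s ?g" using dual_act_inv[of s f] s by simp
    then have "f = dual_act (s \<otimes> w) h" using w s by (simp add: dual_act_mult)
    moreover have "s \<otimes> w \<in> carrier W" using w s by simp
    ultimately show ?thesis unfolding tits_cone_def using w(2) by blast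
  qed
qed

lemma tits_cone_iff: "f \<in> tits_cone \<longleftrightarrow> linear f \<and> finite {\<beta> \<in> pos_roots. f \<beta> < 0}"
proof
  assume f: "f \<in> tits_cone"
  then obtain w where w: "w \<in> carrier W" "\<And>\<beta>. \<beta> \<in> pos_roots \<Longrightarrow> f \<beta> < 0 \<Longrightarrow> \<beta> \<in> inversions w"
    using tits_cone_negative_inversions by metis
  have "{\<beta> \<in> pos_roots. f \<beta> < 0} \<subseteq> inversions w" using w(2) by blast
  then show "linear f \<and> finite {\<beta> \<in> pos_roots. f \<beta> < 0}"
    using linear_tits_cone[OF f] finite_subset finite_inversions[OF w(1)] by blast
qed (use tits_cone_if_finite_negative in blast)

lemma tits_cone_segment:
  assumes "f \<in> tits_cone" "g \<in> tits_cone" "a \<ge> 0" "b \<ge> (0::real)"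
  shows "(\<lambda>v. a * f v + b * g v) \<in> tits_cone"
proof -
  have l: "linear f" "linear g" using assms linear_tits_cone by auto
  have "linear (\<lambda>v. a * f v + b * g v)"
    by (rule linearI) (simp_all add: linear_add[OF l(1)] linear_add[OF l(2)] linear_scale[OF l(1)]
      linear_scale[OF l(2)] algebra_simps)
  moreover have "{\<beta> \<in> pos_roots. a * f \<beta> + b * g \<beta> < 0} \<subseteq>
      {\<beta> \<in> pos_roots. f \<beta> < 0} \<union> {\<beta> \<in> pos_roots. g \<beta> < 0}"
  proof safe
    fix \<beta> assume n: "a * f \<beta> + b * g \<beta> < 0" "\<not> g \<beta> < 0"
    show "f \<beta> < 0"
    proof (rule ccontr)
      assume "\<not> f \<beta> < 0"
      then have "0 \<le> a * f \<beta> + b * g \<beta>" using assms n(2) by (intro add_nonneg_nonneg mult_nonneg_nonneg) auto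
      then show False using n by simp
    qed
  qed
  ultimately show ?thesis using assms(1,2) by (auto simp: tits_cone_iff intro: finite_subset)
qed

section \<open>Hyperplanes, regions and chambers\<close>

lemma hyperplane_eq:
  assumes \<beta>: "\<beta> \<in> roots"
  shows "hyperplane \<beta> = {f \<in> tits_cone. f \<beta> = 0}"
proof -
  have "dual_act (reflection \<beta>) f = f \<longleftrightarrow> f \<beta> = 0" if l: "linear f" for f
  proof -
    have e: "dual_act (reflection \<beta>) f v = f v - 2 * B \<beta> v * f \<beta>" for v
      using \<beta> by (simp add: dual_act_def inv_reflection act_reflection reflect_def
        linear_diff[OF l] linear_scale[OF l])
    show ?thesis
    proof
      assume "dual_act (reflection \<beta>) f = f"
      then show "f \<beta> = 0" using e[of \<beta>] root_unit[OF \<beta>] by simp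
    qed (auto simp: e)
  qed
  then show ?thesis unfolding hyperplane_def using linear_tits_cone by auto
qed

definition shi_complement :: "nat \<Rightarrow> ('v \<Rightarrow> real) set" where
  "shi_complement m = {f \<in> tits_cone. \<forall>\<beta> \<in> small_roots m. f \<beta> \<noteq> 0}"

lemma shi_regions_eq: "shi_regions m = components (shi_complement m)"
proof -
  have "tits_cone - \<Union> (shi_arrangement m) = shi_complement m"
    unfolding shi_arrangement_def shi_complement_def
    using hyperplane_eq pos_rootsD(1)[OF small_roots_pos] by auto
  then show ?thesis by (simp add: shi_regions_def)
qed

lemma same_sign_in_component:
  assumes "connected_component (shi_complement m) f g" "\<beta> \<in> small_roots m"
  shows "f \<beta> < 0 \<longleftrightarrow> g \<beta> < 0"
proof -
  obtain T where T: "connected T" "T \<subseteq> shi_complement m" "f \<in> T" "g \<in> T"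
    using assms(1) by (auto simp: connected_component_def)
  let ?I = "(\<lambda>h. h \<beta>) ` T"
  have "continuous_on T (\<lambda>h :: 'v \<Rightarrow> real. h \<beta>)"
    by (rule continuous_on_subset[OF continuous_on_product_coordinates]) simp
  then have "connected ?I" using T(1) by (rule connected_continuous_image)
  moreover have "0 \<notin> ?I" using T(2) assms(2) by (auto simp: shi_complement_def)
  ultimately have "\<not> (x \<in> ?I \<and> y \<in> ?I \<and> x < 0 \<and> y \<ge> 0)" for x y
    by (meson connectedD_interval less_imp_le)
  then show ?thesis using T(3,4) by (meson imageI not_le)
qed

lemma same_signs_connected:
  assumes f: "f \<in> shi_complement m" and g: "g \<in> shi_complement m"
    and sgn: "\<And>\<beta>. \<beta> \<in> small_roots m \<Longrightarrow> f \<beta> < 0 \<longleftrightarrow> g \<beta> < 0"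
  shows "connected_component (shi_complement m) f g"
proof -
  define p where "p s = (\<lambda>v. (1 - s) * f v + s * g v)" for s :: real
  have "continuous_on {0..1} p" unfolding p_def
    by (intro continuous_on_coordinatewise_then_product continuous_intros)
  then have "connected (p ` {0..1})" by (rule connected_continuous_image) simp
  moreover have "p ` {0..1} \<subseteq> shi_complement m"
  proof safe
    fix s :: real assume s: "s \<in> {0..1}"
    have "p s \<in> tits_cone" unfolding p_def
      using tits_cone_segment[of f g "1 - s" s] f g s by (simp add: shi_complement_def)
    moreover have "p s \<beta> \<noteq> 0" if b: "\<beta> \<in> small_roots m" for \<beta>
    proof -
      have nz: "f \<beta> \<noteq> 0" "g \<beta> \<noteq> 0" using f g b by (auto simp: shi_complement_def)
      show ?thesis
      proof (cases "f \<beta> < 0")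
        case True
        then have "(1 - s) * f \<beta> + s * g \<beta> < 0" using sgn[OF b] s
          by (cases "s = 1") (auto intro!: add_neg_nonpos mult_pos_neg mult_nonneg_nonpos)
        then show ?thesis by (simp add: p_def)
      next
        case False
        then have "(1 - s) * f \<beta> + s * g \<beta> > 0" using sgn[OF b] nz s
          by (cases "s = 1") (auto intro!: add_pos_nonneg mult_pos_pos mult_nonneg_nonneg)
        then show ?thesis by (simp add: p_def)
      qed
    qed
    ultimately show "p s \<in> shi_complement m" by (simp add: shi_complement_def)
  qed
  moreover have "p 0 = f" "p 1 = g" by (auto simp: p_def)
  then have "f \<in> p ` {0..1}" "g \<in> p ` {0..1}" by force+
  ultimately show ?thesis by (auto simp: connected_component_def)
qed

lemma chamber_sign:
  assumes w: "w \<in> carrier W" and f: "f \<in> chamber w" and \<beta>: "\<beta> \<in> pos_roots"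
  shows "f \<beta> \<noteq> 0" "f \<beta> < 0 \<longleftrightarrow> \<beta> \<in> inversions w"
proof -
  obtain g where g: "g \<in> fund_chamber" "f = dual_act w g" using f by (auto simp: chamber_def)
  have l: "linear g" using g by (simp add: fund_chamber_def)
  have iv: "inv w \<in> carrier W" using w by simp
  have r: "act (inv w) \<beta> \<in> roots" using roots_act[OF iv] pos_rootsD[OF \<beta>] by simp
  have "f \<beta> \<noteq> 0 \<and> (f \<beta> < 0 \<longleftrightarrow> f0 (act (inv w) \<beta>) < 0)"
  proof (cases "f0 (act (inv w) \<beta>) > 0")
    case True
    then have "g (act (inv w) \<beta>) > 0" using fund_chamber_pos[OF g(1)] r by (simp add: pos_roots_iff)
    then show ?thesis using True by (simp add: g(2) dual_act_def)
  next
    case False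
    then have n: "f0 (act (inv w) \<beta>) < 0" using f0_root_nonzero[OF r] by simp
    then have "g (- act (inv w) \<beta>) > 0" using fund_chamber_pos[OF g(1)] roots_uminus[OF r] by (simp add: pos_roots_iff)
    then show ?thesis using n by (simp add: g(2) dual_act_def linear_neg[OF l])
  qed
  then show "f \<beta> \<noteq> 0" "f \<beta> < 0 \<longleftrightarrow> \<beta> \<in> inversions w" using w \<beta> by (auto simp: inversions_iff)
qed

lemma chamber_subset_complement:
  assumes w: "w \<in> carrier W"
  shows "chamber w \<subseteq> shi_complement m"
proof
  fix f assume f: "f \<in> chamber w"
  have "fund_chamber \<subseteq> closed_fund_chamber"
    by (auto simp: fund_chamber_def closed_fund_chamber_def intro: less_imp_le)
  then have "f \<in> tits_cone" using f w unfolding chamber_def tits_cone_def by blast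
  then show "f \<in> shi_complement m"
    using chamber_sign(1)[OF w f] small_roots_pos by (auto simp: shi_complement_def)
qed

lemma dual_act_f0_chamber: "dual_act w f0 \<in> chamber w"
  by (auto simp: chamber_def fund_chamber_def simple_roots_def f0_linear f0_simple)

lemma chamber_subset_component_iff:
  assumes u: "u \<in> carrier W" and w: "w \<in> carrier W" and f: "f \<in> shi_complement m"
    and sgn: "\<And>\<beta>. \<beta> \<in> small_roots m \<Longrightarrow> f \<beta> < 0 \<longleftrightarrow> \<beta> \<in> inversions w"
  shows "chamber u \<subseteq> connected_component_set (shi_complement m) f \<longleftrightarrow>
    small_roots m \<inter> inversions u = small_roots m \<inter> inversions w"
proof
  assume "chamber u \<subseteq> connected_component_set (shi_complement m) f"
  then have "connected_component (shi_complement m) f (dual_act u f0)"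
    using dual_act_f0_chamber by auto
  then have "f \<beta> < 0 \<longleftrightarrow> \<beta> \<in> inversions u" if "\<beta> \<in> small_roots m" for \<beta>
    using same_sign_in_component that chamber_sign(2)[OF u dual_act_f0_chamber small_roots_pos] by blast
  then show "small_roots m \<inter> inversions u = small_roots m \<inter> inversions w" using sgn by blast
next
  assume eq: "small_roots m \<inter> inversions u = small_roots m \<inter> inversions w"
  show "chamber u \<subseteq> connected_component_set (shi_complement m) f"
  proof
    fix g assume g: "g \<in> chamber u"
    have "connected_component (shi_complement m) f g"
    proof (rule same_signs_connected[OF f])
      show "g \<in> shi_complement m" using chamber_subset_complement[OF u] g by blast
      show "f \<beta> < 0 \<longleftrightarrow> g \<beta> < 0" if "\<beta> \<in> small_roots m" for \<beta>
        using sgn[OF that] chamber_sign(2)[OF u g small_roots_pos[OF that]] eq that by blast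
    qed
    then show "g \<in> connected_component_set (shi_complement m) f" by simp
  qed
qed

text \<open>A region is only known to contain a point \<open>f\<close>, possibly on walls. Small
  roots do not vanish at \<open>f\<close>, so any closed chamber containing \<open>f\<close> has
  their signs, and its open chamber lies in the region.\<close>

lemma region_inversions:
  assumes "R \<in> shi_regions m"
  obtains w where "w \<in> carrier W"
    "\<And>u. u \<in> carrier W \<Longrightarrow>
      chamber u \<subseteq> R \<longleftrightarrow> small_roots m \<inter> inversions u = small_roots m \<inter> inversions w"
proof -
  obtain f where f: "f \<in> shi_complement m" "R = connected_component_set (shi_complement m) f"
    using assms by (auto simp: shi_regions_eq components_def)
  then have "f \<in> tits_cone" by (simp add: shi_complement_def)
  then obtain w where w: "w \<in> carrier W" "\<And>\<beta>. \<beta> \<in> pos_roots \<Longrightarrow> f \<beta> < 0 \<Longrightarrow> \<beta> \<in> inversions w"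
    "\<And>\<beta>. \<beta> \<in> pos_roots \<Longrightarrow> \<beta> \<in> inversions w \<Longrightarrow> f \<beta> \<le> 0"
    using tits_cone_negative_inversions by metis
  have "f \<beta> < 0 \<longleftrightarrow> \<beta> \<in> inversions w" if b: "\<beta> \<in> small_roots m" for \<beta>
    using w(2,3)[OF small_roots_pos[OF b]] f(1) b by (fastforce simp: shi_complement_def)
  then show ?thesis using that[OF w(1)] chamber_subset_component_iff[OF _ w(1) f(1)] unfolding f(2) by blast
qed

lemma region_of_element:
  assumes w: "w \<in> carrier W"
  obtains R where "R \<in> shi_regions m"
    "\<And>u. u \<in> carrier W \<Longrightarrow>
      chamber u \<subseteq> R \<longleftrightarrow> small_roots m \<inter> inversions u = small_roots m \<inter> inversions w"
proof -
  let ?f = "dual_act w f0"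
  have f: "?f \<in> shi_complement m" using chamber_subset_complement[OF w] dual_act_f0_chamber by blast
  have "?f \<beta> < 0 \<longleftrightarrow> \<beta> \<in> inversions w" if "\<beta> \<in> small_roots m" for \<beta>
    using chamber_sign(2)[OF w dual_act_f0_chamber small_roots_pos[OF that]] .
  then show ?thesis
    using that[of "connected_component_set (shi_complement m) ?f"] f chamber_subset_component_iff[OF _ w f]
    by (auto simp: shi_regions_eq components_def)
qed

text \<open>Elements of minimal length are low, so the inversion set of one is contained in those of
  all elements of the region. Two of them have nested inversion sets of equal size.\<close>

lemma region_unique_min_low:
  assumes w: "w \<in> carrier W" and R: "\<And>u. u \<in> carrier W \<Longrightarrow>
      chamber u \<subseteq> R \<longleftrightarrow> small_roots m \<inter> inversions u = small_roots m \<inter> inversions w"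
  shows "\<exists>!u. min_length_in R u"
    and "min_length_in R u \<Longrightarrow> u \<in> low_elements m"
    and "u \<in> carrier W \<Longrightarrow> chamber u \<subseteq> R \<Longrightarrow> u \<in> low_elements m \<Longrightarrow> min_length_in R u"
proof -
  have low: "u \<in> low_elements m" if "min_length_in R u" for u
    using that R by (intro min_class_low) (auto simp: min_length_in_def is_arg_min_linorder)
  then show "min_length_in R u \<Longrightarrow> u \<in> low_elements m" .
  show "min_length_in R u" if u: "u \<in> carrier W" "chamber u \<subseteq> R" "u \<in> low_elements m"
    unfolding min_length_in_def is_arg_min_linorder
  proof (intro conjI allI impI u)
    fix v assume v: "v \<in> carrier W \<and> chamber v \<subseteq> R"
    then have "inversions u \<subseteq> inversions v" using low_class_min[OF u(3), of v] R[of u] R[of v] u by blast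
    then show "len u \<le> len v" using v u by (simp add: len_card card_mono)
  qed
  have "chamber w \<subseteq> R" using R[OF w] by simp
  then obtain u where u: "min_length_in R u"
    unfolding min_length_in_def using ex_has_least_nat[of "\<lambda>u. u \<in> carrier W \<and> chamber u \<subseteq> R" w len] w
    by (auto simp: is_arg_min_linorder)
  show "\<exists>!u. min_length_in R u"
  proof (rule ex1I)
    show "min_length_in R u" by (rule u)
    fix v assume v: "min_length_in R v"
    have c: "u \<in> carrier W" "v \<in> carrier W" "chamber u \<subseteq> R" "chamber v \<subseteq> R"
      "len u \<le> len v" "len v \<le> len u"
      using u v by (simp_all add: min_length_in_def is_arg_min_linorder)
    then have "inversions u \<subseteq> inversions v"
      using low_class_min[OF low[OF u], of v] R[of u] R[of v] by blast
    moreover have "card (inversions u) = card (inversions v)" using c len_card by simp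
    ultimately have "inversions u = inversions v" using c by (intro card_subset_eq) simp_all
    then show "v = u" using inversions_inject c by metis
  qed
qed

end

theorem theorem1p1:
  fixes W :: "('a, 'z) monoid_scheme" and S :: "'a set"
    and act :: "'a \<Rightarrow> 'v::real_vector \<Rightarrow> 'v" and B :: "'v \<Rightarrow> 'v \<Rightarrow> real" and \<alpha> :: "'a \<Rightarrow> 'v"
    and m :: nat
  assumes "geometric_representation W S act B \<alpha>"
  shows "(\<forall>R \<in> geometric_representation.shi_regions W S act B \<alpha> m.
            \<exists>!w. geometric_representation.min_length_in W S act \<alpha> R w) \<and>
         {w. \<exists>R \<in> geometric_representation.shi_regions W S act B \<alpha> m.
               geometric_representation.min_length_in W S act \<alpha> R w} =
         geometric_representation.low_elements W S act B \<alpha> m"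
proof -
  interpret geometric_representation W S act B \<alpha> by fact
  have "\<exists>!w. min_length_in R w" if "R \<in> shi_regions m" for R
    using region_inversions[OF that] region_unique_min_low(1) by metis
  moreover have "w \<in> low_elements m" if "R \<in> shi_regions m" "min_length_in R w" for R w
    using region_inversions[OF that(1)] region_unique_min_low(2) that(2) by metis
  moreover have "\<exists>R \<in> shi_regions m. min_length_in R w" if w: "w \<in> low_elements m" for w
  proof -
    have wW: "w \<in> carrier W" using w by (simp add: low_elements_def)
    obtain R where R: "R \<in> shi_regions m" "\<And>u. u \<in> carrier W \<Longrightarrow>
      chamber u \<subseteq> R \<longleftrightarrow> small_roots m \<inter> inversions u = small_roots m \<inter> inversions w"
      using region_of_element[OF wW] by blast
    have "chamber w \<subseteq> R" using R(2)[OF wW] by simp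
    then show ?thesis using region_unique_min_low(3)[OF wW R(2) wW _ w] R(1) by blast
  qed
  ultimately show ?thesis by blast
qed

end
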